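(* Let $m,n\ge 1$ be integers with $(m,n)\neq(1,1)$ and let $(R,{}^-)$ be a unital associative $\Bbbk$-superalgebra with superinvolution. Then the canonical homomorphism $\psi:\mathfrak{sto}_{m|2n}(R,{}^-)\to\mathfrak{osp}_{m|2n}(R,{}^-)$ is a central extension, and $\ker\psi\cong{}_{-}\mathrm{HD}_1(R,{}^-)$ as $\Bbbk$-modules.
   Context: **Base conventions.** $\Bbbk$ is a unital commutative associative ring in which $2$ is invertible; all modules and (super)algebras are over $\Bbbk$. Superalgebras are $\mathbb{Z}/2\mathbb{Z}$-graded, $|x|$ is the degree of a homogeneous $x$, and formulas involving degrees are for homogeneous elements, extended linearly. A Lie superalgebra has an even bilinear bracket with $[x,y]=-(-1)^{|x||y|}[y,x]$ and $(-1)^{|x||z|}[[x,y],z]+(-1)^{|y||x|}[[y,z],x]+(-1)^{|z||y|}[[z,x],y]=0$. A superinvolution on $R$ is a degree-preserving $\Bbbk$-linear map $a\mapsto\bar a$ with $\overline{ab}=(-1)^{|a||b|}\bar b\bar a$, $\bar{\bar a}=a$. In $R$, $[a,b]=ab-(-1)^{|a||b|}ba$. Put $\rho(a)=(-1)^{|a|}a$. **$\mathfrak{osp}_{m|2n}(R,{}^-)$.** $\mathrm{M}_{m|2n}(R)$ is the superalgebra of $(m+2n)\times(m+2n)$ matrices over $R$ with usual matrix multiplication; $e_{ij}(a)$ (entry $a$ at $(i,j)$) has degree $|i|+|j|+|a|$, with $|i|=0$ for $i\le m$, $|i|=1$ for $i>m$. With blocks of sizes $m,n,n$ let $$\begin{pmatrix}A&B_1&C_2\\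 C_1&D_{11}&D_{12}\\ B_2&D_{21}&D_{22}\end{pmatrix}^{\mathrm{osp}}=\begin{pmatrix}\overline{A}^t&-\overline{\rho(B_2)}^t&\overline{\rho(C_1)}^t\\ \overline{\rho(C_2)}^t&\overline{D_{22}}^t&-\overline{D_{12}}^t\\ -\overline{\rho(B_1)}^t&-\overline{D_{21}}^t&\overline{D_{11}}^t\end{pmatrix}$$ ($\rho$ and ${}^-$ applied entrywise). $\widetilde{\mathfrak{osp}}_{m|2n}(R,{}^-)=\{X: X^{\mathrm{osp}}=-X\}$ is a Lie superalgebra under the supercommutator, and $\mathfrak{osp}_{m|2n}(R,{}^-)=[\widetilde{\mathfrak{osp}}_{m|2n}(R,{}^-),\widetilde{\mathfrak{osp}}_{m|2n}(R,{}^-)]$. It is generated by the elements below ($i\ne j$ for $t$; $k\neq l$ for $u,v,w$): $t_{ij}(a)=e_{ij}(a)-e_{ji}(\bar a)$, $u_{kl}(a)=e_{m+k,m+l}(a)-e_{m+n+l,m+n+k}(\bar a)$, $v_{kl}(a)=e_{m+k,m+n+l}(a)+e_{m+l,m+n+k}(\bar a)$, $w_{kl}(a)=e_{m+n+k,m+l}(a)+e_{m+n+l,m+k}(\bar a)$, $f_{ik}(a)=e_{i,m+k}(a)+e_{m+n+k,i}(\rho(\bar a))$, $g_{ki}(a)=e_{m+k,i}(a)-e_{i,m+n+k}(\rho(\bar a))$. **$\mathfrak{sto}_{m|2n}(R,{}^-)$.** The Lie superalgebra generated by $\mathbf t_{ij}(a),\mathbf u_{kl}(a),\mathbf v_{kl}(a),\mathbf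 w_{kl}(a)$ of degree $|a|$ ($i\neq j$, $k\ne l$) and $\mathbf f_{ik}(a),\mathbf g_{ki}(a)$ of degree $1+|a|$ (all $i,k$), $a\in R$ homogeneous, $1\le i,j\le m$, $1\le k,l\le n$, with relations (indices $i,j,i',j'\in\{1,\dots,m\}$, $k,l,k',l'\in\{1,\dots,n\}$; $a,b\in R$ homogeneous; a chain such as $k\ne l\ne k'$ only means consecutive indices differ): - all generators are $\Bbbk$-linear in $a$; $\mathbf t_{ij}(a)=-\mathbf t_{ji}(\bar a)$ ($i\ne j$); $\mathbf v_{kl}(a)=\mathbf v_{lk}(\bar a)$, $\mathbf w_{kl}(a)=\mathbf w_{lk}(\bar a)$ ($k\neq l$); - $[\mathbf t_{ii'}(a),\mathbf t_{i'j}(b)]=\mathbf t_{ij}(ab)$ ($i,i',j$ distinct); $[\mathbf t_{ij}(a),\mathbf t_{i'j'}(b)]=0$ ($i,j,i',j'$ distinct); - $[\mathbf t_{ij}(a),\mathbf u_{kl}(b)]=[\mathbf t_{ij}(a),\mathbf v_{kl}(b)]=[\mathbf t_{ij}(a),\mathbf w_{kl}(b)]=0$ ($i\ne j$, $k\ne l$); - $[\mathbf u_{kk'}(a),\mathbf u_{k'l}(b)]=\mathbf u_{kl}(ab)$ ($k,k',l$ distinct); $[\mathbf u_{kl}(a),\mathbf u_{k'l'}(b)]=0$ ($k\ne l\ne k'\ne l'\ne k$); - $[\mathbf u_{kk'}(a),\mathbf v_{k'l}(b)]=\mathbf v_{kl}(ab)$ ($k,k',l$ distinct); $[\mathbf u_{kl}(a),\mathbf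 v_{k'l'}(b)]=0$ ($k\ne l\ne k'\ne l'\ne l$); - $[\mathbf w_{lk'}(a),\mathbf u_{k'k}(b)]=\mathbf w_{lk}(ab)$ ($k,k',l$ distinct); $[\mathbf w_{l'k'}(a),\mathbf u_{lk}(b)]=0$ ($k\ne l\ne k'\ne l'\ne l$); - $[\mathbf v_{kl}(a),\mathbf v_{k'l'}(b)]=[\mathbf w_{kl}(a),\mathbf w_{k'l'}(b)]=0$ ($k\ne l$, $k'\ne l'$); - $[\mathbf v_{kk'}(a),\mathbf w_{k'l}(b)]=\mathbf u_{kl}(ab)$ ($k,k',l$ distinct); $[\mathbf v_{kl}(a),\mathbf w_{k'l'}(b)]=0$ ($k,l,k',l'$ distinct); - $[\mathbf t_{ij}(a),\mathbf f_{i'k}(b)]=\delta_{i'j}\mathbf f_{ik}(ab)-\delta_{i'i}\mathbf f_{jk}(\bar ab)$, $[\mathbf g_{ki'}(a),\mathbf t_{ij}(b)]=\delta_{i'i}\mathbf g_{kj}(ab)-\delta_{i'j}\mathbf g_{ki}(a\bar b)$ ($i\ne j$); - for $k\neq l$: $[\mathbf f_{ik'}(a),\mathbf u_{kl}(b)]=\delta_{kk'}\mathbf f_{il}(ab)$; $[\mathbf u_{lk}(a),\mathbf g_{k'i}(b)]=\delta_{k'k}\mathbf g_{li}(ab)$; $[\mathbf v_{kl}(a),\mathbf f_{il'}(b)]=(-1)^{|b|}(\delta_{l'l}\mathbf g_{ki}(a\bar b)+\delta_{l'k}\mathbf g_{li}(\bar a\bar b))$; $[\mathbf g_{k'i}(a),\mathbf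 v_{kl}(b)]=0$; $[\mathbf w_{kl}(a),\mathbf f_{ik'}(b)]=0$; $[\mathbf g_{k'i}(a),\mathbf w_{kl}(b)]=-(-1)^{|a|}(\delta_{k'k}\mathbf f_{il}(\bar ab)+\delta_{k'l}\mathbf f_{ik}(\bar a\bar b))$; - $[\mathbf f_{ik}(a),\mathbf f_{il}(b)]=(-1)^{|a|}\mathbf w_{kl}(\bar ab)$ ($k\ne l$); $[\mathbf f_{ik}(a),\mathbf f_{jl}(b)]=0$ ($i\ne j$); $[\mathbf g_{ki}(a),\mathbf g_{li}(b)]=-(-1)^{|b|}\mathbf v_{kl}(a\bar b)$ ($k\ne l$); $[\mathbf g_{ki}(a),\mathbf g_{lj}(b)]=0$ ($i\ne j$); - $[\mathbf f_{ik}(a),\mathbf g_{lj}(b)]=\delta_{kl}\mathbf t_{ij}(ab)$ ($i\ne j$); $[\mathbf g_{ki}(a),\mathbf f_{il}(b)]=\mathbf u_{kl}(ab)$ ($k\ne l$). **$\psi$.** The homomorphism sending $\mathbf t_{ij}(a),\mathbf u_{kl}(a),\mathbf v_{kl}(a),\mathbf w_{kl}(a),\mathbf f_{ik}(a),\mathbf g_{ki}(a)$ to $t_{ij}(a),u_{kl}(a),v_{kl}(a),w_{kl}(a),f_{ik}(a),g_{ki}(a)$. **Central extension**: a surjective homomorphism of Lie superalgebras whose kernel lies in the center of the source. **First $\mathbb{Z}/2\mathbb{Z}$-graded skew-dihedral homology.** Let $I_{\mathsf d}^-\subseteq R\otimes_\Bbbk R$ be the submodule spanned by $a\otimes b-\bar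 a\otimes\bar b$, $a\otimes b+(-1)^{|a||b|}b\otimes a$ and $(-1)^{|a||c|}ab\otimes c+(-1)^{|a||b|}bc\otimes a+(-1)^{|b||c|}ca\otimes b$; let $\langle R,R\rangle_{\mathsf d}^-=(R\otimes_\Bbbk R)/I_{\mathsf d}^-$ with $\langle a,b\rangle_{\mathsf d}^-$ the class of $a\otimes b$. Then ${}_{-}\mathrm{HD}_1(R,{}^-)=\{\sum_i\langle a_i,b_i\rangle_{\mathsf d}^-:\ \sum_i[a_i,b_i]=\sum_i\overline{[a_i,b_i]}\}$. *)

theory Defs
  imports
    "HOL-Analysis.Finite_Cartesian_Product"
    "HOL-Library.Z2"
    "HOL-Library.Poly_Mapping"
    "HOL-Algebra.Module"
    "HOL-Algebra.AbelCoset"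
begin

section \<open>Superalgebras with superinvolution\<close>

text \<open>Degrees are elements of the two-element field \<^typ>\<open>bit\<close>, and \<open>koszul (d * e)\<close> is the sign
  $(-1)^{de}$.\<close>

definition koszul :: "bit \<Rightarrow> 'a::ring_1" where
  "koszul d = (if d = 1 then - 1 else 1)"

definition component :: "(bit \<Rightarrow> 'a::ab_group_add set) \<Rightarrow> bit \<Rightarrow> 'a \<Rightarrow> 'a" where
  "component gr d x = (THE y. y \<in> gr d \<and> x - y \<in> gr (d + 1))"

locale superalgebra_with_superinvolution =
  Modules.module scal
  for scal :: "'k::comm_ring_1 \<Rightarrow> 'r::ring_1 \<Rightarrow> 'r" +
  fixes gr :: "bit \<Rightarrow> 'r set"
    and bar :: "'r \<Rightarrow> 'r"
  assumes scale_mult_left: "scal c a * b = scal c (a * b)"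
    and scale_mult_right: "a * scal c b = scal c (a * b)"
    and gr_subspace: "subspace (gr d)"
    and gr_direct_sum: "\<exists>!(x0, x1). x0 \<in> gr 0 \<and> x1 \<in> gr 1 \<and> x = x0 + x1"
    and gr_mult: "\<lbrakk>a \<in> gr d; b \<in> gr e\<rbrakk> \<Longrightarrow> a * b \<in> gr (d + e)"
    and bar_linear: "Modules.module_hom scal scal bar"
    and bar_gr: "a \<in> gr d \<Longrightarrow> bar a \<in> gr d"
    and bar_mult: "\<lbrakk>a \<in> gr d; b \<in> gr e\<rbrakk> \<Longrightarrow> bar (a * b) = koszul (d * e) * (bar b * bar a)"
    and bar_bar: "bar (bar a) = a"

definition rho :: "(bit \<Rightarrow> 'r::ring_1 set) \<Rightarrow> 'r \<Rightarrow> 'r" where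
  "rho gr a = component gr 0 a - component gr 1 a"

definition ring_scomm :: "(bit \<Rightarrow> 'r::ring_1 set) \<Rightarrow> 'r \<Rightarrow> 'r \<Rightarrow> 'r" where
  "ring_scomm gr a b = (\<Sum>d\<in>{0, 1}. \<Sum>e\<in>{0, 1}.
     component gr d a * component gr e b
       - koszul (d * e) * (component gr e b * component gr d a))"


section \<open>Modules and Lie superalgebras over the base ring\<close>

text \<open>The quotients below are not types, so they live on carrier sets, as records over the scalars
  \<^typ>\<open>'k\<close>. The record fields \<open>mult\<close> and \<open>one\<close> of modules are irrelevant and left undefined.\<close>

abbreviation base_ring :: "'k::comm_ring_1 ring" where
  "base_ring \<equiv> \<lparr>carrier = UNIV, mult = (*), one = 1, zero = 0, add = (+)\<rparr>"

definition submodule_span :: "('k::comm_ring_1, 'a, 'z) module_scheme \<Rightarrow> 'a set \<Rightarrow> 'a set" where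
  "submodule_span M S = \<Inter>{N. submodule N base_ring M \<and> S \<subseteq> N}"

definition quotient_module ::
  "('k::comm_ring_1, 'a, 'z) module_scheme \<Rightarrow> 'a set \<Rightarrow> ('k, 'a set) module" where
  "quotient_module M N =
    \<lparr>carrier = a_rcosets\<^bsub>M\<^esub> N, mult = undefined, one = undefined, zero = N, add = set_add M,
     smult = (\<lambda>c C. \<Union>x\<in>C. N +>\<^bsub>M\<^esub> (c \<odot>\<^bsub>M\<^esub> x))\<rparr>"

definition modules_isomorphic ::
  "('k::comm_ring_1, 'a, 'y) module_scheme \<Rightarrow> ('k, 'b, 'z) module_scheme \<Rightarrow> bool" where
  "modules_isomorphic M N \<longleftrightarrow> (\<exists>h. bij_betw h (carrier M) (carrier N) \<and>
     (\<forall>x\<in>carrier M. \<forall>y\<in>carrier M. h (x \<oplus>\<^bsub>M\<^esub> y) = h x \<oplus>\<^bsub>N\<^esub> h y) \<and>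
     (\<forall>c. \<forall>x\<in>carrier M. h (c \<odot>\<^bsub>M\<^esub> x) = c \<odot>\<^bsub>N\<^esub> h x))"

record ('k, 'a) lie_super = "('k, 'a) module" +
  bracket :: "'a \<Rightarrow> 'a \<Rightarrow> 'a"
  grade :: "bit \<Rightarrow> 'a set"

locale lie_superalgebra =
  Module.module "base_ring :: 'k::comm_ring_1 ring" L
  for L :: "('k::comm_ring_1, 'a, 'z) lie_super_scheme" (structure) +
  assumes grade_submodule: "submodule (grade L d) base_ring L"
    and grade_direct_sum:
      "x \<in> carrier L \<Longrightarrow> \<exists>!(x0, x1). x0 \<in> grade L 0 \<and> x1 \<in> grade L 1 \<and> x = x0 \<oplus> x1"
    and bracket_closed: "\<lbrakk>x \<in> carrier L; y \<in> carrier L\<rbrakk> \<Longrightarrow> bracket L x y \<in> carrier L"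
    and bracket_grade:
      "\<lbrakk>x \<in> grade L d; y \<in> grade L e\<rbrakk> \<Longrightarrow> bracket L x y \<in> grade L (d + e)"
    and bracket_add_left: "\<lbrakk>x \<in> carrier L; y \<in> carrier L; z \<in> carrier L\<rbrakk> \<Longrightarrow>
      bracket L (x \<oplus> y) z = bracket L x z \<oplus> bracket L y z"
    and bracket_add_right: "\<lbrakk>x \<in> carrier L; y \<in> carrier L; z \<in> carrier L\<rbrakk> \<Longrightarrow>
      bracket L x (y \<oplus> z) = bracket L x y \<oplus> bracket L x z"
    and bracket_smult_left: "\<lbrakk>x \<in> carrier L; y \<in> carrier L\<rbrakk> \<Longrightarrow>
      bracket L (c \<odot>\<^bsub>L\<^esub> x) y = c \<odot>\<^bsub>L\<^esub> bracket L x y"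
    and bracket_smult_right: "\<lbrakk>x \<in> carrier L; y \<in> carrier L\<rbrakk> \<Longrightarrow>
      bracket L x (c \<odot>\<^bsub>L\<^esub> y) = c \<odot>\<^bsub>L\<^esub> bracket L x y"
    and super_antisym: "\<lbrakk>x \<in> grade L d; y \<in> grade L e\<rbrakk> \<Longrightarrow>
      bracket L x y = (- koszul (d * e)) \<odot>\<^bsub>L\<^esub> bracket L y x"
    and super_jacobi: "\<lbrakk>x \<in> grade L d; y \<in> grade L e; z \<in> grade L f\<rbrakk> \<Longrightarrow>
      koszul (d * f) \<odot>\<^bsub>L\<^esub> bracket L (bracket L x y) z
      \<oplus> koszul (e * d) \<odot>\<^bsub>L\<^esub> bracket L (bracket L y z) x
      \<oplus> koszul (f * e) \<odot>\<^bsub>L\<^esub> bracket L (bracket L z x) y = \<zero>"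

definition lie_super_hom ::
  "('k::comm_ring_1, 'a, 'y) lie_super_scheme \<Rightarrow> ('k, 'b, 'z) lie_super_scheme \<Rightarrow> ('a \<Rightarrow> 'b) \<Rightarrow> bool"
where
  "lie_super_hom L L' f \<longleftrightarrow>
     (\<forall>x\<in>carrier L. f x \<in> carrier L') \<and>
     (\<forall>x\<in>carrier L. \<forall>y\<in>carrier L. f (x \<oplus>\<^bsub>L\<^esub> y) = f x \<oplus>\<^bsub>L'\<^esub> f y) \<and>
     (\<forall>c. \<forall>x\<in>carrier L. f (c \<odot>\<^bsub>L\<^esub> x) = c \<odot>\<^bsub>L'\<^esub> f x) \<and>
     (\<forall>x\<in>carrier L. \<forall>y\<in>carrier L. f (bracket L x y) = bracket L' (f x) (f y)) \<and>
     (\<forall>d. \<forall>x\<in>grade L d. f x \<in> grade L' d)"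

definition lie_center :: "('k::comm_ring_1, 'a, 'z) lie_super_scheme \<Rightarrow> 'a set" where
  "lie_center L = {z \<in> carrier L. \<forall>x\<in>carrier L. bracket L z x = \<zero>\<^bsub>L\<^esub>}"

definition central_extension ::
  "('k::comm_ring_1, 'a, 'y) lie_super_scheme \<Rightarrow> ('k, 'b, 'z) lie_super_scheme \<Rightarrow> ('a \<Rightarrow> 'b) \<Rightarrow> bool"
where
  "central_extension L L' f \<longleftrightarrow>
     lie_superalgebra L \<and> lie_superalgebra L' \<and> lie_super_hom L L' f \<and>
     f ` carrier L = carrier L' \<and> a_kernel L L' f \<subseteq> lie_center L"


section \<open>Lie superalgebras presented by generators and relations\<close>

text \<open>The presented Lie superalgebra is the set of formal Lie polynomials in the generators modulo the
  least congruence that contains the relations and the laws of Lie superalgebras. A set of generators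
  is given as a pair of sets \<open>X 0\<close>, \<open>X 1\<close> of even and odd generators.\<close>

datatype (dead 'k, gens: 'x) lie_term =
  Gen 'x
| Zero
| Add "('k, 'x) lie_term" "('k, 'x) lie_term"
| Smul 'k "('k, 'x) lie_term"
| Br "('k, 'x) lie_term" "('k, 'x) lie_term"

definition lie_terms :: "(bit \<Rightarrow> 'x set) \<Rightarrow> ('k, 'x) lie_term set" where
  "lie_terms X = {t. gens t \<subseteq> X 0 \<union> X 1}"

inductive homogeneous_term :: "(bit \<Rightarrow> 'x set) \<Rightarrow> bit \<Rightarrow> ('k, 'x) lie_term \<Rightarrow> bool"
  for X :: "bit \<Rightarrow> 'x set" where
  "x \<in> X d \<Longrightarrow> homogeneous_term X d (Gen x)"
| "homogeneous_term X d Zero"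
| "\<lbrakk>homogeneous_term X d s; homogeneous_term X d t\<rbrakk> \<Longrightarrow> homogeneous_term X d (Add s t)"
| "homogeneous_term X d s \<Longrightarrow> homogeneous_term X d (Smul c s)"
| "\<lbrakk>homogeneous_term X d s; homogeneous_term X e t\<rbrakk> \<Longrightarrow>
     homogeneous_term X (d + e) (Br s t)"

inductive_set lie_cong ::
  "(bit \<Rightarrow> 'x set) \<Rightarrow> (('k::comm_ring_1, 'x) lie_term \<times> ('k, 'x) lie_term) set \<Rightarrow>
   (('k, 'x) lie_term \<times> ('k, 'x) lie_term) set"
  for X :: "bit \<Rightarrow> 'x set" and Rel :: "(('k::comm_ring_1, 'x) lie_term \<times> ('k, 'x) lie_term) set"
where
  rel: "\<lbrakk>(s, t) \<in> Rel; s \<in> lie_terms X; t \<in> lie_terms X\<rbrakk> \<Longrightarrow> (s, t) \<in> lie_cong X Rel"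
| refl: "s \<in> lie_terms X \<Longrightarrow> (s, s) \<in> lie_cong X Rel"
| sym: "(s, t) \<in> lie_cong X Rel \<Longrightarrow> (t, s) \<in> lie_cong X Rel"
| trans: "\<lbrakk>(s, t) \<in> lie_cong X Rel; (t, u) \<in> lie_cong X Rel\<rbrakk> \<Longrightarrow> (s, u) \<in> lie_cong X Rel"
| cong_Add: "\<lbrakk>(s, s') \<in> lie_cong X Rel; (t, t') \<in> lie_cong X Rel\<rbrakk> \<Longrightarrow>
    (Add s t, Add s' t') \<in> lie_cong X Rel"
| cong_Smul: "(s, s') \<in> lie_cong X Rel \<Longrightarrow> (Smul c s, Smul c s') \<in> lie_cong X Rel"
| cong_Br: "\<lbrakk>(s, s') \<in> lie_cong X Rel; (t, t') \<in> lie_cong X Rel\<rbrakk> \<Longrightarrow>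
    (Br s t, Br s' t') \<in> lie_cong X Rel"
| add_assoc: "\<lbrakk>s \<in> lie_terms X; t \<in> lie_terms X; u \<in> lie_terms X\<rbrakk> \<Longrightarrow>
    (Add (Add s t) u, Add s (Add t u)) \<in> lie_cong X Rel"
| add_commute: "\<lbrakk>s \<in> lie_terms X; t \<in> lie_terms X\<rbrakk> \<Longrightarrow> (Add s t, Add t s) \<in> lie_cong X Rel"
| add_zero: "s \<in> lie_terms X \<Longrightarrow> (Add s Zero, s) \<in> lie_cong X Rel"
| add_inverse: "s \<in> lie_terms X \<Longrightarrow> (Add s (Smul (- 1) s), Zero) \<in> lie_cong X Rel"
| smul_add: "\<lbrakk>s \<in> lie_terms X; t \<in> lie_terms X\<rbrakk> \<Longrightarrow>
    (Smul c (Add s t), Add (Smul c s) (Smul c t)) \<in> lie_cong X Rel"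
| add_smul: "s \<in> lie_terms X \<Longrightarrow> (Smul (c + c') s, Add (Smul c s) (Smul c' s)) \<in> lie_cong X Rel"
| smul_smul: "s \<in> lie_terms X \<Longrightarrow> (Smul c (Smul c' s), Smul (c * c') s) \<in> lie_cong X Rel"
| smul_one: "s \<in> lie_terms X \<Longrightarrow> (Smul 1 s, s) \<in> lie_cong X Rel"
| br_add_left: "\<lbrakk>s \<in> lie_terms X; t \<in> lie_terms X; u \<in> lie_terms X\<rbrakk> \<Longrightarrow>
    (Br (Add s t) u, Add (Br s u) (Br t u)) \<in> lie_cong X Rel"
| br_add_right: "\<lbrakk>s \<in> lie_terms X; t \<in> lie_terms X; u \<in> lie_terms X\<rbrakk> \<Longrightarrow>
    (Br s (Add t u), Add (Br s t) (Br s u)) \<in> lie_cong X Rel"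
| br_smul_left: "\<lbrakk>s \<in> lie_terms X; t \<in> lie_terms X\<rbrakk> \<Longrightarrow>
    (Br (Smul c s) t, Smul c (Br s t)) \<in> lie_cong X Rel"
| br_smul_right: "\<lbrakk>s \<in> lie_terms X; t \<in> lie_terms X\<rbrakk> \<Longrightarrow>
    (Br s (Smul c t), Smul c (Br s t)) \<in> lie_cong X Rel"
| antisym: "\<lbrakk>homogeneous_term X d s; homogeneous_term X e t\<rbrakk> \<Longrightarrow>
    (Br s t, Smul (- koszul (d * e)) (Br t s)) \<in> lie_cong X Rel"
| jacobi: "\<lbrakk>homogeneous_term X d s; homogeneous_term X e t; homogeneous_term X f u\<rbrakk> \<Longrightarrow>
    (Add (Add (Smul (koszul (d * f)) (Br (Br s t) u))
              (Smul (koszul (e * d)) (Br (Br t u) s)))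
         (Smul (koszul (f * e)) (Br (Br u s) t)), Zero) \<in> lie_cong X Rel"

definition presented_lie_superalgebra ::
  "(bit \<Rightarrow> 'x set) \<Rightarrow> (('k::comm_ring_1, 'x) lie_term \<times> ('k, 'x) lie_term) set \<Rightarrow>
   ('k, ('k, 'x) lie_term set) lie_super"
where
  "presented_lie_superalgebra X Rel =
    \<lparr>carrier = lie_terms X // lie_cong X Rel, mult = undefined, one = undefined,
     zero = lie_cong X Rel `` {Zero},
     add = (\<lambda>A B. \<Union>s\<in>A. \<Union>t\<in>B. lie_cong X Rel `` {Add s t}),
     smult = (\<lambda>c A. \<Union>s\<in>A. lie_cong X Rel `` {Smul c s}),
     bracket = (\<lambda>A B. \<Union>s\<in>A. \<Union>t\<in>B. lie_cong X Rel `` {Br s t}),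
     grade = (\<lambda>d. {t. homogeneous_term X d t} // lie_cong X Rel)\<rparr>"


section \<open>The Lie superalgebra sto\<close>

text \<open>The index sets $\{1,\dots,m\}$ and $\{1,\dots,n\}$ are the finite types \<^typ>\<open>'m\<close> and
  \<^typ>\<open>'n\<close>; a generator is a kind together with its coefficient in \<open>R\<close>.\<close>

datatype ('m, 'n) kind = T 'm 'm | U 'n 'n | V 'n 'n | W 'n 'n | F 'm 'n | G 'n 'm

primrec valid_kind :: "('m, 'n) kind \<Rightarrow> bool" where
  "valid_kind (T i j) \<longleftrightarrow> i \<noteq> j"
| "valid_kind (U k l) \<longleftrightarrow> k \<noteq> l"
| "valid_kind (V k l) \<longleftrightarrow> k \<noteq> l"
| "valid_kind (W k l) \<longleftrightarrow> k \<noteq> l"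
| "valid_kind (F i k) \<longleftrightarrow> True"
| "valid_kind (G k i) \<longleftrightarrow> True"

primrec kind_degree :: "('m, 'n) kind \<Rightarrow> bit" where
  "kind_degree (T i j) = 0"
| "kind_degree (U k l) = 0"
| "kind_degree (V k l) = 0"
| "kind_degree (W k l) = 0"
| "kind_degree (F i k) = 1"
| "kind_degree (G k i) = 1"

type_synonym ('m, 'n, 'r) sto_generator = "('m, 'n) kind \<times> 'r"

text \<open>The generators with coefficient 0 occur both as even and as odd generators; they vanish by
  linearity.\<close>

definition sto_generators :: "(bit \<Rightarrow> 'r set) \<Rightarrow> bit \<Rightarrow> ('m, 'n, 'r) sto_generator set" where
  "sto_generators gr d =
    {(q, a). valid_kind q \<and> (\<exists>e. a \<in> gr e \<and> d = kind_degree q + e)}"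

abbreviation "gt i j a \<equiv> Gen (T i j, a)"
abbreviation "gu k l a \<equiv> Gen (U k l, a)"
abbreviation "gv k l a \<equiv> Gen (V k l, a)"
abbreviation "gw k l a \<equiv> Gen (W k l, a)"
abbreviation "gf i k a \<equiv> Gen (F i k, a)"
abbreviation "gg k i a \<equiv> Gen (G k i, a)"

definition delta :: "'i \<Rightarrow> 'i \<Rightarrow> 'k::comm_ring_1" where
  "delta i j = of_bool (i = j)"

inductive_set sto_relations ::
  "('k::comm_ring_1 \<Rightarrow> 'r::ring_1 \<Rightarrow> 'r) \<Rightarrow> (bit \<Rightarrow> 'r set) \<Rightarrow> ('r \<Rightarrow> 'r) \<Rightarrow>
   (('k, ('m, 'n, 'r) sto_generator) lie_term \<times> ('k, ('m, 'n, 'r) sto_generator) lie_term) set"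
  for scal :: "'k::comm_ring_1 \<Rightarrow> 'r::ring_1 \<Rightarrow> 'r" and gr :: "bit \<Rightarrow> 'r set" and bar :: "'r \<Rightarrow> 'r"
where
  linear: "\<lbrakk>valid_kind q; a \<in> gr d; b \<in> gr d\<rbrakk> \<Longrightarrow>
    (Gen (q, scal c a + scal c' b), Add (Smul c (Gen (q, a))) (Smul c' (Gen (q, b))))
      \<in> sto_relations scal gr bar"
| t_bar: "\<lbrakk>a \<in> gr d; i \<noteq> j\<rbrakk> \<Longrightarrow>
    (gt i j a, Smul (- 1) (gt j i (bar a))) \<in> sto_relations scal gr bar"
| v_bar: "\<lbrakk>a \<in> gr d; k \<noteq> l\<rbrakk> \<Longrightarrow> (gv k l a, gv l k (bar a)) \<in> sto_relations scal gr bar"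
| w_bar: "\<lbrakk>a \<in> gr d; k \<noteq> l\<rbrakk> \<Longrightarrow> (gw k l a, gw l k (bar a)) \<in> sto_relations scal gr bar"

| t_t: "\<lbrakk>a \<in> gr d; b \<in> gr e; distinct [i, i', j]\<rbrakk> \<Longrightarrow>
    (Br (gt i i' a) (gt i' j b), gt i j (a * b)) \<in> sto_relations scal gr bar"
| t_t_0: "\<lbrakk>a \<in> gr d; b \<in> gr e; distinct [i, j, i', j']\<rbrakk> \<Longrightarrow>
    (Br (gt i j a) (gt i' j' b), Zero) \<in> sto_relations scal gr bar"
| t_u: "\<lbrakk>a \<in> gr d; b \<in> gr e; i \<noteq> j; k \<noteq> l\<rbrakk> \<Longrightarrow>
    (Br (gt i j a) (gu k l b), Zero) \<in> sto_relations scal gr bar"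
| t_v: "\<lbrakk>a \<in> gr d; b \<in> gr e; i \<noteq> j; k \<noteq> l\<rbrakk> \<Longrightarrow>
    (Br (gt i j a) (gv k l b), Zero) \<in> sto_relations scal gr bar"
| t_w: "\<lbrakk>a \<in> gr d; b \<in> gr e; i \<noteq> j; k \<noteq> l\<rbrakk> \<Longrightarrow>
    (Br (gt i j a) (gw k l b), Zero) \<in> sto_relations scal gr bar"

| u_u: "\<lbrakk>a \<in> gr d; b \<in> gr e; distinct [k, k', l]\<rbrakk> \<Longrightarrow>
    (Br (gu k k' a) (gu k' l b), gu k l (a * b)) \<in> sto_relations scal gr bar"
| u_u_0: "\<lbrakk>a \<in> gr d; b \<in> gr e; k \<noteq> l; l \<noteq> k'; k' \<noteq> l'; l' \<noteq> k\<rbrakk> \<Longrightarrow>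
    (Br (gu k l a) (gu k' l' b), Zero) \<in> sto_relations scal gr bar"
| u_v: "\<lbrakk>a \<in> gr d; b \<in> gr e; distinct [k, k', l]\<rbrakk> \<Longrightarrow>
    (Br (gu k k' a) (gv k' l b), gv k l (a * b)) \<in> sto_relations scal gr bar"
| u_v_0: "\<lbrakk>a \<in> gr d; b \<in> gr e; k \<noteq> l; l \<noteq> k'; k' \<noteq> l'; l' \<noteq> l\<rbrakk> \<Longrightarrow>
    (Br (gu k l a) (gv k' l' b), Zero) \<in> sto_relations scal gr bar"
| w_u: "\<lbrakk>a \<in> gr d; b \<in> gr e; distinct [k, k', l]\<rbrakk> \<Longrightarrow>
    (Br (gw l k' a) (gu k' k b), gw l k (a * b)) \<in> sto_relations scal gr bar"
| w_u_0: "\<lbrakk>a \<in> gr d; b \<in> gr e; k \<noteq> l; l \<noteq> k'; k' \<noteq> l'; l' \<noteq> l\<rbrakk> \<Longrightarrow>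
    (Br (gw l' k' a) (gu l k b), Zero) \<in> sto_relations scal gr bar"
| v_v: "\<lbrakk>a \<in> gr d; b \<in> gr e; k \<noteq> l; k' \<noteq> l'\<rbrakk> \<Longrightarrow>
    (Br (gv k l a) (gv k' l' b), Zero) \<in> sto_relations scal gr bar"
| w_w: "\<lbrakk>a \<in> gr d; b \<in> gr e; k \<noteq> l; k' \<noteq> l'\<rbrakk> \<Longrightarrow>
    (Br (gw k l a) (gw k' l' b), Zero) \<in> sto_relations scal gr bar"
| v_w: "\<lbrakk>a \<in> gr d; b \<in> gr e; distinct [k, k', l]\<rbrakk> \<Longrightarrow>
    (Br (gv k k' a) (gw k' l b), gu k l (a * b)) \<in> sto_relations scal gr bar"
| v_w_0: "\<lbrakk>a \<in> gr d; b \<in> gr e; distinct [k, l, k', l']\<rbrakk> \<Longrightarrow>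
    (Br (gv k l a) (gw k' l' b), Zero) \<in> sto_relations scal gr bar"

| t_f: "\<lbrakk>a \<in> gr d; b \<in> gr e; i \<noteq> j\<rbrakk> \<Longrightarrow>
    (Br (gt i j a) (gf i' k b),
     Add (Smul (delta i' j) (gf i k (a * b))) (Smul (- delta i' i) (gf j k (bar a * b))))
      \<in> sto_relations scal gr bar"
| g_t: "\<lbrakk>a \<in> gr d; b \<in> gr e; i \<noteq> j\<rbrakk> \<Longrightarrow>
    (Br (gg k i' a) (gt i j b),
     Add (Smul (delta i' i) (gg k j (a * b))) (Smul (- delta i' j) (gg k i (a * bar b))))
      \<in> sto_relations scal gr bar"
| f_u: "\<lbrakk>a \<in> gr d; b \<in> gr e; k \<noteq> l\<rbrakk> \<Longrightarrow>
    (Br (gf i k' a) (gu k l b), Smul (delta k k') (gf i l (a * b))) \<in> sto_relations scal gr bar"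
| u_g: "\<lbrakk>a \<in> gr d; b \<in> gr e; k \<noteq> l\<rbrakk> \<Longrightarrow>
    (Br (gu l k a) (gg k' i b), Smul (delta k' k) (gg l i (a * b))) \<in> sto_relations scal gr bar"
| v_f: "\<lbrakk>a \<in> gr d; b \<in> gr e; k \<noteq> l\<rbrakk> \<Longrightarrow>
    (Br (gv k l a) (gf i l' b),
     Smul (koszul e) (Add (Smul (delta l' l) (gg k i (a * bar b)))
                          (Smul (delta l' k) (gg l i (bar a * bar b)))))
      \<in> sto_relations scal gr bar"
| g_v: "\<lbrakk>a \<in> gr d; b \<in> gr e; k \<noteq> l\<rbrakk> \<Longrightarrow>
    (Br (gg k' i a) (gv k l b), Zero) \<in> sto_relations scal gr bar"
| w_f: "\<lbrakk>a \<in> gr d; b \<in> gr e; k \<noteq> l\<rbrakk> \<Longrightarrow>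
    (Br (gw k l a) (gf i k' b), Zero) \<in> sto_relations scal gr bar"
| g_w: "\<lbrakk>a \<in> gr d; b \<in> gr e; k \<noteq> l\<rbrakk> \<Longrightarrow>
    (Br (gg k' i a) (gw k l b),
     Smul (- koszul d) (Add (Smul (delta k' k) (gf i l (bar a * b)))
                            (Smul (delta k' l) (gf i k (bar a * bar b)))))
      \<in> sto_relations scal gr bar"
| f_f: "\<lbrakk>a \<in> gr d; b \<in> gr e; k \<noteq> l\<rbrakk> \<Longrightarrow>
    (Br (gf i k a) (gf i l b), Smul (koszul d) (gw k l (bar a * b))) \<in> sto_relations scal gr bar"
| f_f_0: "\<lbrakk>a \<in> gr d; b \<in> gr e; i \<noteq> j\<rbrakk> \<Longrightarrow>
    (Br (gf i k a) (gf j l b), Zero) \<in> sto_relations scal gr bar"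
| g_g: "\<lbrakk>a \<in> gr d; b \<in> gr e; k \<noteq> l\<rbrakk> \<Longrightarrow>
    (Br (gg k i a) (gg l i b), Smul (- koszul e) (gv k l (a * bar b))) \<in> sto_relations scal gr bar"
| g_g_0: "\<lbrakk>a \<in> gr d; b \<in> gr e; i \<noteq> j\<rbrakk> \<Longrightarrow>
    (Br (gg k i a) (gg l j b), Zero) \<in> sto_relations scal gr bar"
| f_g: "\<lbrakk>a \<in> gr d; b \<in> gr e; i \<noteq> j\<rbrakk> \<Longrightarrow>
    (Br (gf i k a) (gg l j b), Smul (delta k l) (gt i j (a * b))) \<in> sto_relations scal gr bar"
| g_f: "\<lbrakk>a \<in> gr d; b \<in> gr e; k \<noteq> l\<rbrakk> \<Longrightarrow>
    (Br (gg k i a) (gf i l b), gu k l (a * b)) \<in> sto_relations scal gr bar"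

definition sto ::
  "('k::comm_ring_1 \<Rightarrow> 'r::ring_1 \<Rightarrow> 'r) \<Rightarrow> (bit \<Rightarrow> 'r set) \<Rightarrow> ('r \<Rightarrow> 'r) \<Rightarrow>
   ('k, ('k, ('m, 'n, 'r) sto_generator) lie_term set) lie_super"
where
  "sto scal gr bar =
     presented_lie_superalgebra (sto_generators gr) (sto_relations scal gr bar)"

definition sto_element ::
  "('k::comm_ring_1 \<Rightarrow> 'r::ring_1 \<Rightarrow> 'r) \<Rightarrow> (bit \<Rightarrow> 'r set) \<Rightarrow> ('r \<Rightarrow> 'r) \<Rightarrow>
   ('m, 'n, 'r) sto_generator \<Rightarrow> ('k, ('m, 'n, 'r) sto_generator) lie_term set"
where
  "sto_element scal gr bar x =
     lie_cong (sto_generators gr) (sto_relations scal gr bar) `` {Gen x}"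


section \<open>The Lie superalgebra osp\<close>

text \<open>Rows and columns are indexed by a sum type whose three summands are the blocks of sizes
  $m$, $n$, $n$.\<close>

type_synonym ('m, 'n, 'r) smatrix = "'r ^ ('m + 'n + 'n) ^ ('m + 'n + 'n)"

definition index_degree :: "'m + 'n + 'n \<Rightarrow> bit" where
  "index_degree p = (case p of Inl i \<Rightarrow> 0 | Inr k \<Rightarrow> 1)"

definition mat_scale ::
  "('k \<Rightarrow> 'r \<Rightarrow> 'r) \<Rightarrow> 'k \<Rightarrow> ('m::finite, 'n::finite, 'r) smatrix \<Rightarrow> ('m, 'n, 'r) smatrix" where
  "mat_scale scal c A = (\<chi> p q. scal c (A $ p $ q))"

definition mat_grade :: "(bit \<Rightarrow> 'r set) \<Rightarrow> bit \<Rightarrow> ('m::finite, 'n::finite, 'r) smatrix set" where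
  "mat_grade gr d = {A. \<forall>p q. A $ p $ q \<in> gr (d + index_degree p + index_degree q)}"

definition mat_scomm ::
  "(bit \<Rightarrow> 'r::ring_1 set) \<Rightarrow> ('m::finite, 'n::finite, 'r) smatrix \<Rightarrow>
   ('m, 'n, 'r) smatrix \<Rightarrow> ('m, 'n, 'r) smatrix"
where
  "mat_scomm gr A B = (\<Sum>d\<in>{0, 1}. \<Sum>e\<in>{0, 1}.
     component (mat_grade gr) d A ** component (mat_grade gr) e B
       - mat_scale (*) (koszul (d * e))
           (component (mat_grade gr) e B ** component (mat_grade gr) d A))"

definition osp_transpose ::
  "(bit \<Rightarrow> 'r::ring_1 set) \<Rightarrow> ('r \<Rightarrow> 'r) \<Rightarrow> ('m::finite, 'n::finite, 'r) smatrix \<Rightarrow>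
   ('m, 'n, 'r) smatrix"
where
  "osp_transpose gr bar A = (\<chi> p q. case (p, q) of
     (Inl i, Inl j) \<Rightarrow> bar (A $ Inl j $ Inl i)
   | (Inl i, Inr (Inl l)) \<Rightarrow> - bar (rho gr (A $ Inr (Inr l) $ Inl i))
   | (Inl i, Inr (Inr l)) \<Rightarrow> bar (rho gr (A $ Inr (Inl l) $ Inl i))
   | (Inr (Inl k), Inl j) \<Rightarrow> bar (rho gr (A $ Inl j $ Inr (Inr k)))
   | (Inr (Inl k), Inr (Inl l)) \<Rightarrow> bar (A $ Inr (Inr l) $ Inr (Inr k))
   | (Inr (Inl k), Inr (Inr l)) \<Rightarrow> - bar (A $ Inr (Inl l) $ Inr (Inr k))
   | (Inr (Inr k), Inl j) \<Rightarrow> - bar (rho gr (A $ Inl j $ Inr (Inl k)))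
   | (Inr (Inr k), Inr (Inl l)) \<Rightarrow> - bar (A $ Inr (Inr l) $ Inr (Inl k))
   | (Inr (Inr k), Inr (Inr l)) \<Rightarrow> bar (A $ Inr (Inl l) $ Inr (Inl k)))"

definition osp_tilde ::
  "(bit \<Rightarrow> 'r::ring_1 set) \<Rightarrow> ('r \<Rightarrow> 'r) \<Rightarrow> ('m::finite, 'n::finite, 'r) smatrix set" where
  "osp_tilde gr bar = {A. osp_transpose gr bar A = - A}"

definition osp_carrier ::
  "('k::comm_ring_1 \<Rightarrow> 'r::ring_1 \<Rightarrow> 'r) \<Rightarrow> (bit \<Rightarrow> 'r set) \<Rightarrow> ('r \<Rightarrow> 'r) \<Rightarrow>
   ('m::finite, 'n::finite, 'r) smatrix set"
where
  "osp_carrier scal gr bar = Modules.module.span (mat_scale scal)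
     {mat_scomm gr A B | A B. A \<in> osp_tilde gr bar \<and> B \<in> osp_tilde gr bar}"

definition osp ::
  "('k::comm_ring_1 \<Rightarrow> 'r::ring_1 \<Rightarrow> 'r) \<Rightarrow> (bit \<Rightarrow> 'r set) \<Rightarrow> ('r \<Rightarrow> 'r) \<Rightarrow>
   ('k, ('m::finite, 'n::finite, 'r) smatrix) lie_super"
where
  "osp scal gr bar =
    \<lparr>carrier = osp_carrier scal gr bar, mult = undefined, one = undefined, zero = 0, add = (+),
     smult = mat_scale scal, bracket = mat_scomm gr,
     grade = (\<lambda>d. osp_carrier scal gr bar \<inter> mat_grade gr d)\<rparr>"

definition mat_unit ::
  "'m + 'n + 'n \<Rightarrow> 'm + 'n + 'n \<Rightarrow> 'r::ring_1 \<Rightarrow> ('m::finite, 'n::finite, 'r) smatrix" where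
  "mat_unit p q a = (\<chi> p' q'. if p' = p \<and> q' = q then a else 0)"

primrec osp_element_of_kind ::
  "(bit \<Rightarrow> 'r::ring_1 set) \<Rightarrow> ('r \<Rightarrow> 'r) \<Rightarrow> 'r \<Rightarrow> ('m::finite, 'n::finite) kind \<Rightarrow>
   ('m, 'n, 'r) smatrix"
where
  "osp_element_of_kind gr bar a (T i j) =
     mat_unit (Inl i) (Inl j) a - mat_unit (Inl j) (Inl i) (bar a)"
| "osp_element_of_kind gr bar a (U k l) =
     mat_unit (Inr (Inl k)) (Inr (Inl l)) a - mat_unit (Inr (Inr l)) (Inr (Inr k)) (bar a)"
| "osp_element_of_kind gr bar a (V k l) =
     mat_unit (Inr (Inl k)) (Inr (Inr l)) a + mat_unit (Inr (Inl l)) (Inr (Inr k)) (bar a)"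
| "osp_element_of_kind gr bar a (W k l) =
     mat_unit (Inr (Inr k)) (Inr (Inl l)) a + mat_unit (Inr (Inr l)) (Inr (Inl k)) (bar a)"
| "osp_element_of_kind gr bar a (F i k) =
     mat_unit (Inl i) (Inr (Inl k)) a + mat_unit (Inr (Inr k)) (Inl i) (rho gr (bar a))"
| "osp_element_of_kind gr bar a (G k i) =
     mat_unit (Inr (Inl k)) (Inl i) a - mat_unit (Inl i) (Inr (Inr k)) (rho gr (bar a))"

definition osp_element ::
  "(bit \<Rightarrow> 'r::ring_1 set) \<Rightarrow> ('r \<Rightarrow> 'r) \<Rightarrow> ('m::finite, 'n::finite, 'r) sto_generator \<Rightarrow>
   ('m, 'n, 'r) smatrix"
where
  "osp_element gr bar x = osp_element_of_kind gr bar (snd x) (fst x)"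

text \<open>As the generators generate \<open>sto\<close>, these conditions determine \<open>\<psi>\<close> on the carrier.\<close>

definition canonical_hom ::
  "('k::comm_ring_1 \<Rightarrow> 'r::ring_1 \<Rightarrow> 'r) \<Rightarrow> (bit \<Rightarrow> 'r set) \<Rightarrow> ('r \<Rightarrow> 'r) \<Rightarrow>
   (('k, ('m::finite, 'n::finite, 'r) sto_generator) lie_term set \<Rightarrow> ('m, 'n, 'r) smatrix) \<Rightarrow> bool"
where
  "canonical_hom scal gr bar \<psi> \<longleftrightarrow>
     lie_super_hom (sto scal gr bar) (osp scal gr bar) \<psi> \<and>
     (\<forall>d. \<forall>x\<in>sto_generators gr d. \<psi> (sto_element scal gr bar x) = osp_element gr bar x)"


section \<open>Skew-dihedral homology\<close>

definition free_module :: "('k::comm_ring_1, 'x \<Rightarrow>\<^sub>0 'k) module" where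
  "free_module =
    \<lparr>carrier = UNIV, mult = undefined, one = undefined, zero = 0, add = (+),
     smult = (\<lambda>c. Poly_Mapping.map ((*) c))\<rparr>"

definition bilinear_relators ::
  "('k::comm_ring_1 \<Rightarrow> 'r::ring_1 \<Rightarrow> 'r) \<Rightarrow> ('r \<times> 'r \<Rightarrow>\<^sub>0 'k) set"
where
  "bilinear_relators scal =
     {Poly_Mapping.single (a + a', b) 1
        - Poly_Mapping.single (a, b) 1 - Poly_Mapping.single (a', b) 1 | a a' b. True}
   \<union> {Poly_Mapping.single (a, b + b') 1
        - Poly_Mapping.single (a, b) 1 - Poly_Mapping.single (a, b') 1 | a b b'. True}
   \<union> {Poly_Mapping.single (scal c a, b) 1 - Poly_Mapping.single (a, b) c | c a b. True}
   \<union> {Poly_Mapping.single (a, scal c b) 1 - Poly_Mapping.single (a, b) c | c a b. True}"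

definition tensor_square ::
  "('k::comm_ring_1 \<Rightarrow> 'r::ring_1 \<Rightarrow> 'r) \<Rightarrow> ('k, ('r \<times> 'r \<Rightarrow>\<^sub>0 'k) set) module" where
  "tensor_square scal =
     quotient_module free_module (submodule_span free_module (bilinear_relators scal))"

definition pure_tensor ::
  "('k::comm_ring_1 \<Rightarrow> 'r::ring_1 \<Rightarrow> 'r) \<Rightarrow> 'r \<Rightarrow> 'r \<Rightarrow> ('r \<times> 'r \<Rightarrow>\<^sub>0 'k) set" where
  "pure_tensor scal a b =
     submodule_span free_module (bilinear_relators scal)
       +>\<^bsub>free_module\<^esub> Poly_Mapping.single (a, b) 1"

definition skew_dihedral_relations ::
  "('k::comm_ring_1 \<Rightarrow> 'r::ring_1 \<Rightarrow> 'r) \<Rightarrow> (bit \<Rightarrow> 'r set) \<Rightarrow> ('r \<Rightarrow> 'r) \<Rightarrow>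
   ('r \<times> 'r \<Rightarrow>\<^sub>0 'k) set set"
where
  "skew_dihedral_relations scal gr bar =
    (let M = tensor_square scal; tens = pure_tensor scal in
     submodule_span M
      ({tens a b \<ominus>\<^bsub>M\<^esub> tens (bar a) (bar b) | a b. True}
     \<union> {tens a b \<oplus>\<^bsub>M\<^esub> koszul (d * e) \<odot>\<^bsub>M\<^esub> tens b a | a b d e. a \<in> gr d \<and> b \<in> gr e}
     \<union> {koszul (d * f) \<odot>\<^bsub>M\<^esub> tens (a * b) c
          \<oplus>\<^bsub>M\<^esub> koszul (d * e) \<odot>\<^bsub>M\<^esub> tens (b * c) a
          \<oplus>\<^bsub>M\<^esub> koszul (e * f) \<odot>\<^bsub>M\<^esub> tens (c * a) b
        | a b c d e f. a \<in> gr d \<and> b \<in> gr e \<and> c \<in> gr f}))"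

definition skew_dihedral_pairing ::
  "('k::comm_ring_1 \<Rightarrow> 'r::ring_1 \<Rightarrow> 'r) \<Rightarrow> (bit \<Rightarrow> 'r set) \<Rightarrow> ('r \<Rightarrow> 'r) \<Rightarrow>
   ('k, ('r \<times> 'r \<Rightarrow>\<^sub>0 'k) set set) module"
where
  "skew_dihedral_pairing scal gr bar =
     quotient_module (tensor_square scal) (skew_dihedral_relations scal gr bar)"

definition pairing_class ::
  "('k::comm_ring_1 \<Rightarrow> 'r::ring_1 \<Rightarrow> 'r) \<Rightarrow> (bit \<Rightarrow> 'r set) \<Rightarrow> ('r \<Rightarrow> 'r) \<Rightarrow>
   'r \<Rightarrow> 'r \<Rightarrow> ('r \<times> 'r \<Rightarrow>\<^sub>0 'k) set set"
where
  "pairing_class scal gr bar a b =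
     skew_dihedral_relations scal gr bar +>\<^bsub>tensor_square scal\<^esub> pure_tensor scal a b"

definition skew_dihedral_HD1 ::
  "('k::comm_ring_1 \<Rightarrow> 'r::ring_1 \<Rightarrow> 'r) \<Rightarrow> (bit \<Rightarrow> 'r set) \<Rightarrow> ('r \<Rightarrow> 'r) \<Rightarrow>
   ('k, ('r \<times> 'r \<Rightarrow>\<^sub>0 'k) set set) module"
where
  "skew_dihedral_HD1 scal gr bar = (skew_dihedral_pairing scal gr bar)
    \<lparr>carrier :=
      {(\<Oplus>\<^bsub>skew_dihedral_pairing scal gr bar\<^esub>i\<in>{..<N}. pairing_class scal gr bar (a i) (b i))
       | (N::nat) a b.
         (\<Sum>i<N. ring_scomm gr (a i) (b i)) = (\<Sum>i<N. bar (ring_scomm gr (a i) (b i)))}\<rparr>"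

end

(*
Index rows and columns of the matrices by p, q with involution p* (exchanging the two symplectic
blocks). Then osp~ is spanned by X_pq(a) = e_pq(a) - e_pq(a)^osp, and for q different from p, p* these
are, up to sign, the generators t, u, v, w, f, g. In these terms the defining relations of sto say
  X_pq(a) = +- X_{q* p*}(+- bar a),  [X_pq(a), X_qr(b)] = X_pr(ab),  [X_pq(a), X_rs(b)] = 0,
whenever the indices allow no other interaction. Hence sto is spanned by the X_pq(a), by the brackets
[X_pq(1), X_{q p*}(a)], and by H_pq(a,b) = [X_pq(a), X_qp(b)]. Since (m,n) is not (1,1) there is always a
third index r, and expanding X_pq(ac) = [X_pr(a), X_rq(c)] yields
  H_pq(ac,b) = H_pr(a,cb) +- H_rq(c,ba).
For a fixed p in the orthogonal block this makes lam(a,b) = H_pq(a,b) - (-1)^{|a||b|} H_pq(1,ba)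
independent of q and forces on it the relations of <a,b>. So every element of sto is a canonical lift
of its image in osp plus a sum of lam(a_i,b_i); psi sends lam(a,b) to X_pp([a,b]), and ker psi is the set
of the sums with sum [a_i,b_i] fixed under bar. It is central, because lam(a,b) preserves each
X_ps(R), on which psi is injective.

Conversely, the supertrace with <a,b> in place of the product ab is a cocycle on matrices with values in
<R,R>, it vanishes on all defining relations, and the induced map from sto sends lam(a,b) to 2<a,b>.
*)

theory Submission
  imports Defs
begin

text \<open>All block by block checking of the relations is concentrated in
  \<open>XL_product\<close> and \<open>XL_zero\<close>; afterwards only the involution on indices,
  the degrees and the choice of a third index matter. The base index is orthogonal because it is
  then self-dual and even: most signs disappear, and the X_pq with p the base index already
  generate, so that normalisers and centralisers are tested on them only. That the kernel contains
  nothing but sums of lam is shown without a basis of sto. A linear map on matrices, which reads off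
  entries, reproduces every spanning element from its image up to sums of lam. Invertibility of 2
  enters four times: a matrix in osp~ is half of A - A^osp, each X_pq is read twice from its own
  matrix, the cocycle detects 2<a,b>, and the parity automorphism separates even from odd elements.
  Neither sto nor <R,R> is a type, as both depend on parameters; they are embedded in types that
  hold all such quotients at once. The model is the product of the type for sto with the extension
  of the matrices by the cocycle, so that psi and the detecting map are projections.\<close>

declare add_bit_eq_xor [simp del] mult_bit_eq_and [simp del]

section \<open>Signs\<close>

lemma bit_add_self [simp]: "(x::bit) + x = 0"
  by (cases x) simp_all

lemma bit_add_self_left [simp]: "(x::bit) + (x + y) = y"
  by (cases x; cases y) simp_all

lemma bit_mult_self [simp]: "(x::bit) * x = x"
  by (cases x) simp_all

lemma bit_mult_self_left [simp]: "(x::bit) * (x * y) = x * y"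
  by (cases x; cases y) simp_all

text \<open>The sign (-1)^d acting on an arbitrary abelian group, so that the same sign can be used
  in \<open>R\<close>, in matrices, in the presented algebra and in the module of pairs without
  going through scalars.\<close>

definition sg :: "bit \<Rightarrow> 'a::ab_group_add \<Rightarrow> 'a" where
  "sg d x = (if d = 1 then - x else x)"

lemma sg_0 [simp]: "sg 0 x = x" and sg_1 [simp]: "sg 1 x = - x"
  by (simp_all add: sg_def)

lemma sg_sg [simp]: "sg d (sg e x) = sg (d + e) x"
  by (cases d; cases e) simp_all

lemma sg_zero [simp]: "sg d 0 = 0"
  by (cases d) simp_all

lemma sg_minus: "sg d (- x) = - sg d x"
  by (cases d) simp_all

lemma sg_add: "sg d (x + y) = sg d x + sg d y"
  by (cases d) simp_all

lemma sg_diff: "sg d (x - y) = sg d x - sg d y"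
  by (cases d) simp_all

lemma sg_sum: "sg d (\<Sum>x\<in>A. f x) = (\<Sum>x\<in>A. sg d (f x))"
  by (cases d) (simp_all add: sum_negf)

text \<open>Turning every minus into an exponent reduces the comparison of signs to arithmetic in
  \<open>bit\<close>.\<close>

lemma minus_eq_sg: "- x = sg 1 x"
  by simp

lemma sg_mult_left: "sg d x * y = sg d (x * y)" and sg_mult_right: "x * sg d y = sg d (x * y)"
  for x y :: "'a::ring"
  by (cases d; simp)+

lemma koszul_mult: "koszul d * x = sg d x"
  by (simp add: koszul_def sg_def)

lemma additive_sg: "(\<And>x y. f (x + y) = f x + f y) \<Longrightarrow> f (sg d x) = sg d (f x)"
  for f :: "'a::ab_group_add \<Rightarrow> 'b::ab_group_add"
  using additive.minus[of f x] by (cases d) (auto simp: additive_def)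

lemma fst_sg: "fst (sg d x) = sg d (fst x)" and snd_sg: "snd (sg d x) = sg d (snd x)"
  by (cases d; simp)+

context Modules.module
begin

lemma koszul_scale [simp]: "scale (koszul d) x = sg d x"
  by (simp add: koszul_def sg_def)

lemma koszul_scale_minus [simp]: "scale (- koszul d) x = - sg d x"
  by (simp add: koszul_def sg_def)

lemma scale_sg: "scale c (sg d x) = sg d (scale c x)"
  by (cases d) simp_all

lemma subspace_sg: "subspace S \<Longrightarrow> x \<in> S \<Longrightarrow> sg d x \<in> S"
  by (cases d) (simp_all add: subspace_neg)

end

section \<open>Graded modules and superalgebras\<close>

text \<open>Shared by \<open>R\<close> with \<open>gr\<close> and by the matrices with
  \<open>mat_grade gr\<close>, since \<open>component\<close> is applied to both.\<close>

locale graded_module = Modules.module scal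
  for scal :: "'k::comm_ring_1 \<Rightarrow> 'a::ab_group_add \<Rightarrow> 'a" +
  fixes gr :: "bit \<Rightarrow> 'a set"
  assumes gr_sub: "subspace (gr d)"
    and gr_sum: "\<exists>!(x0, x1). x0 \<in> gr 0 \<and> x1 \<in> gr 1 \<and> x = x0 + x1"
begin

lemma gr_unique:
  assumes "x \<in> gr d" "y \<in> gr (d + 1)" "x' \<in> gr d" "y' \<in> gr (d + 1)" "x + y = x' + y'"
  shows "x = x' \<and> y = y'"
proof -
  have *: "u = u' \<and> v = v'"
    if "u \<in> gr 0" "v \<in> gr 1" "u' \<in> gr 0" "v' \<in> gr 1" "u + v = u' + v'" for u v u' v'
    using gr_sum[of "u + v"] that by (metis (mono_tags, lifting) case_prod_conv old.prod.inject)
  show ?thesis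
  proof (cases "d = 0")
    case True
    then show ?thesis using *[of x y x' y'] assms by simp
  next
    case False
    then have "d = 1" by simp
    then show ?thesis using *[of y x y' x'] assms by (simp add: add.commute)
  qed
qed

lemma component_eqI:
  assumes "y \<in> gr d" "x - y \<in> gr (d + 1)"
  shows "component gr d x = y"
  unfolding component_def
proof (rule the_equality)
  show "y \<in> gr d \<and> x - y \<in> gr (d + 1)" using assms by simp
next
  fix z assume "z \<in> gr d \<and> x - z \<in> gr (d + 1)"
  then show "z = y" using gr_unique[of z d "x - z" y "x - y"] assms by simp
qed

lemma component_ex: "\<exists>y. y \<in> gr d \<and> x - y \<in> gr (d + 1)"
proof -
  obtain x0 x1 where x: "x0 \<in> gr 0" "x1 \<in> gr 1" "x = x0 + x1"
    using gr_sum[of x] by auto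
  show ?thesis
  proof (cases "d = 0")
    case True then show ?thesis using x by (intro exI[of _ x0]) simp
  next
    case False then show ?thesis using x by (intro exI[of _ x1]) simp
  qed
qed

lemma component_in [simp]: "component gr d x \<in> gr d"
  using component_ex[of d x] component_eqI by metis

lemma component_compl: "x - component gr d x \<in> gr (d + 1)"
  using component_ex[of d x] component_eqI by metis

lemma component_add: "component gr d (x + y) = component gr d x + component gr d y"
proof (rule component_eqI)
  show "component gr d x + component gr d y \<in> gr d"
    by (simp add: gr_sub subspace_add)
  have "(x - component gr d x) + (y - component gr d y) \<in> gr (d + 1)"
    by (intro subspace_add gr_sub component_compl)
  then show "x + y - (component gr d x + component gr d y) \<in> gr (d + 1)"
    by (simp add: algebra_simps)
qed

lemma component_scale: "component gr d (scal c x) = scal c (component gr d x)"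
proof (rule component_eqI)
  show "scal c (component gr d x) \<in> gr d"
    by (simp add: gr_sub subspace_scale)
  have "scal c (x - component gr d x) \<in> gr (d + 1)"
    by (intro subspace_scale gr_sub component_compl)
  then show "scal c x - scal c (component gr d x) \<in> gr (d + 1)"
    by (simp add: scale_right_diff_distrib)
qed

lemma component_homog:
  assumes "x \<in> gr e"
  shows "component gr d x = (if d = e then x else 0)"
proof (cases "d = e")
  case True
  then show ?thesis using assms by (auto intro!: component_eqI simp: gr_sub subspace_0)
next
  case False
  then have "e = d + 1" by (cases d; cases e) auto
  then show ?thesis using assms by (auto intro!: component_eqI simp: gr_sub subspace_0)
qed

lemma component_zero [simp]: "component gr d 0 = 0"
  using component_homog[of 0 d d] by (simp add: gr_sub subspace_0)

lemma component_minus: "component gr d (- x) = - component gr d x"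
  using component_scale[of d "-1" x] by simp

lemma component_diff: "component gr d (x - y) = component gr d x - component gr d y"
  using component_add[of d x "- y"] by (simp add: component_minus)

lemma component_decomp: "component gr 0 x + component gr 1 x = x"
proof -
  have "component gr 1 x = x - component gr 0 x"
    using component_compl[of x 0] by (intro component_eqI) simp_all
  then show ?thesis by simp
qed

text \<open>Formulas with degrees make sense on homogeneous elements only; additive identities
  extend from there to all elements.\<close>

lemma homogeneous_induct:
  assumes "\<And>d x. x \<in> gr d \<Longrightarrow> P x" and "\<And>x y. P x \<Longrightarrow> P y \<Longrightarrow> P (x + y)"
  shows "P x"
  using assms(2)[of "component gr 0 x" "component gr 1 x"]
    assms(1)[of "component gr 0 x" 0] assms(1)[of "component gr 1 x" 1]
  by (simp add: component_decomp)

lemma gr_sg: "x \<in> gr d \<Longrightarrow> sg e x \<in> gr d"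
  by (simp add: gr_sub subspace_sg)

lemma component_component: "component gr d (component gr e x) = (if d = e then component gr e x else 0)"
  by (rule component_homog) simp

end

context superalgebra_with_superinvolution
begin

sublocale graded_module scal gr
  by unfold_locales (rule gr_subspace, rule gr_direct_sum)

lemma bar_add: "bar (a + b) = bar a + bar b" and bar_scale: "bar (scal c a) = scal c (bar a)"
  using bar_linear by (simp_all add: module_hom_iff)

lemma bar_zero [simp]: "bar 0 = 0"
  using bar_add[of 0 0] by simp

lemma bar_sg: "bar (sg d a) = sg d (bar a)"
  by (rule additive_sg) (rule bar_add)

lemma bar_minus: "bar (- a) = - bar a"
  using bar_sg[of 1 a] by simp

lemma bar_diff: "bar (a - b) = bar a - bar b"
  using bar_add[of a "- b"] by (simp add: bar_minus)

lemma bar_sum: "bar (\<Sum>i\<in>A. f i) = (\<Sum>i\<in>A. bar (f i))"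
  by (induction A rule: infinite_finite_induct) (simp_all add: bar_add)

lemma bar_times: "a \<in> gr d \<Longrightarrow> b \<in> gr e \<Longrightarrow> bar (a * b) = sg (d * e) (bar b * bar a)"
  by (simp add: bar_mult koszul_mult)

declare bar_bar [simp]

lemma component_bar: "component gr d (bar a) = bar (component gr d a)"
proof (rule component_eqI)
  show "bar (component gr d a) \<in> gr d" by (rule bar_gr) simp
  show "bar a - bar (component gr d a) \<in> gr (d + 1)"
    using bar_gr[OF component_compl[of a d]] by (simp add: bar_diff)
qed

text \<open>Write 1 = u + v with u even and v odd. Comparing odd parts in v = uv + vv gives uv = v,
  comparing odd parts in u = uu + uv gives uv = 0.\<close>

lemma one_in_gr: "1 \<in> gr 0"
proof -
  define u where "u = component gr 0 (1::'r)"
  define v where "v = component gr 1 (1::'r)"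
  have uv: "u + v = 1" "u \<in> gr 0" "v \<in> gr 1"
    unfolding u_def v_def by (simp_all add: component_decomp)
  have "u * v \<in> gr 1" "v * v \<in> gr 0" "u * v + v * v = v"
    using gr_mult[of u 0 v 1] gr_mult[of v 1 v 1] uv by (simp_all flip: distrib_right)
  then have "v * v = 0"
    using gr_unique[of "v * v" 0 "u * v" 0 v] uv by (simp add: add.commute gr_sub subspace_0)
  moreover have "v * u \<in> gr 1" "v * u + v * v = v"
    using gr_mult[of v 1 u 0] uv by (simp_all flip: distrib_left)
  moreover have "u * u \<in> gr 0" "u * u + u * v = u"
    using gr_mult[of u 0 u 0] uv by (simp_all flip: distrib_left)
  ultimately have "u * v = v" "u * v = 0"
    using gr_unique[of "u * u" 0 "u * v" u 0] \<open>u * v \<in> gr 1\<close> \<open>u * v + v * v = v\<close> uv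
    by (simp_all add: gr_sub subspace_0)
  then show ?thesis using uv by simp
qed

lemma bar_one [simp]: "bar 1 = 1"
proof -
  have "bar (1 * bar 1) = sg 0 (bar (bar 1) * bar 1)"
    using bar_times[of 1 0 "bar 1" 0] one_in_gr by (simp add: bar_gr)
  then show ?thesis by simp
qed

lemma rho_homog: "a \<in> gr d \<Longrightarrow> rho gr a = sg d a"
  by (cases d) (simp_all add: rho_def component_homog)

lemma rho_add: "rho gr (a + b) = rho gr a + rho gr b"
  by (simp add: rho_def component_add)

lemma rho_scale: "rho gr (scal c a) = scal c (rho gr a)"
  by (simp add: rho_def component_scale scale_right_diff_distrib)

lemma rho_bar: "rho gr (bar a) = bar (rho gr a)"
  by (simp add: rho_def component_bar bar_diff)

lemma rho_rho [simp]: "rho gr (rho gr a) = a"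
  using component_decomp[of a]
  by (simp add: rho_def component_diff component_component)

text \<open>What \<open>osp_transpose\<close> does to an entry, apart from its sign, when
  \<open>e\<close> is the parity \<open>dg p + dg q\<close> of the position.\<close>

definition cj :: "bit \<Rightarrow> 'r \<Rightarrow> 'r" where
  "cj e a = (if e = 1 then bar (rho gr a) else bar a)"

lemma cj_homog: "a \<in> gr d \<Longrightarrow> cj e a = sg (e * d) (bar a)"
  by (cases e) (simp_all add: cj_def rho_homog bar_sg)

lemma cj_0 [simp]: "cj 0 a = bar a"
  by (simp add: cj_def)

lemma cj_add: "cj e (a + b) = cj e a + cj e b"
  by (simp add: cj_def rho_add bar_add)

lemma cj_scale: "cj e (scal c a) = scal c (cj e a)"
  by (simp add: cj_def rho_scale bar_scale)

lemma cj_zero [simp]: "cj e 0 = 0"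
  using cj_add[of e 0 0] by simp

lemma cj_sg: "cj e (sg d a) = sg d (cj e a)"
  by (rule additive_sg) (rule cj_add)

lemma cj_sum: "cj e (\<Sum>i\<in>A. f i) = (\<Sum>i\<in>A. cj e (f i))"
  by (induction A rule: infinite_finite_induct) (simp_all add: cj_add)

lemma cj_cj [simp]: "cj e (cj e a) = a"
  by (simp add: cj_def flip: rho_bar)

lemma cj_gr: "a \<in> gr d \<Longrightarrow> cj e a \<in> gr d"
  by (simp add: cj_homog gr_sg bar_gr)

lemma scomm_homog:
  "a \<in> gr d \<Longrightarrow> b \<in> gr e \<Longrightarrow> ring_scomm gr a b = a * b - sg (d * e) (b * a)"
  by (cases d; cases e) (simp_all add: ring_scomm_def component_homog koszul_mult)

lemma scomm_add_left: "ring_scomm gr (a + a') b = ring_scomm gr a b + ring_scomm gr a' b"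
  by (simp add: ring_scomm_def component_add algebra_simps)

lemma scomm_add_right: "ring_scomm gr a (b + b') = ring_scomm gr a b + ring_scomm gr a b'"
  by (simp add: ring_scomm_def component_add algebra_simps)

lemma scomm_scale_left: "ring_scomm gr (scal c a) b = scal c (ring_scomm gr a b)"
  by (simp add: ring_scomm_def component_scale scale_mult_left scale_mult_right koszul_mult
      scale_right_diff_distrib scale_right_distrib flip: scale_sg)

lemma scomm_scale_right: "ring_scomm gr a (scal c b) = scal c (ring_scomm gr a b)"
  by (simp add: ring_scomm_def component_scale scale_mult_left scale_mult_right koszul_mult
      scale_right_diff_distrib scale_right_distrib flip: scale_sg)

end

section \<open>Lie superalgebras on types\<close>

text \<open>The sets \<open>H 0\<close> and \<open>H 1\<close> need be neither disjoint up to 0 nor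
  jointly spanning: the type of presented algebras contains much more than one algebra, and the
  cocycle extension carries no grading on its central part.\<close>

locale lie_type = Modules.module sm
  for sm :: "'k::comm_ring_1 \<Rightarrow> 'l::ab_group_add \<Rightarrow> 'l" +
  fixes br :: "'l \<Rightarrow> 'l \<Rightarrow> 'l" and H :: "bit \<Rightarrow> 'l set"
  assumes br_add_left: "br (x + y) z = br x z + br y z"
    and br_add_right: "br x (y + z) = br x y + br x z"
    and br_sm_left: "br (sm c x) y = sm c (br x y)"
    and br_sm_right: "br x (sm c y) = sm c (br x y)"
    and H_subspace: "subspace (H d)"
    and H_br: "x \<in> H d \<Longrightarrow> y \<in> H e \<Longrightarrow> br x y \<in> H (d + e)"
    and br_antisym: "x \<in> H d \<Longrightarrow> y \<in> H e \<Longrightarrow> br x y = - sg (d * e) (br y x)"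
    and br_jacobi: "x \<in> H d \<Longrightarrow> y \<in> H e \<Longrightarrow> z \<in> H f \<Longrightarrow>
      sg (d * f) (br (br x y) z) + sg (e * d) (br (br y z) x) + sg (f * e) (br (br z x) y) = 0"
begin

lemma br_zero_left [simp]: "br 0 y = 0" and br_zero_right [simp]: "br x 0 = 0"
  using br_add_left[of 0 0 y] br_add_right[of x 0 0] by simp_all

lemma br_sg_left: "br (sg d x) y = sg d (br x y)"
  by (rule additive_sg) (rule br_add_left)

lemma br_sg_right: "br x (sg d y) = sg d (br x y)"
  by (rule additive_sg) (rule br_add_right)

lemma br_minus_left: "br (- x) y = - br x y" and br_minus_right: "br x (- y) = - br x y"
  using br_sg_left[of 1] br_sg_right[of x 1] by simp_all

lemma H_sg: "x \<in> H d \<Longrightarrow> sg e x \<in> H d"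
  by (simp add: H_subspace subspace_sg)

text \<open>The cyclic Jacobi identity solved for one term, after antisymmetry has moved
  \<open>z\<close> to the innermost right position in the others.\<close>

lemma br_leibniz_left:
  assumes "x \<in> H d" "y \<in> H e" "z \<in> H f"
  shows "br (br x y) z = br x (br y z) - sg (d * e) (br y (br x z))"
proof -
  have 1: "br (br y z) x = - sg ((e + f) * d) (br x (br y z))"
    using assms by (intro br_antisym H_br)
  have 2: "br z x = - sg (f * d) (br x z)"
    using assms by (intro br_antisym)
  have 3: "br (br x z) y = - sg ((d + f) * e) (br y (br x z))"
    using assms by (intro br_antisym H_br)
  have "sg (d * f) (br (br x y) z) = sg (d * f) (br x (br y z) - sg (d * e) (br y (br x z)))"
    using br_jacobi[OF assms] unfolding 1 2 3 br_minus_left br_sg_left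
    by (cases d; cases e; cases f) (simp_all add: 3 algebra_simps eq_neg_iff_add_eq_0)
  then have "sg (d * f) (sg (d * f) (br (br x y) z)) =
      sg (d * f) (sg (d * f) (br x (br y z) - sg (d * e) (br y (br x z))))" by simp
  then show ?thesis by simp
qed

lemma br_leibniz_right:
  assumes "x \<in> H d" "y \<in> H e" "z \<in> H f"
  shows "br x (br y z) = br (br x y) z + sg (d * e) (br y (br x z))"
  using br_leibniz_left[OF assms] by simp

end

primrec lev :: "('k \<Rightarrow> 'l \<Rightarrow> 'l) \<Rightarrow> ('l \<Rightarrow> 'l \<Rightarrow> 'l) \<Rightarrow> ('x \<Rightarrow> 'l) \<Rightarrow> ('k, 'x) lie_term \<Rightarrow> 'l::ab_group_add"
where
  "lev sm br \<gamma> (Gen x) = \<gamma> x"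
| "lev sm br \<gamma> Zero = 0"
| "lev sm br \<gamma> (Add s t) = lev sm br \<gamma> s + lev sm br \<gamma> t"
| "lev sm br \<gamma> (Smul c s) = sm c (lev sm br \<gamma> s)"
| "lev sm br \<gamma> (Br s t) = br (lev sm br \<gamma> s) (lev sm br \<gamma> t)"

context lie_type
begin

lemma lev_homogeneous:
  assumes "\<And>d x. x \<in> X d \<Longrightarrow> \<gamma> x \<in> H d" and "homogeneous_term X d s"
  shows "lev sm br \<gamma> s \<in> H d"
  using assms(2)
  by induction (simp_all add: assms(1) H_subspace subspace_0 subspace_add subspace_scale H_br)

text \<open>The universal property of the presentation. The assignment must respect degrees because
  antisymmetry and Jacobi are imposed on homogeneous terms, with signs depending on the
  degrees.\<close>

lemma lev_cong:
  assumes X: "\<And>d x. x \<in> X d \<Longrightarrow> \<gamma> x \<in> H d"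
    and Rel: "\<And>s t. (s, t) \<in> Rel \<Longrightarrow> lev sm br \<gamma> s = lev sm br \<gamma> t"
    and "(s, t) \<in> lie_cong X Rel"
  shows "lev sm br \<gamma> s = lev sm br \<gamma> t"
  using assms(3)
proof induction
  case (antisym d s e t)
  then show ?case
    using br_antisym lev_homogeneous[where X = X and \<gamma> = \<gamma>, OF X] by fastforce
next
  case (jacobi d s e t f u)
  then show ?case
    using br_jacobi lev_homogeneous[where X = X and \<gamma> = \<gamma>, OF X] by fastforce
qed (auto simp: Rel algebra_simps br_add_left br_add_right br_sm_left br_sm_right)

end

section \<open>Presented Lie superalgebras as types\<close>

text \<open>A quotient by a relation that depends on parameters is not a type, but the product of these
  quotients over all values of the parameters is. The quotient for given parameters embeds into this
  product, so that one can compute in it with type class operations.\<close>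

type_synonym ('k, 'x) presentation =
  "(bit \<Rightarrow> 'x set) \<times> (('k, 'x) lie_term \<times> ('k, 'x) lie_term) set"

definition pointwise_lie_cong ::
  "(('k::comm_ring_1, 'x) presentation \<Rightarrow> ('k, 'x) lie_term) \<Rightarrow>
   (('k, 'x) presentation \<Rightarrow> ('k, 'x) lie_term) \<Rightarrow> bool" where
  "pointwise_lie_cong f g \<longleftrightarrow> (\<forall>c. (f c, g c) \<in> lie_cong (fst c) (snd c))"

lemma Zero_in_lie_terms [simp]: "Zero \<in> lie_terms X"
  by (simp add: lie_terms_def)

lemma Add_in_lie_terms [simp]: "Add s t \<in> lie_terms X \<longleftrightarrow> s \<in> lie_terms X \<and> t \<in> lie_terms X"
  by (auto simp: lie_terms_def)

lemma Br_in_lie_terms [simp]: "Br s t \<in> lie_terms X \<longleftrightarrow> s \<in> lie_terms X \<and> t \<in> lie_terms X"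
  by (auto simp: lie_terms_def)

lemma Smul_in_lie_terms [simp]: "Smul c s \<in> lie_terms X \<longleftrightarrow> s \<in> lie_terms X"
  by (auto simp: lie_terms_def)

lemma Gen_in_lie_terms [simp]: "Gen x \<in> lie_terms X \<longleftrightarrow> x \<in> X 0 \<union> X 1"
  by (auto simp: lie_terms_def)

lemma homogeneous_in_lie_terms: "homogeneous_term X d s \<Longrightarrow> s \<in> lie_terms X"
proof (induction rule: homogeneous_term.induct)
  case (1 x d)
  then show ?case by (cases d) auto
qed simp_all

lemma lie_cong_in_lie_terms:
  "(s, t) \<in> lie_cong X Rel \<Longrightarrow> s \<in> lie_terms X \<and> t \<in> lie_terms X"
  by (induction rule: lie_cong.induct) (auto dest: homogeneous_in_lie_terms)

\<comment> \<open>Partial, because \<open>lie_cong\<close> is reflexive only on terms in the given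
  generators.\<close>
quotient_type (overloaded) ('k, 'x) presented =
  "('k::comm_ring_1, 'x) presentation \<Rightarrow> ('k, 'x) lie_term" / partial: pointwise_lie_cong
proof (rule part_equivpI)
  show "\<exists>f. pointwise_lie_cong f f"
    by (intro exI[of _ "\<lambda>_. Zero"]) (simp add: pointwise_lie_cong_def lie_cong.refl)
  show "symp pointwise_lie_cong"
    by (auto simp: symp_def pointwise_lie_cong_def intro: lie_cong.sym)
  show "transp pointwise_lie_cong"
    unfolding transp_def pointwise_lie_cong_def by (blast intro: lie_cong.trans)
qed

lemma pointwise_lie_cong_refl_iff: "pointwise_lie_cong f f \<longleftrightarrow> (\<forall>c. f c \<in> lie_terms (fst c))"
  unfolding pointwise_lie_cong_def using lie_cong_in_lie_terms lie_cong.refl by blast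

lemma lie_cong_neg_left: "s \<in> lie_terms X \<Longrightarrow> (Add (Smul (- 1) s) s, Zero) \<in> lie_cong X Rel"
  by (rule lie_cong.trans[OF lie_cong.add_commute lie_cong.add_inverse]) simp_all

lemma lie_cong_zero_left: "s \<in> lie_terms X \<Longrightarrow> (Add Zero s, s) \<in> lie_cong X Rel"
  by (rule lie_cong.trans[OF lie_cong.add_commute lie_cong.add_zero]) simp_all

instantiation presented :: (comm_ring_1, type) ab_group_add
begin

lift_definition zero_presented :: "('a, 'b) presented" is "\<lambda>_. Zero"
  by (simp add: pointwise_lie_cong_def lie_cong.refl)

lift_definition plus_presented ::
    "('a, 'b) presented \<Rightarrow> ('a, 'b) presented \<Rightarrow> ('a, 'b) presented"
  is "\<lambda>f g c. Add (f c) (g c)"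
  by (simp add: pointwise_lie_cong_def lie_cong.cong_Add)

lift_definition uminus_presented :: "('a, 'b) presented \<Rightarrow> ('a, 'b) presented"
  is "\<lambda>f c. Smul (- 1) (f c)"
  by (simp add: pointwise_lie_cong_def lie_cong.cong_Smul)

lift_definition minus_presented ::
    "('a, 'b) presented \<Rightarrow> ('a, 'b) presented \<Rightarrow> ('a, 'b) presented"
  is "\<lambda>f g c. Add (f c) (Smul (- 1) (g c))"
  by (simp add: pointwise_lie_cong_def lie_cong.cong_Add lie_cong.cong_Smul)

instance
proof
  fix a b c :: "('a, 'b) presented"
  show "a + b + c = a + (b + c)"
    by transfer (simp only: pointwise_lie_cong_refl_iff, simp add: pointwise_lie_cong_def lie_cong.add_assoc)
  show "a + b = b + a"
    by transfer (simp only: pointwise_lie_cong_refl_iff, simp add: pointwise_lie_cong_def lie_cong.add_commute)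
  show "0 + a = a"
    by transfer (simp only: pointwise_lie_cong_refl_iff, simp add: pointwise_lie_cong_def lie_cong_zero_left)
  show "- a + a = 0"
    by transfer (simp only: pointwise_lie_cong_refl_iff, simp add: pointwise_lie_cong_def lie_cong_neg_left)
  show "a - b = a + - b"
    by transfer (simp only: pointwise_lie_cong_refl_iff, simp add: pointwise_lie_cong_def lie_cong.refl)
qed

end

lift_definition psmul :: "'k::comm_ring_1 \<Rightarrow> ('k, 'x) presented \<Rightarrow> ('k, 'x) presented"
  is "\<lambda>a f c. Smul a (f c)"
  by (simp add: pointwise_lie_cong_def lie_cong.cong_Smul)

lift_definition pbr ::
    "('k::comm_ring_1, 'x) presented \<Rightarrow> ('k, 'x) presented \<Rightarrow> ('k, 'x) presented"
  is "\<lambda>f g c. Br (f c) (g c)"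
  by (simp add: pointwise_lie_cong_def lie_cong.cong_Br)

text \<open>The quotient for \<open>(X, Rel)\<close> sits in one coordinate of the product; all
  others are set to \<open>Zero\<close>. A term with foreign generators is sent to
  \<open>Zero\<close> as well, which keeps the function inside the domain of the partial
  equivalence.\<close>

lift_definition pclass ::
    "(bit \<Rightarrow> 'x set) \<Rightarrow> (('k::comm_ring_1, 'x) lie_term \<times> ('k, 'x) lie_term) set \<Rightarrow>
     ('k, 'x) lie_term \<Rightarrow> ('k, 'x) presented"
  is "\<lambda>X Rel t c. if c = (X, Rel) \<and> t \<in> lie_terms X then t else Zero"
  by (simp add: pointwise_lie_cong_def lie_cong.refl)

interpretation presented: Modules.module "psmul :: 'k::comm_ring_1 \<Rightarrow> ('k, 'x) presented \<Rightarrow> _"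
proof
  fix a b :: 'k and x y :: "('k, 'x) presented"
  show "psmul a (x + y) = psmul a x + psmul a y"
    by transfer (simp only: pointwise_lie_cong_refl_iff, simp add: pointwise_lie_cong_def lie_cong.smul_add)
  show "psmul (a + b) x = psmul a x + psmul b x"
    by transfer (simp only: pointwise_lie_cong_refl_iff, simp add: pointwise_lie_cong_def lie_cong.add_smul)
  show "psmul a (psmul b x) = psmul (a * b) x"
    by transfer (simp only: pointwise_lie_cong_refl_iff, simp add: pointwise_lie_cong_def lie_cong.smul_smul)
  show "psmul 1 x = x"
    by transfer (simp only: pointwise_lie_cong_refl_iff, simp add: pointwise_lie_cong_def lie_cong.smul_one)
qed

lemma pclass_eq_iff:
  assumes "s \<in> lie_terms X" "t \<in> lie_terms X"
  shows "pclass X Rel s = pclass X Rel t \<longleftrightarrow> (s, t) \<in> lie_cong X Rel"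
  using assms by transfer (auto simp: pointwise_lie_cong_def intro: lie_cong.refl)

lemma pclass_Zero [simp]: "pclass X Rel Zero = 0"
  by transfer (simp add: pointwise_lie_cong_def lie_cong.refl)

lemma pbr_add_left: "pbr (x + y) z = pbr x z + pbr y z"
  by transfer (simp only: pointwise_lie_cong_refl_iff, simp add: pointwise_lie_cong_def lie_cong.br_add_left)

lemma pbr_add_right: "pbr x (y + z) = pbr x y + pbr x z"
  by transfer (simp only: pointwise_lie_cong_refl_iff, simp add: pointwise_lie_cong_def lie_cong.br_add_right)

lemma pbr_smul_left: "pbr (psmul a x) y = psmul a (pbr x y)"
  by transfer (simp only: pointwise_lie_cong_refl_iff, simp add: pointwise_lie_cong_def lie_cong.br_smul_left)

lemma pbr_smul_right: "pbr x (psmul a y) = psmul a (pbr x y)"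
  by transfer (simp only: pointwise_lie_cong_refl_iff, simp add: pointwise_lie_cong_def lie_cong.br_smul_right)

declare lie_cong.trans [trans]

text \<open>\<open>Smul a Zero\<close> and \<open>Br Zero Zero\<close> occur in the idle coordinates
  of \<open>pclass\<close>; that they vanish is not a clause of \<open>lie_cong\<close> but follows
  because both are idempotent under addition.\<close>

lemma lie_cong_idem:
  assumes "(Add x x, x) \<in> lie_cong X Rel"
  shows "(x, Zero) \<in> lie_cong X Rel"
proof -
  have x: "x \<in> lie_terms X" using lie_cong_in_lie_terms[OF assms] by simp
  have "(x, Add x Zero) \<in> lie_cong X Rel" using x by (intro lie_cong.sym[OF lie_cong.add_zero])
  also have "(Add x Zero, Add x (Add x (Smul (- 1) x))) \<in> lie_cong X Rel"
    using x by (intro lie_cong.cong_Add lie_cong.refl lie_cong.sym[OF lie_cong.add_inverse])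
  also have "(Add x (Add x (Smul (- 1) x)), Add (Add x x) (Smul (- 1) x)) \<in> lie_cong X Rel"
    using x by (intro lie_cong.sym[OF lie_cong.add_assoc]) simp_all
  also have "(Add (Add x x) (Smul (- 1) x), Add x (Smul (- 1) x)) \<in> lie_cong X Rel"
    using x by (intro lie_cong.cong_Add assms lie_cong.refl) simp
  also have "(Add x (Smul (- 1) x), Zero) \<in> lie_cong X Rel"
    using x by (rule lie_cong.add_inverse)
  finally show ?thesis .
qed

lemma lie_cong_Smul_Zero: "(Smul a Zero, Zero) \<in> lie_cong X Rel"
  by (rule lie_cong_idem, rule lie_cong.trans[OF lie_cong.sym[OF lie_cong.smul_add]])
    (simp_all add: lie_cong.cong_Smul lie_cong.add_zero)

lemma lie_cong_Br_Zero: "(Br Zero Zero, Zero) \<in> lie_cong X Rel"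
  by (rule lie_cong_idem, rule lie_cong.trans[OF lie_cong.sym[OF lie_cong.br_add_left]])
    (simp_all add: lie_cong.cong_Br lie_cong.add_zero lie_cong.refl)

lemma pclass_Add: "s \<in> lie_terms X \<Longrightarrow> t \<in> lie_terms X \<Longrightarrow>
    pclass X Rel (Add s t) = pclass X Rel s + pclass X Rel t"
  by transfer (auto simp: pointwise_lie_cong_def intro: lie_cong.refl lie_cong.sym[OF lie_cong.add_zero])

lemma pclass_Smul: "s \<in> lie_terms X \<Longrightarrow> pclass X Rel (Smul a s) = psmul a (pclass X Rel s)"
  by transfer (auto simp: pointwise_lie_cong_def intro: lie_cong.refl lie_cong.sym[OF lie_cong_Smul_Zero])

lemma pclass_Br: "s \<in> lie_terms X \<Longrightarrow> t \<in> lie_terms X \<Longrightarrow>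
    pclass X Rel (Br s t) = pbr (pclass X Rel s) (pclass X Rel t)"
  by transfer (auto simp: pointwise_lie_cong_def intro: lie_cong.refl lie_cong.sym[OF lie_cong_Br_Zero])

lemma pclass_eq_lev:
  "t \<in> lie_terms X \<Longrightarrow> pclass X Rel t = lev psmul pbr (\<lambda>x. pclass X Rel (Gen x)) t"
  by (induction t) (simp_all add: pclass_Add pclass_Smul pclass_Br del: Gen_in_lie_terms)

definition pgrade ::
  "(bit \<Rightarrow> 'x set) \<Rightarrow> (('k::comm_ring_1, 'x) lie_term \<times> ('k, 'x) lie_term) set \<Rightarrow> bit \<Rightarrow>
   ('k, 'x) presented set" where
  "pgrade X Rel d = pclass X Rel ` {t. homogeneous_term X d t}"

lemma lie_type_presented: "lie_type psmul pbr (pgrade X Rel)"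
proof
  fix x y z :: "('a, 'b) presented" and a :: 'a
  show "pbr (x + y) z = pbr x z + pbr y z" "pbr x (y + z) = pbr x y + pbr x z"
    "pbr (psmul a x) y = psmul a (pbr x y)" "pbr x (psmul a y) = psmul a (pbr x y)"
    by (rule pbr_add_left pbr_add_right pbr_smul_left pbr_smul_right)+
next
  fix d
  show "presented.subspace (pgrade X Rel d)"
  proof (rule presented.subspaceI)
    show "0 \<in> pgrade X Rel d"
      by (auto simp: pgrade_def intro!: image_eqI[of _ _ Zero] homogeneous_term.intros)
  next
    fix x y assume "x \<in> pgrade X Rel d" "y \<in> pgrade X Rel d"
    then obtain s t where "x = pclass X Rel s" "y = pclass X Rel t"
        "homogeneous_term X d s" "homogeneous_term X d t"
      by (auto simp: pgrade_def)
    then show "x + y \<in> pgrade X Rel d"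
      by (auto simp: pgrade_def pclass_Add homogeneous_in_lie_terms
          intro!: image_eqI[of _ _ "Add s t"] homogeneous_term.intros)
  next
    fix a x assume "x \<in> pgrade X Rel d"
    then obtain s where "x = pclass X Rel s" "homogeneous_term X d s"
      by (auto simp: pgrade_def)
    then show "psmul a x \<in> pgrade X Rel d"
      by (auto simp: pgrade_def pclass_Smul homogeneous_in_lie_terms
          intro!: image_eqI[of _ _ "Smul a s"] homogeneous_term.intros)
  qed
next
  fix x y d e assume "x \<in> pgrade X Rel d" "y \<in> pgrade X Rel e"
  then obtain s t where st: "x = pclass X Rel s" "y = pclass X Rel t"
      "homogeneous_term X d s" "homogeneous_term X e t"
    by (auto simp: pgrade_def)
  note [simp] = st(3,4)[THEN homogeneous_in_lie_terms]
  show "pbr x y \<in> pgrade X Rel (d + e)"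
    using st by (auto simp: pgrade_def pclass_Br
        intro!: image_eqI[of _ _ "Br s t"] homogeneous_term.intros)
  have "pclass X Rel (Br s t) = pclass X Rel (Smul (- koszul (d * e)) (Br t s))"
    using lie_cong.antisym[OF st(3,4)] by (simp add: pclass_eq_iff)
  then show "pbr x y = - sg (d * e) (pbr y x)"
    by (simp add: st pclass_Br pclass_Smul)
next
  fix x y z d e f assume "x \<in> pgrade X Rel d" "y \<in> pgrade X Rel e" "z \<in> pgrade X Rel f"
  then obtain s t u where st: "x = pclass X Rel s" "y = pclass X Rel t" "z = pclass X Rel u"
      "homogeneous_term X d s" "homogeneous_term X e t" "homogeneous_term X f u"
    by (auto simp: pgrade_def)
  note [simp] = st(4-6)[THEN homogeneous_in_lie_terms]
  have "pclass X Rel (Add (Add (Smul (koszul (d * f)) (Br (Br s t) u))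
              (Smul (koszul (e * d)) (Br (Br t u) s)))
         (Smul (koszul (f * e)) (Br (Br u s) t))) = pclass X Rel Zero"
    by (subst pclass_eq_iff) (auto intro: lie_cong.jacobi[OF st(4-6)])
  then show "sg (d * f) (pbr (pbr x y) z) + sg (e * d) (pbr (pbr y z) x) + sg (f * e) (pbr (pbr z x) y) = 0"
    by (simp add: st pclass_Br pclass_Smul pclass_Add)
qed

text \<open>Existence only. That the decomposition is unique depends on the relations and is settled
  for \<open>sto\<close> in \<open>pgrade_direct\<close>.\<close>

lemma homogeneous_decomposition:
  assumes "t \<in> lie_terms X"
  shows "\<exists>x0\<in>pgrade X Rel 0. \<exists>x1\<in>pgrade X Rel 1. pclass X Rel t = x0 + x1"
proof -
  interpret lie_type psmul pbr "pgrade X Rel" by (rule lie_type_presented)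
  have 0: "0 \<in> pgrade X Rel d" for d using H_subspace presented.subspace_0 by blast
  show ?thesis
    using assms
  proof (induction t)
    case (Gen x)
    then have "x \<in> X 0 \<or> x \<in> X 1" by simp
    then obtain d where "x \<in> X d" by blast
    then have "pclass X Rel (Gen x) \<in> pgrade X Rel d"
      unfolding pgrade_def by (intro imageI CollectI homogeneous_term.intros)
    then show ?case using 0 by (cases d) (auto intro: bexI[of _ 0] bexI[of _ "pclass X Rel (Gen x)"])
  next
    case Zero
    then show ?case using 0 by (auto intro!: bexI[of _ 0])
  next
    case (Add s t)
    then obtain s0 s1 t0 t1 where *: "s0 \<in> pgrade X Rel 0" "s1 \<in> pgrade X Rel 1"
      "t0 \<in> pgrade X Rel 0" "t1 \<in> pgrade X Rel 1"
      "pclass X Rel s = s0 + s1" "pclass X Rel t = t0 + t1"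
      by auto
    then show ?case using Add.prems
      by (intro bexI[of _ "s0 + t0"] bexI[of _ "s1 + t1"])
        (auto simp: pclass_Add algebra_simps intro: presented.subspace_add H_subspace)
  next
    case (Smul a s)
    then obtain s0 s1 where *: "s0 \<in> pgrade X Rel 0" "s1 \<in> pgrade X Rel 1"
      "pclass X Rel s = s0 + s1"
      by auto
    then show ?case using Smul.prems
      by (intro bexI[of _ "psmul a s0"] bexI[of _ "psmul a s1"])
        (auto simp: pclass_Smul presented.scale_right_distrib intro: presented.subspace_scale H_subspace)
  next
    case (Br s t)
    then obtain s0 s1 t0 t1 where *: "s0 \<in> pgrade X Rel 0" "s1 \<in> pgrade X Rel 1"
      "t0 \<in> pgrade X Rel 0" "t1 \<in> pgrade X Rel 1"
      "pclass X Rel s = s0 + s1" "pclass X Rel t = t0 + t1"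
      by auto
    have "pbr s0 t0 + pbr s1 t1 \<in> pgrade X Rel 0" "pbr s0 t1 + pbr s1 t0 \<in> pgrade X Rel 1"
      using H_br[OF *(1,3)] H_br[OF *(2,4)] H_br[OF *(1,4)] H_br[OF *(2,3)]
      by (auto intro: presented.subspace_add H_subspace)
    then show ?case using Br.prems *
      by (intro bexI[of _ "pbr s0 t0 + pbr s1 t1"] bexI[of _ "pbr s0 t1 + pbr s1 t0"])
        (auto simp: pclass_Br br_add_left br_add_right algebra_simps)
  qed
qed

section \<open>Passage between the presented algebra as a record and as part of a type\<close>

context
  fixes X :: "bit \<Rightarrow> 'x set"
    and Rel :: "(('k::comm_ring_1, 'x) lie_term \<times> ('k, 'x) lie_term) set"
begin

abbreviation (input) cls :: "('k, 'x) lie_term \<Rightarrow> ('k, 'x) lie_term set" where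
  "cls t \<equiv> lie_cong X Rel `` {t}"

abbreviation (input) L :: "('k, ('k, 'x) lie_term set) lie_super" where
  "L \<equiv> presented_lie_superalgebra X Rel"

lemma equiv_lie_cong: "equiv (lie_terms X) (lie_cong X Rel)"
  by (rule equivI)
    (auto simp: refl_on_def sym_def trans_def dest: lie_cong_in_lie_terms
      intro: lie_cong.refl lie_cong.sym lie_cong.trans)

lemma cls_eq_iff: "s \<in> lie_terms X \<Longrightarrow> t \<in> lie_terms X \<Longrightarrow>
    cls s = cls t \<longleftrightarrow> pclass X Rel s = pclass X Rel t"
  by (simp add: pclass_eq_iff eq_equiv_class_iff[OF equiv_lie_cong])

lemma carrier_presented: "carrier L = cls ` lie_terms X"
  by (auto simp: presented_lie_superalgebra_def quotient_def)

lemma zero_presented: "\<zero>\<^bsub>L\<^esub> = cls Zero"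
  by (simp add: presented_lie_superalgebra_def)

lemma add_presented: "s \<in> lie_terms X \<Longrightarrow> t \<in> lie_terms X \<Longrightarrow> cls s \<oplus>\<^bsub>L\<^esub> cls t = cls (Add s t)"
  unfolding presented_lie_superalgebra_def
  using UN_equiv_class2[OF equiv_lie_cong equiv_lie_cong, of "\<lambda>s t. cls (Add s t)" s t]
  by (auto simp: congruent2_def eq_equiv_class_iff[OF equiv_lie_cong]
      dest: lie_cong_in_lie_terms intro!: equiv_class_eq[OF equiv_lie_cong] lie_cong.cong_Add)

lemma bracket_presented: "s \<in> lie_terms X \<Longrightarrow> t \<in> lie_terms X \<Longrightarrow>
    bracket L (cls s) (cls t) = cls (Br s t)"
  unfolding presented_lie_superalgebra_def
  using UN_equiv_class2[OF equiv_lie_cong equiv_lie_cong, of "\<lambda>s t. cls (Br s t)" s t]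
  by (auto simp: congruent2_def eq_equiv_class_iff[OF equiv_lie_cong]
      dest: lie_cong_in_lie_terms intro!: equiv_class_eq[OF equiv_lie_cong] lie_cong.cong_Br)

lemma smult_presented: "s \<in> lie_terms X \<Longrightarrow> c \<odot>\<^bsub>L\<^esub> cls s = cls (Smul c s)"
  unfolding presented_lie_superalgebra_def
  using UN_equiv_class[OF equiv_lie_cong, of "\<lambda>s. cls (Smul c s)" s]
  by (auto simp: congruent_def eq_equiv_class_iff[OF equiv_lie_cong]
      dest: lie_cong_in_lie_terms intro!: equiv_class_eq[OF equiv_lie_cong] lie_cong.cong_Smul)

lemma grade_presented: "grade L d = cls ` {t. homogeneous_term X d t}"
  by (auto simp: presented_lie_superalgebra_def quotient_def)

end

section \<open>Orthosymplectic matrices\<close>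

text \<open>The dual index with respect to the form, and its bookkeeping of signs.\<close>

definition st :: "'m + 'n + 'n \<Rightarrow> 'm + 'n + 'n" where
  "st p = (case p of Inl i \<Rightarrow> Inl i | Inr (Inl k) \<Rightarrow> Inr (Inr k) | Inr (Inr k) \<Rightarrow> Inr (Inl k))"

abbreviation dg :: "'m + 'n + 'n \<Rightarrow> bit" where
  "dg \<equiv> index_degree"

definition nu :: "'m + 'n + 'n \<Rightarrow> bit" where
  "nu p = (case p of Inr (Inr k) \<Rightarrow> 1 | _ \<Rightarrow> 0)"

text \<open>The sign in front of entry \<open>(p, q)\<close> in \<^const>\<open>osp_transpose\<close>.\<close>

definition xs :: "'m + 'n + 'n \<Rightarrow> 'm + 'n + 'n \<Rightarrow> bit" where
  "xs p q = nu p + nu q + (1 + dg p) * dg q"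

lemma st_simps [simp]: "st (Inl i) = Inl i" "st (Inr (Inl k)) = Inr (Inr k)"
  "st (Inr (Inr k)) = Inr (Inl k)"
  by (simp_all add: st_def)

lemma nu_simps [simp]: "nu (Inl i) = 0" "nu (Inr (Inl k)) = 0" "nu (Inr (Inr k)) = 1"
  by (simp_all add: nu_def)

lemma dg_simps [simp]: "dg (Inl i) = 0" "dg (Inr p) = 1"
  by (simp_all add: index_degree_def)

lemma index_cases: obtains i where "p = Inl i" | k where "p = Inr (Inl k)" | k where "p = Inr (Inr k)"
  by (metis sumE)

lemma st_st [simp]: "st (st p) = p"
  by (cases p rule: index_cases) auto

lemma dg_st [simp]: "dg (st p) = dg p"
  by (cases p rule: index_cases) auto

lemma nu_st: "nu (st p) = nu p + dg p"
  by (cases p rule: index_cases) auto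

lemma st_eq_iff [simp]: "st p = st q \<longleftrightarrow> p = q"
  by (metis st_st)

lemma st_eq_swap: "st p = q \<longleftrightarrow> p = st q"
  by auto

lemma bij_st: "bij st"
  by (metis bijI' st_st)

lemma sum_st: "(\<Sum>p\<in>UNIV. f (st p)) = (\<Sum>p\<in>UNIV. f p)"
  by (rule sum.reindex_bij_betw) (rule bij_st)

section \<open>The grading of the matrices and the superinvolution defining osp\<close>

context superalgebra_with_superinvolution
begin

text \<open>An explicit candidate for the homogeneous component; the definite description in
  \<open>component\<close> is of use only once the decomposition is known to be unique.\<close>

definition cm :: "bit \<Rightarrow> ('m::finite, 'n::finite, 'r) smatrix \<Rightarrow> ('m, 'n, 'r) smatrix" where
  "cm d A = (\<chi> p q. component gr (d + dg p + dg q) (A $ p $ q))"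

lemma module_mat: "Modules.module (mat_scale scal :: 'k \<Rightarrow> ('m::finite, 'n::finite, 'r) smatrix \<Rightarrow> _)"
  by unfold_locales (simp_all add: mat_scale_def vec_eq_iff scale_right_distrib scale_left_distrib)

lemma mat_gradeD: "A \<in> mat_grade gr d \<Longrightarrow> A $ p $ q \<in> gr (d + dg p + dg q)"
  by (simp add: mat_grade_def)

lemma mat_grade_subspace:
  "module.subspace (mat_scale scal) (mat_grade gr d :: ('m::finite, 'n::finite, 'r) smatrix set)"
proof -
  interpret M: Modules.module "mat_scale scal :: 'k \<Rightarrow> ('m, 'n, 'r) smatrix \<Rightarrow> _"
    by (rule module_mat)
  show ?thesis
    by (rule M.subspaceI)
      (auto simp: mat_grade_def mat_scale_def gr_sub subspace_0 subspace_add subspace_scale)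
qed

lemma cm_in: "cm d A \<in> mat_grade gr d"
  by (simp add: cm_def mat_grade_def)

lemma cm_decomp: "cm 0 A + cm 1 A = A"
proof -
  have "component gr e x + component gr (1 + e) x = x" for e x
    using component_decomp[of x] by (cases e) (simp_all add: add.commute)
  then show ?thesis by (simp add: vec_eq_iff cm_def add.assoc)
qed

lemma graded_module_mat:
  "graded_module (mat_scale scal) (mat_grade gr :: bit \<Rightarrow> ('m::finite, 'n::finite, 'r) smatrix set)"
proof -
  interpret M: Modules.module "mat_scale scal :: 'k \<Rightarrow> ('m, 'n, 'r) smatrix \<Rightarrow> _"
    by (rule module_mat)
  show ?thesis
  proof
    fix d show "M.subspace (mat_grade gr d)" by (rule mat_grade_subspace)
  next
    fix x :: "('m, 'n, 'r) smatrix"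
    have uniq: "y = cm 0 x \<and> z = cm 1 x" if "y \<in> mat_grade gr 0" "z \<in> mat_grade gr 1" "x = y + z" for y z
    proof -
      have c: "cm d x = cm d y + cm d z" for d
        using that(3) by (simp add: vec_eq_iff cm_def component_add)
      have "cm 0 y = y" "cm 1 y = 0" "cm 1 z = z" "cm 0 z = 0"
        by (simp_all add: vec_eq_iff cm_def component_homog[OF mat_gradeD[OF that(1)]]
            component_homog[OF mat_gradeD[OF that(2)]] add.assoc)
      then show ?thesis using c by simp
    qed
    show "\<exists>!(x0, x1). x0 \<in> mat_grade gr 0 \<and> x1 \<in> mat_grade gr 1 \<and> x = x0 + x1"
      by (rule ex1I[of _ "(cm 0 x, cm 1 x)"])
        (auto simp: cm_in cm_decomp dest: uniq)
  qed
qed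

end

text \<open>The parameter \<open>mn\<close> only pins down the index types, which do not occur in
  the other parameters.\<close>

locale osp_setup = superalgebra_with_superinvolution scal gr bar
  for scal :: "'k::comm_ring_1 \<Rightarrow> 'r::ring_1 \<Rightarrow> 'r" and gr :: "bit \<Rightarrow> 'r set" and bar :: "'r \<Rightarrow> 'r" +
  fixes mn :: "('m::finite \<times> 'n::finite) itself"
begin

abbreviation ms :: "'k \<Rightarrow> ('m, 'n, 'r) smatrix \<Rightarrow> ('m, 'n, 'r) smatrix" where
  "ms \<equiv> mat_scale scal"
abbreviation mg :: "bit \<Rightarrow> ('m, 'n, 'r) smatrix set" where
  "mg \<equiv> mat_grade gr"
abbreviation mbr :: "('m, 'n, 'r) smatrix \<Rightarrow> ('m, 'n, 'r) smatrix \<Rightarrow> ('m, 'n, 'r) smatrix" where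
  "mbr \<equiv> mat_scomm gr"
abbreviation ot :: "('m, 'n, 'r) smatrix \<Rightarrow> ('m, 'n, 'r) smatrix" where
  "ot \<equiv> osp_transpose gr bar"
abbreviation eu :: "'m + 'n + 'n \<Rightarrow> 'm + 'n + 'n \<Rightarrow> 'r \<Rightarrow> ('m, 'n, 'r) smatrix" where
  "eu \<equiv> mat_unit"

sublocale M: graded_module ms mg
  by (rule graded_module_mat)

lemma sg_nth: "sg d A $ p = sg d (A $ p)"
  by (cases d) simp_all

lemma mult_minus: "A ** (- B) = - (A ** B)" "(- A) ** B = - (A ** B)"
  for A B :: "('m, 'n, 'r) smatrix"
  by (simp_all add: vec_eq_iff matrix_matrix_mult_def sum_negf)

lemma mult_sg: "A ** sg d B = sg d (A ** B)" "sg d A ** B = sg d (A ** B)"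
  for A B :: "('m, 'n, 'r) smatrix"
  by (cases d; simp add: mult_minus)+

lemma mult_add: "A ** (B + C) = A ** B + A ** C" "(A + B) ** C = A ** C + B ** C"
  for A B C :: "('m, 'n, 'r) smatrix"
  by (simp_all add: vec_eq_iff matrix_matrix_mult_def sum.distrib algebra_simps)

lemma mult_diff: "A ** (B - C) = A ** B - A ** C" "(A - B) ** C = A ** C - B ** C"
  for A B C :: "('m, 'n, 'r) smatrix"
  by (simp_all add: vec_eq_iff matrix_matrix_mult_def sum_subtractf algebra_simps)

lemma mult_ms: "A ** ms c B = ms c (A ** B)" "ms c A ** B = ms c (A ** B)"
  by (simp_all add: vec_eq_iff matrix_matrix_mult_def mat_scale_def scale_mult_left scale_mult_right
      scale_sum_right)

lemma mult_mg: "A \<in> mg d \<Longrightarrow> B \<in> mg e \<Longrightarrow> A ** B \<in> mg (d + e)"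
proof -
  assume *: "A \<in> mg d" "B \<in> mg e"
  have "A $ p $ r * B $ r $ q \<in> gr (d + e + dg p + dg q)" for p r q
    using gr_mult[OF mat_gradeD[OF *(1), of p r] mat_gradeD[OF *(2), of r q]]
    by (simp add: ac_simps)
  then show ?thesis
    by (auto simp: mat_grade_def matrix_matrix_mult_def intro!: subspace_sum gr_sub)
qed

lemma mbr_homog:
  assumes "A \<in> mg d" "B \<in> mg e"
  shows "mbr A B = A ** B - sg (d * e) (B ** A)"
proof -
  have "mat_scale (*) (koszul x) C = sg x C" for x and C :: "('m, 'n, 'r) smatrix"
    by (simp add: vec_eq_iff mat_scale_def koszul_mult sg_nth)
  then show ?thesis
    by (cases d; cases e) (simp_all add: mat_scomm_def M.component_homog[OF assms(1)]
        M.component_homog[OF assms(2)])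
qed

lemma mbr_add: "mbr (A + B) C = mbr A C + mbr B C" "mbr A (B + C) = mbr A B + mbr A C"
  by (simp_all add: mat_scomm_def M.component_add mult_add mat_scale_def vec_eq_iff algebra_simps)

lemma mbr_ms: "mbr (ms c A) B = ms c (mbr A B)" "mbr A (ms c B) = ms c (mbr A B)"
proof -
  have "mat_scale (*) (koszul x) C = sg x C" for x and C :: "('m, 'n, 'r) smatrix"
    by (simp add: vec_eq_iff mat_scale_def koszul_mult sg_nth)
  then show "mbr (ms c A) B = ms c (mbr A B)" "mbr A (ms c B) = ms c (mbr A B)"
    by (simp_all add: mat_scomm_def M.component_scale mult_ms M.scale_right_distrib
        M.scale_right_diff_distrib flip: M.scale_sg)
qed

lemma mbr_mg: "A \<in> mg d \<Longrightarrow> B \<in> mg e \<Longrightarrow> mbr A B \<in> mg (d + e)"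
  using mult_mg[of A d B e] mult_mg[of B e A d]
  by (simp add: mbr_homog add.commute M.subspace_diff M.gr_sub M.gr_sg)

text \<open>One formula in place of the nine blocks: reflect the position by \<open>st\<close>,
  apply \<open>cj\<close>, multiply by the sign \<open>xs\<close>.\<close>

lemma ot_nth: "ot A $ p $ q = sg (xs p q) (cj (dg p + dg q) (A $ st q $ st p))"
  by (cases p rule: index_cases; cases q rule: index_cases)
    (simp_all add: osp_transpose_def xs_def cj_def)

lemma ot_add: "ot (A + B) = ot A + ot B"
  by (simp add: vec_eq_iff ot_nth cj_add sg_add)

lemma ot_ms: "ot (ms c A) = ms c (ot A)"
  by (simp add: vec_eq_iff ot_nth mat_scale_def cj_scale scale_sg)

lemma ot_sg: "ot (sg d A) = sg d (ot A)"
  by (rule additive_sg) (rule ot_add)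

lemma ot_diff: "ot (A - B) = ot A - ot B"
  using ot_add[of A "- B"] ot_sg[of 1 B] by simp

lemma ot_ot [simp]: "ot (ot A) = A"
proof -
  have "xs p q + xs (st q) (st p) = 0" for p q :: "'m + 'n + 'n"
    by (cases p rule: index_cases; cases q rule: index_cases) (simp_all add: xs_def)
  then have "sg (xs p q + xs (st q) (st p)) x = x" for p q :: "'m + 'n + 'n" and x :: 'r
    by simp
  moreover have "cj (dg p + dg q) (cj (dg q + dg p) a) = a" for p q :: "'m + 'n + 'n" and a
    by (simp add: add.commute)
  ultimately show ?thesis
    by (simp add: vec_eq_iff ot_nth cj_sg)
qed

lemma ot_mg: "A \<in> mg d \<Longrightarrow> ot A \<in> mg d"
proof -
  assume "A \<in> mg d"
  then have "A $ st q $ st p \<in> gr (d + dg p + dg q)" for p q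
    using mat_gradeD[of A d "st q" "st p"] by (simp add: ac_simps)
  then show "ot A \<in> mg d"
    unfolding mat_grade_def by (simp add: ot_nth gr_sg cj_gr)
qed

text \<open>Reindexing the inner sum by \<open>st\<close> reverses the order of the factors
  entrywise, so only signs remain to be compared. Together with \<open>ot_ot\<close> this makes
  \<open>ot\<close> a superinvolution of the matrices.\<close>

lemma ot_mult:
  assumes A: "A \<in> mg d" and B: "B \<in> mg e"
  shows "ot (A ** B) = sg (d * e) (ot B ** ot A)"
proof -
  have "ot (A ** B) $ p $ q = sg (d * e) (ot B ** ot A) $ p $ q" for p q
  proof -
    have "ot (A ** B) $ p $ q =
        (\<Sum>r\<in>UNIV. sg (xs p q) (cj (dg p + dg q) (A $ st q $ st r * B $ st r $ st p)))"
      by (simp add: ot_nth matrix_matrix_mult_def cj_sum sg_sum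
          sum_st[of "\<lambda>r. sg (xs p q) (cj (dg p + dg q) (A $ st q $ r * B $ r $ st p))"])
    also have "\<dots> = (\<Sum>r\<in>UNIV. sg (d * e) (ot B $ p $ r * ot A $ r $ q))"
    proof (rule sum.cong)
      fix r :: "'m + 'n + 'n"
      have a: "A $ st q $ st r \<in> gr (d + dg q + dg r)" and b: "B $ st r $ st p \<in> gr (e + dg r + dg p)"
        using mat_gradeD[OF A, of "st q" "st r"] mat_gradeD[OF B, of "st r" "st p"] by simp_all
      \<comment> \<open>On the left stand the signs of \<open>ot\<close> and \<open>cj\<close> at
        the entry of the product and of \<open>bar\<close> reversing that product; on the right d *
        e and the signs at the two separate entries.\<close>
      have x: "xs p q + (dg p + dg q) * (d + dg q + dg r + (e + dg r + dg p)) +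
          (d + dg q + dg r) * (e + dg r + dg p) =
          d * e + xs p r + (dg p + dg r) * (e + dg r + dg p) + xs r q + (dg r + dg q) * (d + dg q + dg r)"
        unfolding xs_def
        by (cases "nu p"; cases "nu q"; cases "nu r"; cases "dg p"; cases "dg q"; cases "dg r"; cases d; cases e)
          simp_all
      show "sg (xs p q) (cj (dg p + dg q) (A $ st q $ st r * B $ st r $ st p)) =
          sg (d * e) (ot B $ p $ r * ot A $ r $ q)"
        by (simp add: ot_nth cj_homog[OF gr_mult[OF a b]] cj_homog[OF a] cj_homog[OF b]
            bar_times[OF a b] sg_mult_left sg_mult_right, rule arg_cong[where f = "\<lambda>x. sg x _"])
          (use x in \<open>simp add: ac_simps\<close>)
    qed simp
    also have "\<dots> = sg (d * e) (ot B ** ot A) $ p $ q"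
      by (simp add: matrix_matrix_mult_def sg_nth sg_sum)
    finally show ?thesis .
  qed
  then show ?thesis by (simp add: vec_eq_iff)
qed

lemma ot_mbr_homog: "A \<in> mg d \<Longrightarrow> B \<in> mg e \<Longrightarrow> ot (mbr A B) = - mbr (ot A) (ot B)"
  by (simp add: mbr_homog[of A d B e] mbr_homog[OF ot_mg ot_mg] ot_diff ot_sg ot_mult
      ot_mult[of B e A d] mult.commute)

text \<open>Since \<open>ot\<close> reverses products up to sign, \<open>- ot\<close> is an
  automorphism of the Lie superalgebra of matrices; osp~ is its fixed point set.\<close>

lemma ot_mbr: "ot (mbr A B) = - mbr (ot A) (ot B)"
proof (induction A rule: M.homogeneous_induct)
  case (1 d A)
  note A = this
  show ?case
  proof (induction B rule: M.homogeneous_induct)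
    case (1 e B)
    then show ?case by (rule ot_mbr_homog[OF A])
  qed (simp add: mbr_add ot_add)
qed (simp add: mbr_add ot_add)

lemma component_ot: "component mg d (ot A) = ot (component mg d A)"
proof (rule M.component_eqI)
  show "ot A - ot (component mg d A) \<in> mg (d + 1)"
    using ot_mg[OF M.component_compl[of A d]] by (simp add: ot_diff)
qed (simp add: ot_mg)

text \<open>All generators of \<^const>\<open>osp\<close> have this form, see \<open>osp_element_eq\<close>.\<close>

definition XM :: "'m + 'n + 'n \<Rightarrow> 'm + 'n + 'n \<Rightarrow> 'r \<Rightarrow> ('m, 'n, 'r) smatrix" where
  "XM p q a = eu p q a - ot (eu p q a)"

lemma eu_nth: "eu p q a $ p' $ q' = (if p' = p \<and> q' = q then a else 0)"
  by (simp add: mat_unit_def)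

lemma eu_add: "eu p q (a + b) = eu p q a + eu p q b"
  by (simp add: vec_eq_iff eu_nth)

lemma eu_ms: "eu p q (scal c a) = ms c (eu p q a)"
  by (simp add: vec_eq_iff eu_nth mat_scale_def)

lemma eu_mg: "a \<in> gr d \<Longrightarrow> eu p q a \<in> mg (d + dg p + dg q)"
proof -
  have "dg p + (dg p + (dg q + dg q)) = 0" by simp
  then show "a \<in> gr d \<Longrightarrow> eu p q a \<in> mg (d + dg p + dg q)"
    by (auto simp: mat_grade_def eu_nth gr_sub subspace_0 ac_simps)
qed

lemma eu_mult: "eu p q a ** eu r s b = (if q = r then eu p s (a * b) else 0)"
proof -
  have "(\<Sum>k\<in>UNIV. (if i = p \<and> k = q then a else 0) * (if k = r \<and> j = s then b else 0)) =
      (\<Sum>k\<in>UNIV. if k = q then (if q = r \<and> i = p \<and> j = s then a * b else 0) else 0)" for i j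
    by (rule sum.cong) auto
  then show ?thesis
    by (auto simp: vec_eq_iff matrix_matrix_mult_def eu_nth)
qed

lemma ot_eu: "ot (eu p q a) = sg (xs (st q) (st p)) (eu (st q) (st p) (cj (dg p + dg q) a))"
  by (auto simp: vec_eq_iff ot_nth eu_nth sg_nth ac_simps)

lemma XM_add: "XM p q (a + b) = XM p q a + XM p q b"
  by (simp add: XM_def eu_add ot_add)

lemma XM_ms: "XM p q (scal c a) = ms c (XM p q a)"
  by (simp add: XM_def eu_ms ot_ms M.scale_right_diff_distrib)

lemma XM_sg: "XM p q (sg d a) = sg d (XM p q a)"
  by (rule additive_sg) (rule XM_add)

lemma XM_mg: "a \<in> gr d \<Longrightarrow> XM p q a \<in> mg (d + dg p + dg q)"
  by (simp add: XM_def M.subspace_diff M.gr_sub ot_mg eu_mg)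

lemma XM_st: "XM p q a = - sg (xs (st q) (st p)) (XM (st q) (st p) (cj (dg p + dg q) a))"
proof -
  have "XM p q a = - (ot (eu p q a) - ot (ot (eu p q a)))" by (simp add: XM_def)
  also have "ot (eu p q a) - ot (ot (eu p q a)) = sg (xs (st q) (st p)) (XM (st q) (st p) (cj (dg p + dg q) a))"
    unfolding ot_eu[of p q a] by (simp only: XM_def ot_sg sg_diff)
  finally show ?thesis .
qed

lemma ot_XM: "ot (XM p q a) = - XM p q a"
  by (simp add: XM_def ot_diff)

lemma mbr_minus: "mbr (- A) B = - mbr A B" "mbr A (- B) = - mbr A B"
  using mbr_ms(1)[of "- 1" A B] mbr_ms(2)[of A "- 1" B] by simp_all

lemma mbr_diff: "mbr (A - B) C = mbr A C - mbr B C" "mbr A (B - C) = mbr A B - mbr A C"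
  using mbr_add(1)[of A "- B" C] mbr_add(2)[of A B "- C"] by (simp_all add: mbr_minus)

lemma mbr_sg: "mbr (sg d A) B = sg d (mbr A B)" "mbr A (sg d B) = sg d (mbr A B)"
  by (cases d; simp add: mbr_minus)+

lemma mbr_eu:
  assumes "a \<in> gr d" "b \<in> gr e"
  shows "mbr (eu p q a) (eu r s b) = (if q = r then eu p s (a * b) else 0) -
    sg ((d + dg p + dg q) * (e + dg r + dg s)) (if s = p then eu r q (b * a) else 0)"
  by (simp add: mbr_homog[OF eu_mg[OF assms(1)] eu_mg[OF assms(2)]] eu_mult)

lemma XM_0 [simp]: "XM p q 0 = 0"
  using XM_add[of p q 0 0] by simp

text \<open>Put pi A = A - \<open>ot\<close> A. As \<open>- ot\<close> is an automorphism,
  [pi E, pi F] = pi [E, F] - pi [E, \<open>ot\<close> F]. The two brackets of matrix units account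
  for the four possible coincidences between {p, q} and {r, s} up to \<open>st\<close>.\<close>

lemma mbr_XM:
  assumes a: "a \<in> gr d" and b: "b \<in> gr e"
  shows "mbr (XM p q a) (XM r s b) =
    (if q = r then XM p s (a * b) else 0)
    - sg ((d + dg p + dg q) * (e + dg r + dg s)) (if s = p then XM r q (b * a) else 0)
    - sg (xs (st s) (st r)) ((if q = st s then XM p (st r) (a * cj (dg r + dg s) b) else 0)
        - sg ((d + dg p + dg q) * (e + dg r + dg s)) (if r = st p then XM (st s) q (cj (dg r + dg s) b * a) else 0))"
proof -
  let ?E = "eu p q a" and ?F = "eu r s b"
  let ?pi = "\<lambda>A. A - ot A"
  have pi_if: "?pi (if P then eu u v x else 0) = (if P then XM u v x else 0)" for P u v x
    using ot_add[of 0 0] by (simp add: XM_def)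
  have pi_diff: "?pi (A - B) = ?pi A - ?pi B" for A B by (simp add: ot_diff)
  have pi_sg: "?pi (sg x A) = sg x (?pi A)" for x A by (simp add: ot_sg sg_diff)
  have o1: "mbr (ot ?E) (ot ?F) = - ot (mbr ?E ?F)" by (simp add: ot_mbr)
  have o2: "mbr (ot ?E) ?F = - ot (mbr ?E (ot ?F))" by (simp add: ot_mbr)
  have "mbr (XM p q a) (XM r s b) = ?pi (mbr ?E ?F) - ?pi (mbr ?E (ot ?F))"
    by (simp add: XM_def mbr_diff o1 o2)
  also have "?pi (mbr ?E ?F) = (if q = r then XM p s (a * b) else 0)
    - sg ((d + dg p + dg q) * (e + dg r + dg s)) (if s = p then XM r q (b * a) else 0)"
    unfolding mbr_eu[OF a b] pi_diff pi_sg pi_if ..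
  also have "?pi (mbr ?E (ot ?F)) = sg (xs (st s) (st r)) ((if q = st s then XM p (st r) (a * cj (dg r + dg s) b) else 0)
        - sg ((d + dg p + dg q) * (e + dg r + dg s)) (if r = st p then XM (st s) q (cj (dg r + dg s) b * a) else 0))"
    unfolding ot_eu[of r s b] mbr_sg(2) mbr_eu[OF a cj_gr[OF b]] pi_diff pi_sg pi_if
    by (simp add: add.commute add.left_commute st_eq_swap)
  finally show ?thesis .
qed

lemma XM_nth: "XM p q a $ p' $ q' = (if p' = p \<and> q' = q then a else 0)
    - sg (xs (st q) (st p)) (if p' = st q \<and> q' = st p then cj (dg p + dg q) a else 0)"
  by (simp add: XM_def ot_eu eu_nth sg_nth)

lemma sum_eu: "(\<Sum>p\<in>UNIV. \<Sum>q\<in>UNIV. eu p q (A $ p $ q)) = A"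
proof -
  have "(\<Sum>p\<in>UNIV. \<Sum>q\<in>UNIV. eu p q (A $ p $ q)) $ i $ j = A $ i $ j" for i j
  proof -
    have "(\<Sum>p\<in>UNIV. \<Sum>q\<in>UNIV. eu p q (A $ p $ q)) $ i $ j =
        (\<Sum>p\<in>UNIV. \<Sum>q\<in>UNIV. if q = j then if p = i then A $ i $ j else 0 else 0)"
      unfolding sum_component eu_nth by (intro sum.cong refl) auto
    also have "\<dots> = A $ i $ j" by (simp only: sum.delta finite UNIV_I if_True)
    finally show ?thesis .
  qed
  then show ?thesis by (simp add: vec_eq_iff)
qed

lemma sum_ot: "ot (\<Sum>i\<in>S. f i) = (\<Sum>i\<in>S. ot (f i))"
proof (induction S rule: infinite_finite_induct)
  case (infinite A) then show ?case using ot_add[of 0 0] by simp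
next
  case empty show ?case using ot_add[of 0 0] by simp
qed (simp_all add: ot_add)

text \<open>For A in osp~ the right-hand side is 2 A, so such an A is half of a sum of elements
  X_pq.\<close>

lemma sum_XM: "(\<Sum>p\<in>UNIV. \<Sum>q\<in>UNIV. XM p q (A $ p $ q)) = A - ot A"
proof -
  have "(\<Sum>p\<in>UNIV. \<Sum>q\<in>UNIV. XM p q (A $ p $ q)) =
      (\<Sum>p\<in>UNIV. \<Sum>q\<in>UNIV. eu p q (A $ p $ q)) - ot (\<Sum>p\<in>UNIV. \<Sum>q\<in>UNIV. eu p q (A $ p $ q))"
    by (simp add: XM_def sum_subtractf sum_ot)
  then show ?thesis by (simp add: sum_eu)
qed

end

section \<open>The cocycle\<close>

context osp_setup
begin

lemma mbr_antisym: "A \<in> mg d \<Longrightarrow> B \<in> mg e \<Longrightarrow> mbr A B = - sg (d * e) (mbr B A)"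
  by (simp add: mbr_homog[of A d B e] mbr_homog[of B e A d] sg_diff mult.commute)

lemma mbr_jacobi:
  assumes x: "x \<in> mg d" and y: "y \<in> mg e" and z: "z \<in> mg f"
  shows "sg (d * f) (mbr (mbr x y) z) + sg (e * d) (mbr (mbr y z) x) + sg (f * e) (mbr (mbr z x) y) = 0"
  unfolding mbr_homog[OF mbr_mg[OF x y] z] mbr_homog[OF mbr_mg[OF y z] x] mbr_homog[OF mbr_mg[OF z x] y]
  unfolding mbr_homog[OF x y] mbr_homog[OF y z] mbr_homog[OF z x]
  by (cases d; cases e; cases f) (simp_all add: mult_diff mult_add mult_sg mult_minus matrix_mul_assoc)

sublocale Mat: lie_type ms mbr mg
  by unfold_locales
    (blast intro: mbr_add mbr_ms M.gr_sub mbr_mg mbr_antisym mbr_jacobi)+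

end

text \<open>An arbitrary pairing with the properties of <a,b>. The universal one, with values in a
  quotient of a free module, is substituted for \<open>sto_setup\<close>.\<close>

locale skew_dihedral_form = osp_setup scal gr bar mn + Q: Modules.module sq
  for scal :: "'k::comm_ring_1 \<Rightarrow> 'r::ring_1 \<Rightarrow> 'r" and gr :: "bit \<Rightarrow> 'r set" and bar :: "'r \<Rightarrow> 'r"
    and mn :: "('m::finite \<times> 'n::finite) itself" and sq :: "'k \<Rightarrow> 'q::ab_group_add \<Rightarrow> 'q" +
  fixes ang :: "'r \<Rightarrow> 'r \<Rightarrow> 'q"
  assumes ang_add_left: "ang (a + a') b = ang a b + ang a' b"
    and ang_add_right: "ang a (b + b') = ang a b + ang a b'"
    and ang_scale_left: "ang (scal k a) b = sq k (ang a b)"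
    and ang_scale_right: "ang a (scal k b) = sq k (ang a b)"
    and ang_bar: "ang (bar a) (bar b) = ang a b"
    and ang_skew: "a \<in> gr d \<Longrightarrow> b \<in> gr e \<Longrightarrow> ang a b = - sg (d * e) (ang b a)"
    and ang_cyclic: "a \<in> gr d \<Longrightarrow> b \<in> gr e \<Longrightarrow> c \<in> gr f \<Longrightarrow>
      sg (d * f) (ang (a * b) c) + sg (d * e) (ang (b * c) a) + sg (e * f) (ang (c * a) b) = 0"
begin

lemma ang_zero [simp]: "ang 0 b = 0" "ang a 0 = 0"
  using ang_add_left[of 0 0 b] ang_add_right[of a 0 0] by simp_all

lemma ang_sg: "ang (sg d a) b = sg d (ang a b)" "ang a (sg d b) = sg d (ang a b)"
  by (rule additive_sg, rule ang_add_left, rule additive_sg, rule ang_add_right)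

lemma ang_sum: "ang (\<Sum>i\<in>S. f i) b = (\<Sum>i\<in>S. ang (f i) b)"
  by (induction S rule: infinite_finite_induct) (simp_all add: ang_add_left)

text \<open>The cyclic relation for 1, 1, c reads <1,c> + 2<c,1> = 0, and <1,c> = -<c,1> by skew
  symmetry.\<close>

lemma ang_one: "ang 1 c = 0"
proof (induction c rule: homogeneous_induct)
  case (1 f c)
  have "ang c 1 = 0"
    using ang_cyclic[OF one_in_gr one_in_gr 1] ang_skew[OF one_in_gr 1] by simp
  then show ?case using ang_skew[OF one_in_gr 1] by simp
qed (simp add: ang_add_right)

text \<open>The supertrace of \<open>A ** B\<close> with products of entries replaced by \<open>ang\<close>; the argument \<open>d\<close> is the
  total degree.\<close>

definition alpha0 :: "bit \<Rightarrow> ('m, 'n, 'r) smatrix \<Rightarrow> ('m, 'n, 'r) smatrix \<Rightarrow> 'q" where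
  "alpha0 d A B = (\<Sum>p\<in>UNIV. \<Sum>q\<in>UNIV. sg (dg p * (d + 1)) (ang (A $ p $ q) (B $ q $ p)))"

definition alpha :: "('m, 'n, 'r) smatrix \<Rightarrow> ('m, 'n, 'r) smatrix \<Rightarrow> 'q" where
  "alpha A B = (\<Sum>d\<in>{0, 1}. \<Sum>e\<in>{0, 1}. alpha0 (d + e) (component mg d A) (component mg e B))"

lemma alpha0_zero [simp]: "alpha0 d 0 B = 0" "alpha0 d A 0 = 0"
  by (simp_all add: alpha0_def)

lemma alpha_homog: "A \<in> mg d \<Longrightarrow> B \<in> mg e \<Longrightarrow> alpha A B = alpha0 (d + e) A B"
  by (cases d; cases e) (simp_all add: alpha_def M.component_homog)

lemma alpha0_add: "alpha0 d (A + A') B = alpha0 d A B + alpha0 d A' B"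
  "alpha0 d A (B + B') = alpha0 d A B + alpha0 d A B'"
  by (simp_all add: alpha0_def ang_add_left ang_add_right sg_add sum.distrib)

lemma alpha0_ms: "alpha0 d (ms c A) B = sq c (alpha0 d A B)" "alpha0 d A (ms c B) = sq c (alpha0 d A B)"
  by (simp_all add: alpha0_def mat_scale_def ang_scale_left ang_scale_right Q.scale_sum_right Q.scale_sg)

lemma alpha_add: "alpha (A + A') B = alpha A B + alpha A' B"
  "alpha A (B + B') = alpha A B + alpha A B'"
  by (simp_all add: alpha_def M.component_add alpha0_add algebra_simps)

lemma alpha_ms: "alpha (ms c A) B = sq c (alpha A B)" "alpha A (ms c B) = sq c (alpha A B)"
  by (simp_all add: alpha_def M.component_scale alpha0_ms Q.scale_right_distrib)

lemma alpha_sg: "alpha (sg d A) B = sg d (alpha A B)" "alpha A (sg d B) = sg d (alpha A B)"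
  by (rule additive_sg, rule alpha_add, rule additive_sg, rule alpha_add)

lemma alpha_diff: "alpha (A - A') B = alpha A B - alpha A' B" "alpha A (B - B') = alpha A B - alpha A B'"
  using alpha_add(1)[of "A - A'" A' B] alpha_add(2)[of A "B - B'" B'] by (simp_all add: algebra_simps)

lemma alpha_skew:
  assumes A: "A \<in> mg d" and B: "B \<in> mg e"
  shows "alpha A B = - sg (d * e) (alpha B A)"
proof -
  have "sg (dg p * (d + e + 1)) (ang (A $ p $ q) (B $ q $ p)) =
      - sg (d * e) (sg (dg q * (e + d + 1)) (ang (B $ q $ p) (A $ p $ q)))" for p q
  proof -
    \<comment> \<open>The degrees of the two entries differ from d and e by dg p + dg q; this moves
      the supertrace sign from p to q.\<close>
    have x: "dg p * (d + e + 1) + (d + dg p + dg q) * (e + dg q + dg p) = d * e + dg q * (e + d + 1)"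
      by (cases "dg p"; cases "dg q"; cases d; cases e) simp_all
    show ?thesis
      unfolding ang_skew[OF mat_gradeD[OF A] mat_gradeD[OF B], of p q]
      by (simp only: sg_minus sg_sg x)
  qed
  then have "alpha A B = (\<Sum>p\<in>UNIV. \<Sum>q\<in>UNIV. - sg (d * e) (sg (dg q * (e + d + 1)) (ang (B $ q $ p) (A $ p $ q))))"
    by (simp add: alpha_homog[OF A B] alpha0_def)
  also have "\<dots> = (\<Sum>q\<in>UNIV. \<Sum>p\<in>UNIV. - sg (d * e) (sg (dg q * (e + d + 1)) (ang (B $ q $ p) (A $ p $ q))))"
    by (rule sum.swap)
  also have "\<dots> = - sg (d * e) (alpha B A)"
    by (simp add: alpha_homog[OF B A] alpha0_def sg_sum sum_negf)
  finally show ?thesis .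
qed

text \<open>All three terms are sums over closed paths p, q, r of matrix positions. Once the
  summation indices are rotated to a common path, each summand is \<open>ang_cyclic\<close> for the
  three entries along it.\<close>

lemma alpha_mult_cyclic:
  assumes A: "A \<in> mg d" and B: "B \<in> mg e" and C: "C \<in> mg f"
  shows "sg (d * f) (alpha (A ** B) C) + sg (d * e) (alpha (B ** C) A) + sg (e * f) (alpha (C ** A) B) = 0"
proof -
  let ?D = "d + e + f + 1"
  have *: "alpha (A ** B) C = (\<Sum>p\<in>UNIV. \<Sum>q\<in>UNIV. \<Sum>r\<in>UNIV.
      sg (dg p * (d + e + f + 1)) (ang (A $ p $ r * B $ r $ q) (C $ q $ p)))"
    if "A \<in> mg d" "B \<in> mg e" "C \<in> mg f" for A B C d e f
    unfolding alpha_homog[OF mult_mg[OF that(1,2)] that(3)]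
    by (simp add: alpha0_def matrix_matrix_mult_def ang_sum sg_sum)
  let ?S = "\<lambda>g. \<Sum>p\<in>UNIV. \<Sum>q\<in>UNIV. \<Sum>r\<in>UNIV. g p q (r :: 'm + 'n + 'n)"
  have rot1: "?S g = ?S (\<lambda>p q r. g q r p)" for g :: "_ \<Rightarrow> _ \<Rightarrow> _ \<Rightarrow> 'q"
  proof -
    have "?S g = (\<Sum>p\<in>UNIV. \<Sum>r\<in>UNIV. \<Sum>q\<in>UNIV. g p q r)"
      by (rule sum.cong[OF HOL.refl], rule sum.swap)
    also have "\<dots> = (\<Sum>r\<in>UNIV. \<Sum>p\<in>UNIV. \<Sum>q\<in>UNIV. g p q r)"
      by (rule sum.swap)
    finally show ?thesis .
  qed
  have rot2: "?S g = ?S (\<lambda>p q r. g r p q)" for g :: "_ \<Rightarrow> _ \<Rightarrow> _ \<Rightarrow> 'q"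
    by (rule rot1[of "\<lambda>p q r. g r p q", symmetric])
  have t1: "alpha (A ** B) C = ?S (\<lambda>p r q. sg (dg p * ?D) (ang (A $ p $ q * B $ q $ r) (C $ r $ p)))"
    using *[OF A B C] by simp
  have t2: "alpha (B ** C) A = ?S (\<lambda>p r q. sg (dg q * ?D) (ang (B $ q $ r * C $ r $ p) (A $ p $ q)))"
    using *[OF B C A] rot2[of "\<lambda>q p r. sg (dg q * ?D) (ang (B $ q $ r * C $ r $ p) (A $ p $ q))"]
    by (simp add: ac_simps)
  have t3: "alpha (C ** A) B = ?S (\<lambda>p r q. sg (dg r * ?D) (ang (C $ r $ p * A $ p $ q) (B $ q $ r)))"
    using *[OF C A B] rot1[of "\<lambda>r q p. sg (dg r * ?D) (ang (C $ r $ p * A $ p $ q) (B $ q $ r))"]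
    by (simp add: ac_simps)
  have z: "sg (d * f) (sg (dg p * ?D) (ang (A $ p $ q * B $ q $ r) (C $ r $ p)))
    + sg (d * e) (sg (dg q * ?D) (ang (B $ q $ r * C $ r $ p) (A $ p $ q)))
    + sg (e * f) (sg (dg r * ?D) (ang (C $ r $ p * A $ p $ q) (B $ q $ r))) = 0" for p q r
  proof -
    let ?a = "d + dg p + dg q" and ?b = "e + dg q + dg r" and ?c = "f + dg r + dg p"
    \<comment> \<open>The common sign left over when the signs of \<open>ang_cyclic\<close> for the
      entry degrees \<open>?a\<close>, \<open>?b\<close>, \<open>?c\<close> are split off from the
      three summands.\<close>
    define x where "x = d * f + dg p * ?D + ?a * ?c"
    have x1: "d * f + dg p * ?D = x + ?a * ?c" by (simp add: x_def add.assoc)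
    have x2: "d * e + dg q * ?D = x + ?a * ?b" and x3: "e * f + dg r * ?D = x + ?b * ?c"
      unfolding x_def by (cases "dg p"; cases "dg q"; cases "dg r"; cases d; cases e; cases f; simp)+
    show ?thesis
      unfolding sg_sg x1 x2 x3
      using arg_cong[OF ang_cyclic[OF mat_gradeD[OF A, of p q] mat_gradeD[OF B, of q r] mat_gradeD[OF C, of r p]], of "sg x"]
      by (simp only: sg_add sg_sg sg_zero)
  qed
  show ?thesis
    unfolding t1 t2 t3 sg_sum sum.distrib[symmetric] using z by simp
qed

text \<open>The bracket of the central extension of the matrices by \<open>'q\<close> that belongs
  to the cocycle \<open>alpha\<close>.\<close>

definition mqbr :: "('m, 'n, 'r) smatrix \<times> 'q \<Rightarrow> ('m, 'n, 'r) smatrix \<times> 'q \<Rightarrow> ('m, 'n, 'r) smatrix \<times> 'q" where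
  "mqbr x y = (mbr (fst x) (fst y), alpha (fst x) (fst y))"

definition mqs :: "'k \<Rightarrow> ('m, 'n, 'r) smatrix \<times> 'q \<Rightarrow> ('m, 'n, 'r) smatrix \<times> 'q" where
  "mqs c x = (ms c (fst x), sq c (snd x))"

text \<open>The cocycle identity. The products xy, yz, zx give the cyclic identity for (x, y, z),
  the reversed products the one for (y, x, z), multiplied by the sign with exponent de + df +
  ef.\<close>

lemma alpha_jacobi:
  assumes x: "x \<in> mg d" and y: "y \<in> mg e" and z: "z \<in> mg f"
  shows "sg (d * f) (alpha (mbr x y) z) + sg (e * d) (alpha (mbr y z) x) + sg (f * e) (alpha (mbr z x) y) = 0"
proof -
  have 1: "sg (d * f) (alpha (x ** y) z) + sg (d * e) (alpha (y ** z) x) + sg (e * f) (alpha (z ** x) y) = 0"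
    by (rule alpha_mult_cyclic) fact+
  have 2: "sg (e * f) (alpha (y ** x) z) + sg (e * d) (alpha (x ** z) y) + sg (d * f) (alpha (z ** y) x) = 0"
    by (rule alpha_mult_cyclic) fact+
  have "sg (d * f) (alpha (mbr x y) z) + sg (e * d) (alpha (mbr y z) x) + sg (f * e) (alpha (mbr z x) y) =
    (sg (d * f) (alpha (x ** y) z) + sg (d * e) (alpha (y ** z) x) + sg (e * f) (alpha (z ** x) y))
    - sg (d * e + d * f + e * f) (sg (e * f) (alpha (y ** x) z) + sg (e * d) (alpha (x ** z) y) + sg (d * f) (alpha (z ** y) x))"
    unfolding mbr_homog[OF x y] mbr_homog[OF y z] mbr_homog[OF z x] alpha_diff alpha_sg
    by (cases d; cases e; cases f) simp_all
  then show ?thesis by (simp add: 1 2)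
qed

lemma module_mqs: "Modules.module mqs"
  by unfold_locales (simp_all add: mqs_def prod_eq_iff M.scale_right_distrib Q.scale_right_distrib
        M.scale_left_distrib Q.scale_left_distrib)

text \<open>The central part is put into both degrees. This is harmless since the bracket ignores
  the central parts of its arguments.\<close>

sublocale MQ: lie_type mqs mqbr "\<lambda>d. mg d \<times> UNIV"
proof
  fix x y z :: "('m, 'n, 'r) smatrix \<times> 'q" and a b :: 'k
  interpret MQ: Modules.module mqs by (rule module_mqs)
  show "mqs a (x + y) = mqs a x + mqs a y" "mqs (a + b) x = mqs a x + mqs b x"
    "mqs a (mqs b x) = mqs (a * b) x" "mqs 1 x = x"
    by (simp_all add: MQ.scale_right_distrib MQ.scale_left_distrib)
  show "mqbr (x + y) z = mqbr x z + mqbr y z" "mqbr x (y + z) = mqbr x y + mqbr x z"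
    "mqbr (mqs a x) y = mqs a (mqbr x y)" "mqbr x (mqs a y) = mqs a (mqbr x y)"
    by (simp_all add: mqbr_def mqs_def prod_eq_iff mbr_add alpha_add mbr_ms alpha_ms)
next
  fix d
  show "module.subspace mqs (mg d \<times> UNIV)"
    unfolding module.subspace_def[OF module_mqs]
    by (auto simp: mqs_def mem_Times_iff M.gr_sub M.subspace_0 M.subspace_add M.subspace_scale)
next
  fix x y :: "('m, 'n, 'r) smatrix \<times> 'q" and d e
  assume *: "x \<in> mg d \<times> UNIV" "y \<in> mg e \<times> UNIV"
  then show "mqbr x y \<in> mg (d + e) \<times> UNIV" by (auto simp: mqbr_def mbr_mg)
  from mbr_antisym[of "fst x" d "fst y" e] alpha_skew[of "fst x" d "fst y" e] *
  show "mqbr x y = - sg (d * e) (mqbr y x)"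
    by (simp only: mqbr_def prod_eq_iff fst_sg snd_sg fst_conv snd_conv fst_uminus snd_uminus mem_Times_iff)
next
  fix x y z :: "('m, 'n, 'r) smatrix \<times> 'q" and d e f
  assume "x \<in> mg d \<times> UNIV" "y \<in> mg e \<times> UNIV" "z \<in> mg f \<times> UNIV"
  then show "sg (d * f) (mqbr (mqbr x y) z) + sg (e * d) (mqbr (mqbr y z) x) + sg (f * e) (mqbr (mqbr z x) y) = 0"
    by (auto simp: mqbr_def prod_eq_iff fst_sg snd_sg mbr_jacobi alpha_jacobi)
qed

lemma alpha_eu:
  assumes "a \<in> gr d" "b \<in> gr e"
  shows "alpha (eu p q a) (eu r s b) =
    (if q = r \<and> p = s then sg (dg p * (d + e + 1)) (ang a b) else 0)"
proof -
  have "alpha (eu p q a) (eu r s b) = alpha0 (d + dg p + dg q + (e + dg r + dg s)) (eu p q a) (eu r s b)"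
    by (rule alpha_homog; rule eu_mg; fact)
  also have "\<dots> = (\<Sum>i\<in>UNIV. \<Sum>j\<in>UNIV. if j = q then if i = p then
      (if q = r \<and> p = s then sg (dg p * (d + dg p + dg q + (e + dg r + dg s) + 1)) (ang a b) else 0) else 0 else 0)"
    unfolding alpha0_def eu_nth by (intro sum.cong HOL.refl) auto
  also have "\<dots> = (if q = r \<and> p = s then sg (dg p * (d + dg p + dg q + (e + dg r + dg s) + 1)) (ang a b) else 0)"
    by (simp only: sum.delta finite UNIV_I if_True)
  also have "\<dots> = (if q = r \<and> p = s then sg (dg p * (d + e + 1)) (ang a b) else 0)"
  proof -
    have "d + dg p + dg q + (e + dg q + dg p) + 1 = d + e + 1"
      by (cases "dg p"; cases "dg q"; cases d; cases e) simp_all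
    then show ?thesis by (cases "q = r"; cases "p = s") (simp_all only: simp_thms if_True if_False)
  qed
  finally show ?thesis .
qed

text \<open>The supertrace sees two matrix units only if they are transposed to each other, so the
  cocycle can be nonzero only on opposite elements, where \<open>r\<close>, \<open>s\<close> is
  \<open>q\<close>, \<open>p\<close> or its reflection.\<close>

lemma alpha_XM_0:
  assumes "a \<in> gr d" "b \<in> gr e" "\<not> (q = r \<and> p = s)" "\<not> (q = st s \<and> p = st r)"
  shows "alpha (XM p q a) (XM r s b) = 0"
proof -
  have e: "(q = r \<and> p = s) = False" "(q = st s \<and> p = st r) = False"
    "(st p = r \<and> st q = s) = False" "(st p = st s \<and> st q = st r) = False"
    using assms(3,4) by auto
  show ?thesis
    by (simp only: XM_def alpha_diff ot_eu alpha_sg e if_False sg_zero diff_zero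
      alpha_eu[OF assms(1,2)] alpha_eu[OF assms(1) cj_gr[OF assms(2)]]
      alpha_eu[OF cj_gr[OF assms(1)] assms(2)] alpha_eu[OF cj_gr[OF assms(1)] cj_gr[OF assms(2)]])
qed

text \<open>Origin of the factor 2. The two original units contribute <a,b>, their images under
  \<open>ot\<close> contribute <bar a, bar b> with signs that cancel, and the mixed terms vanish
  because \<open>q\<close> is not \<open>st p\<close>.\<close>

lemma alpha_XM:
  assumes "a \<in> gr d" "b \<in> gr e" "dg p = 0" "q \<noteq> st p"
  shows "alpha (XM p q a) (XM q p b) = ang a b + ang a b"
proof -
  have x: "xs (st q) (st p) + xs (st p) (st q) = dg p + dg q"
    by (simp add: xs_def nu_st) (cases "dg p"; cases "dg q"; cases "nu p"; cases "nu q"; simp)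
  have "alpha (ot (eu p q a)) (ot (eu q p b)) =
      sg (xs (st q) (st p) + xs (st p) (st q)) (sg (dg q * (d + e + 1)) (ang (cj (dg p + dg q) a) (cj (dg q + dg p) b)))"
    by (simp add: ot_eu alpha_sg alpha_eu[OF cj_gr[OF assms(1)] cj_gr[OF assms(2)]] ac_simps)
  also have "\<dots> = sg (dg q + dg q * (d + e + 1) + dg q * d + dg q * e) (ang a b)"
    unfolding x by (simp add: assms(3) cj_homog[OF assms(1)] cj_homog[OF assms(2)] ang_sg ang_bar ac_simps)
  also have "\<dots> = ang a b" by (cases "dg q"; cases d; cases e) simp_all
  finally have oo: "alpha (ot (eu p q a)) (ot (eu q p b)) = ang a b" .
  have e: "(q = st p \<and> p = st q) = False" "(st p = q \<and> st q = p) = False"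
    using assms(4) by auto
  have "alpha (eu p q a) (ot (eu q p b)) = 0" "alpha (ot (eu p q a)) (eu q p b) = 0"
    by (simp_all only: ot_eu alpha_sg e if_False sg_zero
      alpha_eu[OF assms(1) cj_gr[OF assms(2)]] alpha_eu[OF cj_gr[OF assms(1)] assms(2)])
  moreover have "alpha (eu p q a) (eu q p b) = ang a b"
    by (simp add: alpha_eu[OF assms(1,2)] assms(3))
  ultimately show ?thesis
    by (simp add: XM_def alpha_diff oo)
qed

end

section \<open>The generators as elements X_pq, and the relations of \<open>sto\<close> in the
  cocycle extension\<close>

primrec row_index :: "('m, 'n) kind \<Rightarrow> 'm + 'n + 'n" where
  "row_index (T i j) = Inl i" | "row_index (U k l) = Inr (Inl k)" | "row_index (V k l) = Inr (Inl k)"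
| "row_index (W k l) = Inr (Inr k)" | "row_index (F i k) = Inl i" | "row_index (G k i) = Inr (Inl k)"

primrec col_index :: "('m, 'n) kind \<Rightarrow> 'm + 'n + 'n" where
  "col_index (T i j) = Inl j" | "col_index (U k l) = Inr (Inl l)" | "col_index (V k l) = Inr (Inr l)"
| "col_index (W k l) = Inr (Inl l)" | "col_index (F i k) = Inr (Inl k)" | "col_index (G k i) = Inl i"

lemma kind_degree_eq: "kind_degree q = dg (row_index q) + dg (col_index q)"
  by (cases q) simp_all

context superalgebra_with_superinvolution
begin

lemma cj_mult: "a \<in> gr d \<Longrightarrow> b \<in> gr e \<Longrightarrow> cj x (a * b) = sg (x * (d + e) + d * e) (bar b * bar a)"
  by (simp add: cj_homog[OF gr_mult] bar_times)

lemma cj_mult_bar: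
  "a \<in> gr d \<Longrightarrow> b \<in> gr e \<Longrightarrow> cj x (bar a * b) = sg (x * (d + e) + d * e) (bar b * a)"
  "a \<in> gr d \<Longrightarrow> b \<in> gr e \<Longrightarrow> cj x (a * bar b) = sg (x * (d + e) + d * e) (b * bar a)"
  using cj_mult[of "bar a" d b e x] cj_mult[of a d "bar b" e x] by (simp_all add: bar_gr)

lemma bar_mult_bar:
  "a \<in> gr d \<Longrightarrow> b \<in> gr e \<Longrightarrow> bar (bar a * b) = sg (d * e) (bar b * a)"
  "a \<in> gr d \<Longrightarrow> b \<in> gr e \<Longrightarrow> bar (a * bar b) = sg (d * e) (b * bar a)"
  using cj_mult_bar[of a d b e 0] by simp_all

end

context skew_dihedral_form
begin

lemma XM_unfold: "XM p q a = eu p q a - sg (xs (st q) (st p)) (eu (st q) (st p) (cj (dg p + dg q) a))"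
  by (simp add: XM_def ot_eu)

lemma osp_element_eq: "osp_element gr bar x = XM (row_index (fst x)) (col_index (fst x)) (snd x)"
  by (cases "fst x") (simp_all add: osp_element_def XM_unfold xs_def cj_def rho_bar)

text \<open>Each generator is lifted with central part 0. No correction is called for: the relations
  bracket no pair of opposite elements.\<close>

definition gmq :: "('m, 'n, 'r) sto_generator \<Rightarrow> ('m, 'n, 'r) smatrix \<times> 'q" where
  "gmq x = (osp_element gr bar x, 0)"

text \<open>Instances of \<open>XM_st\<close>: the first three lead from the index pairs that belong
  to no kind to pairs that do, the last three exchange two descriptions within one kind.\<close>

lemma XM_F: "XM (Inr (Inr k)) (Inl i) a = XM (Inl i) (Inr (Inl k)) (cj 1 a)"
  and XM_G: "XM (Inl i) (Inr (Inr k)) a = - XM (Inr (Inl k)) (Inl i) (cj 1 a)"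
  and XM_U: "XM (Inr (Inr k)) (Inr (Inr l)) a = - XM (Inr (Inl l)) (Inr (Inl k)) (bar a)"
  and XM_T: "XM (Inl i) (Inl j) a = - XM (Inl j) (Inl i) (bar a)"
  and XM_V: "XM (Inr (Inl k)) (Inr (Inr l)) a = XM (Inr (Inl l)) (Inr (Inr k)) (bar a)"
  and XM_W: "XM (Inr (Inr k)) (Inr (Inl l)) a = XM (Inr (Inr l)) (Inr (Inl k)) (bar a)"
  by (subst XM_st, simp add: xs_def)+

text \<open>In the matrix part each relation is an instance of \<open>mbr_XM\<close>; in the central
  part both sides vanish, by \<open>alpha_XM_0\<close> for the brackets.\<close>

lemma gmq_relations:
  assumes "(s, t) \<in> sto_relations scal gr bar"
  shows "lev mqs mqbr gmq s = lev mqs mqbr gmq t"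
  using assms
  apply cases
  apply (simp_all add: gmq_def osp_element_eq mqbr_def mqs_def prod_eq_iff mbr_XM alpha_XM_0 XM_F XM_G XM_U
    cj_homog cj_mult cj_mult_bar bar_mult_bar gr_mult bar_gr gr_sg bar_times XM_sg xs_def sg_mult_left sg_mult_right bar_sg delta_def XM_add XM_ms)
  apply (rule XM_T)
  apply (rule XM_V)
  apply (rule XM_W)
  apply (auto simp: minus_eq_sg simp del: sg_1)
  apply (simp add: algebra_simps)+
  apply (subst XM_W, simp add: bar_mult_bar XM_sg algebra_simps)
  done

lemma gmq_homogeneous: "x \<in> sto_generators gr d \<Longrightarrow> gmq x \<in> mg d \<times> UNIV"
  by (auto simp: sto_generators_def gmq_def osp_element_eq kind_degree_eq ac_simps intro!: XM_mg[THEN back_subst[of "\<lambda>d. _ \<in> mg d"]])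

end

section \<open>The Lie superalgebra osp\<close>

lemma cring_base_ring: "cring base_ring"
  by (unfold_locales) (auto simp: Units_def algebra_simps intro: exI[of _ "- _"])

context lie_type
begin

lemma lie_superalgebra_subspace:
  assumes C: "subspace C" and br: "\<And>x y. x \<in> C \<Longrightarrow> y \<in> C \<Longrightarrow> br x y \<in> C"
    and sum: "\<And>x. x \<in> C \<Longrightarrow> \<exists>!(x0, x1). x0 \<in> C \<inter> H 0 \<and> x1 \<in> C \<inter> H 1 \<and> x = x0 + x1"
  shows "lie_superalgebra \<lparr>carrier = C, mult = undefined, one = undefined, zero = 0, add = (+),
     smult = sm, bracket = br, grade = (\<lambda>d. C \<inter> H d)\<rparr>" (is "lie_superalgebra ?L")
proof -
  note C_add = subspace_add[OF C] and C_0 = subspace_0[OF C] and C_sm = subspace_scale[OF C]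
    and C_neg = subspace_neg[OF C]
  have ag: "abelian_group ?L"
  proof (rule abelian_groupI)
    fix x assume "x \<in> carrier ?L"
    then show "\<exists>y\<in>carrier ?L. y \<oplus>\<^bsub>?L\<^esub> x = \<zero>\<^bsub>?L\<^esub>"
      by (intro bexI[of _ "- x"]) (simp_all add: C_neg)
  qed (auto simp: C_add C_0 algebra_simps)
  have mod: "Module.module base_ring ?L"
    by (rule moduleI[OF cring_base_ring ag])
      (simp_all add: C_sm scale_left_distrib scale_right_distrib)
  interpret mod: Module.module base_ring ?L by (rule mod)
  have inv: "\<ominus>\<^bsub>?L\<^esub> x = - x" if "x \<in> C" for x
    by (rule mod.minus_equality) (use that in \<open>simp_all add: C_neg\<close>)
  have sub: "submodule (grade ?L d) base_ring ?L" for d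
    by (rule mod.submoduleI)
      (auto simp: inv C_add C_0 C_sm C_neg H_subspace subspace_0 subspace_add subspace_scale subspace_neg)
  show ?thesis
  proof (intro lie_superalgebra.intro mod lie_superalgebra_axioms.intro sub)
    fix x assume "x \<in> carrier ?L"
    then show "\<exists>!(x0, x1). x0 \<in> grade ?L 0 \<and> x1 \<in> grade ?L 1 \<and> x = x0 \<oplus>\<^bsub>?L\<^esub> x1"
      using sum[of x] by simp
  qed (auto simp: br br_add_left br_add_right br_sm_left br_sm_right H_br br_jacobi intro: br_antisym)
qed

end

text \<open>Identifying p with \<open>st p\<close> leaves m + n classes, and m + n is at least 3
  because m and n are positive and not both 1. So two classes never exhaust the indices.\<close>

lemma third_index:
  fixes p q :: "'m::finite + 'n::finite + 'n"
  assumes "(CARD('m), CARD('n)) \<noteq> (1, 1)"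
  obtains r where "r \<noteq> p" "r \<noteq> st p" "r \<noteq> q" "r \<noteq> st q"
proof -
  define cl :: "'m + 'n + 'n \<Rightarrow> 'm + 'n" where
    "cl p = (case p of Inl i \<Rightarrow> Inl i | Inr (Inl k) \<Rightarrow> Inr k | Inr (Inr k) \<Rightarrow> Inr k)" for p
  define rep :: "'m + 'n \<Rightarrow> 'm + 'n + 'n" where
    "rep c = (case c of Inl i \<Rightarrow> Inl i | Inr k \<Rightarrow> Inr (Inl k))" for c
  have cl_rep: "cl (rep c) = c" for c by (cases c) (simp_all add: cl_def rep_def)
  have cl_st: "cl (st p) = cl p" for p by (cases p rule: index_cases) (simp_all add: cl_def)
  have pos: "0 < CARD('m)" "0 < CARD('n)" by simp_all
  have "CARD('m + 'n) = CARD('m) + CARD('n)" by (simp add: card_UNIV_sum)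
  moreover have "\<not> a + b \<le> 2" if "0 < a" "0 < b" "(a, b) \<noteq> (1, 1)" for a b :: nat
    using that by auto
  ultimately have "\<not> CARD('m + 'n) \<le> 2" using assms pos by metis
  moreover have "card {cl p, cl q} \<le> 2" by (simp add: card_insert_if)
  ultimately have "UNIV \<noteq> {cl p, cl q}" by metis
  then obtain c where "c \<noteq> cl p" "c \<noteq> cl q" by blast
  then show ?thesis using that[of "rep c"] cl_rep cl_st by metis
qed

context osp_setup
begin

lemma osp_tilde_iff: "A \<in> osp_tilde gr bar \<longleftrightarrow> ot A = - A"
  by (simp add: osp_tilde_def)

lemma osp_tilde_subspace: "M.subspace (osp_tilde gr bar)"
  by (rule M.subspaceI) (use ot_add[of 0 0] in \<open>auto simp: osp_tilde_iff ot_add ot_ms\<close>)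

lemma osp_tilde_mbr: "A \<in> osp_tilde gr bar \<Longrightarrow> B \<in> osp_tilde gr bar \<Longrightarrow> mbr A B \<in> osp_tilde gr bar"
  by (simp add: osp_tilde_iff ot_mbr mbr_minus)

lemma osp_tilde_component: "A \<in> osp_tilde gr bar \<Longrightarrow> component mg d A \<in> osp_tilde gr bar"
  by (simp add: osp_tilde_iff M.component_minus flip: component_ot)

lemma osp_carrier_eq:
  "osp_carrier scal gr bar = M.span {mbr A B | A B. A \<in> osp_tilde gr bar \<and> B \<in> osp_tilde gr bar}"
  by (simp add: osp_carrier_def)

lemma osp_carrier_subspace: "M.subspace (osp_carrier scal gr bar)"
  by (simp add: osp_carrier_eq)

lemma osp_carrier_subset: "osp_carrier scal gr bar \<subseteq> (osp_tilde gr bar :: ('m, 'n, 'r) smatrix set)"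
  unfolding osp_carrier_eq
  by (rule M.span_minimal) (auto simp: osp_tilde_mbr osp_tilde_subspace)

lemma mbr_in_osp_carrier:
  "A \<in> osp_tilde gr bar \<Longrightarrow> B \<in> osp_tilde gr bar \<Longrightarrow> mbr A B \<in> osp_carrier scal gr bar"
  unfolding osp_carrier_eq by (rule M.span_base) blast

text \<open>The defining brackets have arbitrary arguments from osp~. Splitting both arguments into
  components, which stay in osp~, exhibits each component of the bracket as a sum of such
  brackets.\<close>

lemma osp_carrier_component:
  assumes "x \<in> osp_carrier scal gr bar"
  shows "component mg d x \<in> osp_carrier scal gr bar"
  using assms unfolding osp_carrier_eq
proof (induction rule: M.span_induct_alt)
  case base
  then show ?case by (simp add: M.span_zero)
next
  case (step c x y)
  then obtain A B where x: "x = mbr A B" and AB: "A \<in> osp_tilde gr bar" "B \<in> osp_tilde gr bar"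
    by blast
  let ?c = "component mg"
  have "x = mbr (?c 0 A + ?c 1 A) (?c 0 B + ?c 1 B)"
    by (simp add: x M.component_decomp)
  also have "\<dots> = (mbr (?c 0 A) (?c 0 B) + mbr (?c 1 A) (?c 1 B)) + (mbr (?c 0 A) (?c 1 B) + mbr (?c 1 A) (?c 0 B))"
    by (simp add: mbr_add)
  finally have "?c d x = ?c d (mbr (?c 0 A) (?c 0 B)) + ?c d (mbr (?c 1 A) (?c 1 B)) +
      (?c d (mbr (?c 0 A) (?c 1 B)) + ?c d (mbr (?c 1 A) (?c 0 B)))"
    by (simp add: M.component_add)
  moreover have "?c d (mbr (?c e A) (?c f B)) \<in> osp_carrier scal gr bar" for e f
  proof -
    have "mbr (?c e A) (?c f B) \<in> mg (e + f)" by (simp add: mbr_mg)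
    then show ?thesis
      using M.component_homog[of "mbr (?c e A) (?c f B)" "e + f" d]
      by (simp add: mbr_in_osp_carrier osp_tilde_component AB M.subspace_0[OF osp_carrier_subspace])
  qed
  ultimately have "?c d x \<in> osp_carrier scal gr bar"
    by (simp add: M.subspace_add[OF osp_carrier_subspace])
  then show ?case
    using step(2) unfolding osp_carrier_eq
    by (simp add: M.component_add M.component_scale M.span_add M.span_scale)
qed

lemma osp_lie_superalgebra:
  "lie_superalgebra (osp scal gr bar :: ('k, ('m, 'n, 'r) smatrix) lie_super)"
  unfolding osp_def
proof (rule Mat.lie_superalgebra_subspace)
  let ?C = "osp_carrier scal gr bar :: ('m, 'n, 'r) smatrix set"
  show "M.subspace ?C" by (rule osp_carrier_subspace)
  show "mbr x y \<in> ?C" if "x \<in> ?C" "y \<in> ?C" for x y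
    using that osp_carrier_subset by (auto intro!: mbr_in_osp_carrier)
  fix x assume x: "x \<in> ?C"
  show "\<exists>!(x0, x1). x0 \<in> ?C \<inter> mg 0 \<and> x1 \<in> ?C \<inter> mg 1 \<and> x = x0 + x1"
  proof (rule ex1I[of _ "(component mg 0 x, component mg 1 x)"])
    show "case (component mg 0 x, component mg 1 x) of (x0, x1) \<Rightarrow>
        x0 \<in> ?C \<inter> mg 0 \<and> x1 \<in> ?C \<inter> mg 1 \<and> x = x0 + x1"
      using x by (simp add: osp_carrier_component M.component_decomp)
    fix y assume "case y of (x0, x1) \<Rightarrow> x0 \<in> ?C \<inter> mg 0 \<and> x1 \<in> ?C \<inter> mg 1 \<and> x = x0 + x1"
    then have "fst y \<in> mg 0" "snd y \<in> mg 1" "x = fst y + snd y" by (auto split: prod.splits)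
    then show "y = (component mg 0 x, component mg 1 x)"
      by (simp add: prod_eq_iff M.component_add M.component_homog[of "fst y" 0] M.component_homog[of "snd y" 1])
  qed
qed

lemma XM_in_osp_tilde: "XM p q a \<in> osp_tilde gr bar"
  by (simp add: osp_tilde_iff ot_XM)

text \<open>X_pq(a) = [X_pr(a), X_rq(1)] for a third index r.\<close>

lemma XM_in_osp_carrier:
  assumes mn: "(CARD('m), CARD('n)) \<noteq> (1, 1)" and "q \<noteq> p" "q \<noteq> st p"
  shows "XM p q a \<in> osp_carrier scal gr bar"
proof (induction a rule: homogeneous_induct)
  case (1 d a)
  obtain r where r: "r \<noteq> p" "r \<noteq> st p" "r \<noteq> q" "r \<noteq> st q" by (rule third_index[OF mn])
  have "mbr (XM p r a) (XM r q 1) = XM p q a"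
    using mbr_XM[OF 1 one_in_gr, of p r r q] assms(2) r by simp
  then show ?case by (metis mbr_in_osp_carrier XM_in_osp_tilde)
qed (simp add: XM_add M.subspace_add[OF osp_carrier_subspace])

end

section \<open>Generation of osp by the elements X_pq with q different from p and
  \<open>st p\<close>\<close>

locale osp_half = osp_setup scal gr bar mn
  for scal :: "'k::comm_ring_1 \<Rightarrow> 'r::ring_1 \<Rightarrow> 'r" and gr :: "bit \<Rightarrow> 'r set" and bar :: "'r \<Rightarrow> 'r"
    and mn :: "('m::finite \<times> 'n::finite) itself" +
  fixes half :: 'k
  assumes half: "half + half = 1"
begin

lemma half_double: "ms half (A + A) = A"
  by (metis M.scale_left_distrib M.scale_one M.scale_right_distrib half)

text \<open>This will give surjectivity of psi. Single diagonal elements X_pp(a) cannot be expected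
  in \<open>S\<close>, but those of supercommutators lie in it, and brackets with a diagonal factor
  produce no other diagonal elements.\<close>

lemma osp_carrier_least:
  assumes S: "M.subspace S" and br: "\<And>x y. x \<in> S \<Longrightarrow> y \<in> S \<Longrightarrow> mbr x y \<in> S"
    and X: "\<And>p q a d. q \<noteq> p \<Longrightarrow> q \<noteq> st p \<Longrightarrow> a \<in> gr d \<Longrightarrow> XM p q a \<in> S"
  shows "osp_carrier scal gr bar \<subseteq> S"
proof -
  note S_add = M.subspace_add[OF S] and S_diff = M.subspace_diff[OF S] and S_0 = M.subspace_0[OF S]
    and S_neg = M.subspace_neg[OF S] and S_sg = M.subspace_sg[OF S]
  \<comment> \<open>Any index of the orthogonal block serves a symplectic p, and conversely.\<close>
  have other: "\<exists>r. r \<noteq> p \<and> r \<noteq> st p" for p :: "'m + 'n + 'n"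
    by (cases p rule: index_cases) (auto intro: exI[of _ "Inl undefined"] exI[of _ "Inr (Inl undefined)"])
  have offdiag: "XM p q a \<in> S" if "q \<noteq> p" "a \<in> gr d" for p q a d
  proof (cases "q = st p")
    case True
    obtain r where r: "r \<noteq> p" "r \<noteq> st p" using other by blast
    have "mbr (XM p r 1) (XM r q a) = XM p q (1 * a)"
      using mbr_XM[OF one_in_gr that(2), of p r r q] that(1) r True by simp
    moreover have "XM p r 1 \<in> S" "XM r q a \<in> S"
      using r True that by (auto intro!: X one_in_gr)
    ultimately show ?thesis by (metis br mult_1)
  qed (use X that in auto)
  have comm: "XM p p (a * b) - sg (d * e) (XM p p (b * a)) \<in> S" if a: "a \<in> gr d" and b: "b \<in> gr e" for p a b d e
  proof -
    obtain r where r: "r \<noteq> p" "r \<noteq> st p" using other by blast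
    have 1: "mbr (XM p r x) (XM r p y) = XM p p (x * y) - sg ((f + dg p + dg r) * (g + dg p + dg r)) (XM r r (y * x))"
      if "x \<in> gr f" "y \<in> gr g" for x y f g
      using mbr_XM[OF that, of p r r p] r by (simp add: ac_simps)
    have in_S: "mbr (XM p r x) (XM r p y) \<in> S" if "x \<in> gr f" "y \<in> gr g" for x y f g
      using r that by (intro br X) auto
    \<comment> \<open>Both brackets have the same part at \<open>r\<close>, up to the sign in front,
      so only the part at \<open>p\<close> survives.\<close>
    have "mbr (XM p r a) (XM r p b) - sg (d * e) (mbr (XM p r 1) (XM r p (b * a))) =
       XM p p (a * b) - sg (d * e) (XM p p (b * a))"
      unfolding 1[OF a b] 1[OF one_in_gr gr_mult[OF b a]]
      by (cases d; cases e; cases "dg p"; cases "dg r") simp_all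
    then show ?thesis
      using in_S[OF a b] in_S[OF one_in_gr gr_mult[OF b a]] by (metis S_diff S_sg)
  qed
  have diag: "mbr (XM p p a) (XM r s b) \<in> S" if a: "a \<in> gr d" and b: "b \<in> gr e" for p r s a b d e
  proof (cases "r = s")
    case True
    have x: "(1 + dg r) * dg r = 0" by (cases "dg r") simp_all
    have "mbr (XM p p a) (XM r r b) = (if p = r then XM p p (a * b) - sg (d * e) (XM p p (b * a)) else 0) -
        (if p = st r then XM p p (a * bar b) - sg (d * e) (XM p p (bar b * a)) else 0)"
      using mbr_XM[OF a b, of p p r r] x by (auto simp: xs_def)
    moreover have "(if p = r then XM p p (a * b) - sg (d * e) (XM p p (b * a)) else 0) \<in> S"
      "(if p = st r then XM p p (a * bar b) - sg (d * e) (XM p p (bar b * a)) else 0) \<in> S"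
      by (simp_all add: S_0 comm[OF a b] comm[OF a bar_gr[OF b]])
    ultimately show ?thesis
      unfolding True[symmetric] by (simp only: S_diff)
  next
    case False
    then show ?thesis
      using a b unfolding mbr_XM[OF a b]
      by (auto intro!: S_diff S_sg S_0 S_neg offdiag gr_mult cj_gr bar_gr)
  qed
  have all_homog: "mbr (XM p q a) (XM r s b) \<in> S" if a: "a \<in> gr d" and b: "b \<in> gr e" for p q r s a b d e
  proof -
    consider "p = q" | "r = s" | "p \<noteq> q" "r \<noteq> s" by blast
    then show ?thesis
    proof cases
      case 1 then show ?thesis using diag[OF a b] by simp
    next
      case 2
      then show ?thesis
        using mbr_antisym[OF XM_mg[OF a] XM_mg[OF b], of p q r s] diag[OF b a, of r p q]
        by (simp add: S_neg S_sg)
    next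
      case 3
      then show ?thesis by (intro br offdiag) (use a b in auto)
    qed
  qed
  have all: "mbr (XM p q a) (XM r s b) \<in> S" for p q r s a b
  proof (induction a rule: homogeneous_induct)
    case (1 d a)
    note a = this
    show ?case
      by (induction b rule: homogeneous_induct) (auto simp: XM_add mbr_add intro: all_homog[OF a] S_add)
  qed (simp add: XM_add mbr_add S_add)
  have sum_mem: "\<And>I f. (\<And>i. i \<in> I \<Longrightarrow> f i \<in> S) \<Longrightarrow> sum f I \<in> S"
    by (rule M.subspace_sum[OF S])
  have mbr_sum: "mbr (sum f I) B = (\<Sum>i\<in>I. mbr (f i) B)" "mbr B (sum f I) = (\<Sum>i\<in>I. mbr B (f i))" for f B and I :: "'z set"
    using mbr_add(1)[of 0 0 B] mbr_add(2)[of B 0 0]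
    by (induction I rule: infinite_finite_induct) (simp_all add: mbr_add)
  \<comment> \<open>For A in osp~ the double sum equals A - \<open>ot\<close> A = 2 A.\<close>
  have tilde: "A = ms half (\<Sum>p\<in>UNIV. \<Sum>q\<in>UNIV. XM p q (A $ p $ q))" if "A \<in> osp_tilde gr bar" for A
    using that half_double[of A] by (simp add: sum_XM osp_tilde_iff)
  have "mbr A B \<in> S" if AB: "A \<in> osp_tilde gr bar" "B \<in> osp_tilde gr bar" for A B
    by (subst tilde[OF AB(1)], subst tilde[OF AB(2)], unfold mbr_ms mbr_sum)
      (intro M.subspace_scale[OF S] sum_mem all)
  then show ?thesis
    unfolding osp_carrier_eq by (intro M.span_minimal S) auto
qed

end

section \<open>Consequences of the relations of sto\<close>

text \<open>Any Lie superalgebra containing elements that satisfy the relations; it may be larger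
  than what they generate. The generators are extended linearly to inhomogeneous coefficients, which
  makes \<open>homogeneous_induct\<close> available.\<close>

locale sto_model = osp_half scal gr bar mn half + L: lie_type sm br H
  for scal :: "'k::comm_ring_1 \<Rightarrow> 'r::ring_1 \<Rightarrow> 'r" and gr :: "bit \<Rightarrow> 'r set" and bar :: "'r \<Rightarrow> 'r"
    and mn :: "('m::finite \<times> 'n::finite) itself" and half :: 'k
    and sm :: "'k \<Rightarrow> 'l::ab_group_add \<Rightarrow> 'l" and br :: "'l \<Rightarrow> 'l \<Rightarrow> 'l" and H :: "bit \<Rightarrow> 'l set" +
  fixes gen :: "('m, 'n) kind \<Rightarrow> 'r \<Rightarrow> 'l"
  assumes gen_add: "valid_kind q \<Longrightarrow> gen q (a + b) = gen q a + gen q b"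
    and gen_scale: "valid_kind q \<Longrightarrow> gen q (scal k a) = sm k (gen q a)"
    and gen_H: "valid_kind q \<Longrightarrow> a \<in> gr d \<Longrightarrow> gen q a \<in> H (kind_degree q + d)"
    and gen_rel: "(s, t) \<in> sto_relations scal gr bar \<Longrightarrow>
      lev sm br (\<lambda>x. gen (fst x) (snd x)) s = lev sm br (\<lambda>x. gen (fst x) (snd x)) t"
    and mn_neq: "(CARD('m), CARD('n)) \<noteq> (1, 1)"
begin

lemma sm_delta [simp]: "sm (delta i j) x = (if i = j then x else 0)"
  and sm_minus_delta [simp]: "sm (- delta i j) x = (if i = j then - x else 0)"
  by (simp_all add: delta_def)

lemma gen_sg: "valid_kind q \<Longrightarrow> gen q (sg d a) = sg d (gen q a)"
  by (rule additive_sg) (rule gen_add)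

lemma gen_minus: "valid_kind q \<Longrightarrow> gen q (- a) = - gen q a"
  using gen_sg[of q 1 a] by simp

lemma T_bar: "i \<noteq> j \<Longrightarrow> gen (T i j) a = - gen (T j i) (bar a)"
proof (induction a rule: homogeneous_induct)
  case (1 d a) then show ?case using gen_rel[OF sto_relations.t_bar, of a d i j] by simp
qed (simp add: gen_add bar_add)

lemma V_bar: "k \<noteq> l \<Longrightarrow> gen (V k l) a = gen (V l k) (bar a)"
proof (induction a rule: homogeneous_induct)
  case (1 d a) then show ?case using gen_rel[OF sto_relations.v_bar, of a d k l] by simp
qed (simp add: gen_add bar_add)

lemma W_bar: "k \<noteq> l \<Longrightarrow> gen (W k l) a = gen (W l k) (bar a)"
proof (induction a rule: homogeneous_induct)
  case (1 d a) then show ?case using gen_rel[OF sto_relations.w_bar, of a d k l] by simp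
qed (simp add: gen_add bar_add)

section \<open>The relations as equations in the model\<close>

context
  fixes a b d e
  assumes ab: "a \<in> gr d" "b \<in> gr e"
begin

lemma rel_t_t: "distinct [i, i', j] \<Longrightarrow> br (gen (T i i') a) (gen (T i' j) b) = gen (T i j) (a * b)"
  using gen_rel[OF sto_relations.t_t[OF ab], of i i' j] by simp

lemma rel_t_t_0: "distinct [i, j, i', j'] \<Longrightarrow> br (gen (T i j) a) (gen (T i' j') b) = 0"
  using gen_rel[OF sto_relations.t_t_0[OF ab], of i j i' j'] by simp

lemma rel_t_u: "i \<noteq> j \<Longrightarrow> k \<noteq> l \<Longrightarrow> br (gen (T i j) a) (gen (U k l) b) = 0"
  using gen_rel[OF sto_relations.t_u[OF ab], of i j k l] by simp

lemma rel_t_v: "i \<noteq> j \<Longrightarrow> k \<noteq> l \<Longrightarrow> br (gen (T i j) a) (gen (V k l) b) = 0"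
  using gen_rel[OF sto_relations.t_v[OF ab], of i j k l] by simp

lemma rel_t_w: "i \<noteq> j \<Longrightarrow> k \<noteq> l \<Longrightarrow> br (gen (T i j) a) (gen (W k l) b) = 0"
  using gen_rel[OF sto_relations.t_w[OF ab], of i j k l] by simp

lemma rel_u_u: "distinct [k, k', l] \<Longrightarrow> br (gen (U k k') a) (gen (U k' l) b) = gen (U k l) (a * b)"
  using gen_rel[OF sto_relations.u_u[OF ab], of k k' l] by simp

lemma rel_u_u_0: "k \<noteq> l \<Longrightarrow> l \<noteq> k' \<Longrightarrow> k' \<noteq> l' \<Longrightarrow> l' \<noteq> k \<Longrightarrow> br (gen (U k l) a) (gen (U k' l') b) = 0"
  using gen_rel[OF sto_relations.u_u_0[OF ab], of k l k' l'] by simp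

lemma rel_u_v: "distinct [k, k', l] \<Longrightarrow> br (gen (U k k') a) (gen (V k' l) b) = gen (V k l) (a * b)"
  using gen_rel[OF sto_relations.u_v[OF ab], of k k' l] by simp

lemma rel_u_v_0: "k \<noteq> l \<Longrightarrow> l \<noteq> k' \<Longrightarrow> k' \<noteq> l' \<Longrightarrow> l' \<noteq> l \<Longrightarrow> br (gen (U k l) a) (gen (V k' l') b) = 0"
  using gen_rel[OF sto_relations.u_v_0[OF ab], of k l k' l'] by simp

lemma rel_w_u: "distinct [k, k', l] \<Longrightarrow> br (gen (W l k') a) (gen (U k' k) b) = gen (W l k) (a * b)"
  using gen_rel[OF sto_relations.w_u[OF ab], of k k' l] by simp

lemma rel_w_u_0: "k \<noteq> l \<Longrightarrow> l \<noteq> k' \<Longrightarrow> k' \<noteq> l' \<Longrightarrow> l' \<noteq> l \<Longrightarrow> br (gen (W l' k') a) (gen (U l k) b) = 0"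
  using gen_rel[OF sto_relations.w_u_0[OF ab], of k l k' l'] by simp

lemma rel_v_v: "k \<noteq> l \<Longrightarrow> k' \<noteq> l' \<Longrightarrow> br (gen (V k l) a) (gen (V k' l') b) = 0"
  using gen_rel[OF sto_relations.v_v[OF ab], of k l k' l'] by simp

lemma rel_w_w: "k \<noteq> l \<Longrightarrow> k' \<noteq> l' \<Longrightarrow> br (gen (W k l) a) (gen (W k' l') b) = 0"
  using gen_rel[OF sto_relations.w_w[OF ab], of k l k' l'] by simp

lemma rel_v_w: "distinct [k, k', l] \<Longrightarrow> br (gen (V k k') a) (gen (W k' l) b) = gen (U k l) (a * b)"
  using gen_rel[OF sto_relations.v_w[OF ab], of k k' l] by simp

lemma rel_v_w_0: "distinct [k, l, k', l'] \<Longrightarrow> br (gen (V k l) a) (gen (W k' l') b) = 0"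
  using gen_rel[OF sto_relations.v_w_0[OF ab], of k l k' l'] by simp

lemma rel_t_f: "i \<noteq> j \<Longrightarrow> br (gen (T i j) a) (gen (F i' k) b) =
    (if i' = j then gen (F i k) (a * b) else 0) + (if i' = i then - gen (F j k) (bar a * b) else 0)"
  using gen_rel[OF sto_relations.t_f[OF ab], of i j i' k] by simp

lemma rel_g_t: "i \<noteq> j \<Longrightarrow> br (gen (G k i') a) (gen (T i j) b) =
    (if i' = i then gen (G k j) (a * b) else 0) + (if i' = j then - gen (G k i) (a * bar b) else 0)"
  using gen_rel[OF sto_relations.g_t[OF ab], of i j k i'] by simp

lemma rel_f_u: "k \<noteq> l \<Longrightarrow> br (gen (F i k') a) (gen (U k l) b) = (if k = k' then gen (F i l) (a * b) else 0)"
  using gen_rel[OF sto_relations.f_u[OF ab], of k l i k'] by simp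

lemma rel_u_g: "k \<noteq> l \<Longrightarrow> br (gen (U l k) a) (gen (G k' i) b) = (if k' = k then gen (G l i) (a * b) else 0)"
  using gen_rel[OF sto_relations.u_g[OF ab], of k l k' i] by simp

lemma rel_v_f: "k \<noteq> l \<Longrightarrow> br (gen (V k l) a) (gen (F i l') b) = sg e ((if l' = l then gen (G k i) (a * bar b) else 0)
    + (if l' = k then gen (G l i) (bar a * bar b) else 0))"
  using gen_rel[OF sto_relations.v_f[OF ab], of k l i l'] by simp

lemma rel_g_v: "k \<noteq> l \<Longrightarrow> br (gen (G k' i) a) (gen (V k l) b) = 0"
  using gen_rel[OF sto_relations.g_v[OF ab], of k l k' i] by simp

lemma rel_w_f: "k \<noteq> l \<Longrightarrow> br (gen (W k l) a) (gen (F i k') b) = 0"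
  using gen_rel[OF sto_relations.w_f[OF ab], of k l i k'] by simp

lemma rel_g_w: "k \<noteq> l \<Longrightarrow> br (gen (G k' i) a) (gen (W k l) b) = - sg d ((if k' = k then gen (F i l) (bar a * b) else 0)
    + (if k' = l then gen (F i k) (bar a * bar b) else 0))"
  using gen_rel[OF sto_relations.g_w[OF ab], of k l k' i] by simp

lemma rel_f_f: "k \<noteq> l \<Longrightarrow> br (gen (F i k) a) (gen (F i l) b) = sg d (gen (W k l) (bar a * b))"
  using gen_rel[OF sto_relations.f_f[OF ab], of k l i] by simp

lemma rel_f_f_0: "i \<noteq> j \<Longrightarrow> br (gen (F i k) a) (gen (F j l) b) = 0"
  using gen_rel[OF sto_relations.f_f_0[OF ab], of i j k l] by simp

lemma rel_g_g: "k \<noteq> l \<Longrightarrow> br (gen (G k i) a) (gen (G l i) b) = - sg e (gen (V k l) (a * bar b))"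
  using gen_rel[OF sto_relations.g_g[OF ab], of k l i] by simp

lemma rel_g_g_0: "i \<noteq> j \<Longrightarrow> br (gen (G k i) a) (gen (G l j) b) = 0"
  using gen_rel[OF sto_relations.g_g_0[OF ab], of i j k l] by simp

lemma rel_f_g: "i \<noteq> j \<Longrightarrow> br (gen (F i k) a) (gen (G l j) b) = (if k = l then gen (T i j) (a * b) else 0)"
  using gen_rel[OF sto_relations.f_g[OF ab], of i j k l] by simp

lemma rel_g_f: "k \<noteq> l \<Longrightarrow> br (gen (G k i) a) (gen (F i l) b) = gen (U k l) (a * b)"
  using gen_rel[OF sto_relations.g_f[OF ab], of k l i] by simp

lemmas relation_table =
  rel_t_t rel_t_t_0 rel_t_u rel_t_v rel_t_w rel_u_u rel_u_u_0 rel_u_v rel_u_v_0 rel_w_u rel_w_u_0 rel_v_v rel_w_w rel_v_w rel_v_w_0 rel_t_f rel_g_t rel_f_u rel_u_g rel_v_f rel_g_v rel_w_f rel_g_w rel_f_f rel_f_f_0 rel_g_g rel_g_g_0 rel_f_g rel_g_f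

end

text \<open>The elements $X_{pq}(a)$ of the header; the values at degenerate pairs of indices are junk.\<close>

definition XL :: "'m + 'n + 'n \<Rightarrow> 'm + 'n + 'n \<Rightarrow> 'r \<Rightarrow> 'l" where
  "XL p q a = (case (p, q) of
     (Inl i, Inl j) \<Rightarrow> gen (T i j) a
   | (Inl i, Inr (Inl k)) \<Rightarrow> gen (F i k) a
   | (Inl i, Inr (Inr k)) \<Rightarrow> - gen (G k i) (cj 1 a)
   | (Inr (Inl k), Inl i) \<Rightarrow> gen (G k i) a
   | (Inr (Inl k), Inr (Inl l)) \<Rightarrow> gen (U k l) a
   | (Inr (Inl k), Inr (Inr l)) \<Rightarrow> gen (V k l) a
   | (Inr (Inr k), Inl i) \<Rightarrow> gen (F i k) (cj 1 a)
   | (Inr (Inr k), Inr (Inl l)) \<Rightarrow> gen (W k l) a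
   | (Inr (Inr k), Inr (Inr l)) \<Rightarrow> - gen (U l k) (bar a))"

text \<open>Exactly the index pairs at which X_pq is, up to sign, a generator. By
  \<open>nondeg_sym\<close> and \<open>nondeg_st\<close> the relation lives on indices modulo
  \<open>st\<close>.\<close>

definition nondeg :: "'m + 'n + 'n \<Rightarrow> 'm + 'n + 'n \<Rightarrow> bool" where
  "nondeg p q \<longleftrightarrow> q \<noteq> p \<and> q \<noteq> st p"

lemma XL_add: "nondeg p q \<Longrightarrow> XL p q (a + b) = XL p q a + XL p q b"
  by (cases p rule: index_cases; cases q rule: index_cases)
    (simp_all add: XL_def nondeg_def gen_add cj_add bar_add)

lemma XL_scale: "nondeg p q \<Longrightarrow> XL p q (scal c a) = sm c (XL p q a)"
  by (cases p rule: index_cases; cases q rule: index_cases)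
    (simp_all add: XL_def nondeg_def gen_scale cj_scale bar_scale)

lemma gen_in_H: "valid_kind q \<Longrightarrow> a \<in> gr d \<Longrightarrow> kind_degree q + d = e \<Longrightarrow> gen q a \<in> H e"
  using gen_H by blast

lemma XL_H: "nondeg p q \<Longrightarrow> a \<in> gr d \<Longrightarrow> XL p q a \<in> H (d + dg p + dg q)"
  by (cases p rule: index_cases; cases q rule: index_cases)
    (auto simp: XL_def nondeg_def add.assoc intro!: gen_in_H cj_gr bar_gr L.subspace_neg[OF L.H_subspace])

text \<open>The same signs as in \<open>XM_st\<close>. At pairs of type T, V, W this is a relation
  of \<open>sto\<close>, elsewhere it holds by the choice made in \<open>XL\<close>.\<close>

lemma XL_st: "nondeg p q \<Longrightarrow> XL p q a = - sg (xs (st q) (st p)) (XL (st q) (st p) (cj (dg p + dg q) a))"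
  by (cases p rule: index_cases; cases q rule: index_cases)
    (auto simp: XL_def nondeg_def xs_def T_bar[of _ _ a] V_bar[of _ _ a] W_bar[of _ _ a])

lemma XL_flip:
  assumes "nondeg p q" "nondeg r s" "a \<in> gr d" "b \<in> gr e"
  shows "br (XL p q a) (XL r s b) = - sg ((d + dg p + dg q) * (e + dg r + dg s)) (br (XL r s b) (XL p q a))"
  using assms by (intro L.br_antisym XL_H)

end

section \<open>The relations in a form independent of the blocks\<close>

context sto_model
begin

context
  fixes a b d e
  assumes a: "a \<in> gr d" and b: "b \<in> gr e"
begin

lemmas relation_simps =
  relation_table[OF a b] relation_table[OF a bar_gr[OF b]]
  relation_table[OF bar_gr[OF a] b] relation_table[OF bar_gr[OF a] bar_gr[OF b]]
  relation_table[OF b a] relation_table[OF b bar_gr[OF a]]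
  relation_table[OF bar_gr[OF b] a] relation_table[OF bar_gr[OF b] bar_gr[OF a]]
  L.br_sg_left L.br_sg_right L.br_minus_left L.br_minus_right cj_homog[OF a] cj_homog[OF b]
  gen_sg gen_minus bar_sg bar_minus cj_mult[OF a b] bar_times[OF a b] cj_mult_bar[OF a b]
  cj_mult_bar[OF b a] bar_mult_bar[OF a b] bar_mult_bar[OF b a] sg_mult_left sg_mult_right

text \<open>Each relation fixes the bracket of its two generators in one order only, hence the
  alternative; antisymmetry removes it in \<open>XL_product\<close>.\<close>

lemma XL_product_aux:
  assumes "nondeg p q" "nondeg q r" "nondeg p r"
  shows "br (XL p q a) (XL q r b) = XL p r (a * b) \<or> br (XL q r b) (XL p q a) = - sg ((d + dg p + dg q) * (e + dg q + dg r)) (XL p r (a * b))"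
  using assms
  apply (cases p rule: index_cases; cases q rule: index_cases; cases r rule: index_cases)
  apply (simp_all add: nondeg_def XL_def relation_simps)
  apply (simp_all add: minus_eq_sg distrib_left distrib_right ac_simps del: sg_1)
  \<comment> \<open>In the remaining cases the relation returns the reflected description of the
    element, with the two indices of a T, V or W exchanged.\<close>
  subgoal for i k ia using T_bar[of i ia "a * b"] by (simp add: relation_simps minus_eq_sg distrib_left distrib_right ac_simps del: sg_1)
  subgoal for k ka kb using V_bar[of k ka a] V_bar[of k kb "a * b"] by (simp add: relation_simps minus_eq_sg distrib_left distrib_right ac_simps del: sg_1)
  subgoal for k ka kb using V_bar[of ka kb b] W_bar[of k ka a] by (simp add: relation_simps minus_eq_sg distrib_left distrib_right ac_simps del: sg_1)
  subgoal for k ka kb using W_bar[of ka kb b] W_bar[of k kb "a * b"] by (simp add: relation_simps minus_eq_sg distrib_left distrib_right ac_simps del: sg_1)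
  done

lemma XL_zero_aux:
  assumes "nondeg p q" "nondeg r s" "q \<noteq> r" "p \<noteq> s" "q \<noteq> st s" "p \<noteq> st r"
  shows "br (XL p q a) (XL r s b) = 0 \<or> br (XL r s b) (XL p q a) = 0"
  using assms
  apply (cases p rule: index_cases; cases q rule: index_cases; cases r rule: index_cases; cases s rule: index_cases)
  apply (simp_all add: nondeg_def XL_def relation_simps)
  done

end

text \<open>With \<open>XL_zero\<close> this sums up the brackets prescribed by the relations; the
  bracket computations below use them in this form.\<close>

lemma XL_product:
  assumes pq: "nondeg p q" "nondeg q r" "nondeg p r"
  shows "br (XL p q a) (XL q r b) = XL p r (a * b)"
proof (induction a rule: homogeneous_induct)
  case (1 d a)
  note a = this
  show ?case
  proof (induction b rule: homogeneous_induct)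
    case (1 e b)
    show ?case
      using XL_product_aux[OF a 1 pq] XL_flip[OF pq(1,2) a 1] by (auto simp: sg_minus)
  qed (simp add: XL_add pq L.br_add_right distrib_left)
qed (simp add: XL_add pq L.br_add_left distrib_right)

lemma XL_zero:
  assumes pq: "nondeg p q" "nondeg r s" and ne: "q \<noteq> r" "p \<noteq> s" "q \<noteq> st s" "p \<noteq> st r"
  shows "br (XL p q a) (XL r s b) = 0"
proof (induction a rule: homogeneous_induct)
  case (1 d a)
  note a = this
  show ?case
  proof (induction b rule: homogeneous_induct)
    case (1 e b)
    show ?case
      using XL_zero_aux[OF a 1 pq ne] XL_flip[OF pq a 1] by auto
  qed (simp add: XL_add pq L.br_add_right)
qed (simp add: XL_add pq L.br_add_left)

end

lemma sg_cancel [simp]: "sg d x = sg d y \<longleftrightarrow> x = y"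
  by (cases d) simp_all

section \<open>Brackets of opposite elements and the identities for \<open>lam\<close>\<close>

context sto_model
begin

lemma nondeg_sym: "nondeg p q \<longleftrightarrow> nondeg q p"
  by (auto simp: nondeg_def)

lemma nondeg_st [simp]: "nondeg (st p) q \<longleftrightarrow> nondeg p q" "nondeg p (st q) \<longleftrightarrow> nondeg p q"
  by (auto simp: nondeg_def st_eq_swap)

lemma third:
  obtains r where "nondeg p r" "nondeg q r" "nondeg r p" "nondeg r q"
proof -
  obtain r where "r \<noteq> p" "r \<noteq> st p" "r \<noteq> q" "r \<noteq> st q" by (rule third_index[OF mn_neq])
  then show ?thesis by (intro that) (auto simp: nondeg_def)
qed

lemma XL_sg: "nondeg p q \<Longrightarrow> XL p q (sg d a) = sg d (XL p q a)"
  by (rule additive_sg) (rule XL_add)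

lemma XL_0: "nondeg p q \<Longrightarrow> XL p q 0 = 0"
  using XL_add[of p q 0 0] by simp

text \<open>The elements H_pq(a,b) of the header.\<close>

definition hh :: "'m + 'n + 'n \<Rightarrow> 'm + 'n + 'n \<Rightarrow> 'r \<Rightarrow> 'r \<Rightarrow> 'l" where
  "hh p q a b = br (XL p q a) (XL q p b)"

lemma hh_add:
  assumes "nondeg p q"
  shows "hh p q (a + a') b = hh p q a b + hh p q a' b" "hh p q a (b + b') = hh p q a b + hh p q a b'"
  using assms nondeg_sym[of p q] by (simp_all add: hh_def XL_add L.br_add_left L.br_add_right)

lemma hh_scale:
  assumes "nondeg p q"
  shows "hh p q (scal c a) b = sm c (hh p q a b)" "hh p q a (scal c b) = sm c (hh p q a b)"
  using assms nondeg_sym[of p q] by (simp_all add: hh_def XL_scale L.br_sm_left L.br_sm_right)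

lemma hh_sg:
  assumes "nondeg p q"
  shows "hh p q (sg d a) b = sg d (hh p q a b)" "hh p q a (sg d b) = sg d (hh p q a b)"
  using assms nondeg_sym[of p q] by (simp_all add: hh_def XL_sg L.br_sg_left L.br_sg_right)

lemma hh_mult:
  assumes pqr: "nondeg p q" "nondeg q r" "nondeg p r"
    and a: "a \<in> gr d" and b: "b \<in> gr e" and c: "c \<in> gr f"
  shows "hh p q (a * c) b = hh p r a (c * b) + sg ((d + dg p + dg r) * (e + f + dg p + dg r)) (hh r q c (b * a))"
proof -
  note nd = pqr pqr[unfolded nondeg_sym[of p q] nondeg_sym[of q r] nondeg_sym[of p r]]
  have "hh p q (a * c) b = br (br (XL p r a) (XL r q c)) (XL q p b)"
    by (simp add: hh_def XL_product nd)
  also have "\<dots> = br (XL p r a) (br (XL r q c) (XL q p b)) -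
      sg ((d + dg p + dg r) * (f + dg r + dg q)) (br (XL r q c) (br (XL p r a) (XL q p b)))"
    by (rule L.br_leibniz_left[OF XL_H[OF _ a] XL_H[OF _ c] XL_H[OF _ b]]) (use nd in auto)
  also have "br (XL p r a) (XL q p b) = - sg ((d + dg p + dg r) * (e + dg q + dg p)) (XL q r (b * a))"
    using XL_flip[OF nd(3,4) a b] by (simp add: XL_product nd)
  also have "br (XL r q c) (XL q p b) = XL r p (c * b)"
    by (simp add: XL_product nd)
  finally have "hh p q (a * c) b = hh p r a (c * b) + sg ((d + dg p + dg r) * (f + dg r + dg q) +
      (d + dg p + dg r) * (e + dg q + dg p)) (hh r q c (b * a))"
    by (simp add: hh_def L.br_minus_right L.br_sg_right sg_minus)
  also have "(d + dg p + dg r) * (f + dg r + dg q) + (d + dg p + dg r) * (e + dg q + dg p) =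
      (d + dg p + dg r) * (e + f + dg p + dg r)"
    by (simp add: algebra_simps)
  finally show ?thesis .
qed

lemma hh_flip:
  assumes "nondeg p q" "a \<in> gr d" "b \<in> gr e"
  shows "hh p q a b = - sg ((d + dg p + dg q) * (e + dg p + dg q)) (hh q p b a)"
  using XL_flip[OF assms(1) assms(1)[unfolded nondeg_sym[of p q]] assms(2,3)] by (simp add: hh_def ac_simps)

lemma xs_xs: "xs p q + xs q p = dg p + dg q"
  unfolding xs_def by (cases "dg p"; cases "dg q"; cases "nu p"; cases "nu q") simp_all

lemma hh_st:
  assumes pq: "nondeg p q" and a: "a \<in> gr d" and b: "b \<in> gr e"
  shows "hh p q a b = sg ((dg p + dg q) * (d + e + 1)) (hh (st q) (st p) (bar a) (bar b))"
proof -
  have qp: "nondeg q p" using pq nondeg_sym by blast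
  have x: "xs (st q) (st p) + xs (st p) (st q) = dg p + dg q" by (simp add: xs_xs add.commute)
  have "hh p q a b = sg (xs (st q) (st p) + xs (st p) (st q) + (dg p + dg q) * d + (dg p + dg q) * e)
      (hh (st q) (st p) (bar a) (bar b))"
    using pq qp
    by (simp add: hh_def XL_st[OF pq, of a] XL_st[OF qp, of b] L.br_minus_left L.br_minus_right L.br_sg_left
        L.br_sg_right cj_homog[OF a] cj_homog[OF b] XL_sg sg_minus ac_simps)
  also have "xs (st q) (st p) + xs (st p) (st q) + (dg p + dg q) * d + (dg p + dg q) * e =
      (dg p + dg q) * (d + e + 1)"
    unfolding x by (simp add: algebra_simps)
  finally show ?thesis .
qed

text \<open>An orthogonal index, hence self-dual and of degree 0. Its partner \<open>q0\<close> is
  symplectic, so that the pair is nondegenerate for all sizes of the blocks.\<close>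

definition p0 :: "'m + 'n + 'n" where "p0 = Inl undefined"
definition q0 :: "'m + 'n + 'n" where "q0 = Inr (Inl undefined)"

lemma p0_simps [simp]: "dg p0 = 0" "st p0 = p0"
  by (simp_all add: p0_def)

lemma nondeg_p0_q0: "nondeg p0 q0"
  by (simp add: nondeg_def p0_def q0_def)

text \<open>Lifts of diagonal matrices: psi will send \<open>et q x\<close> to X_pp(x), at p =
  \<open>p0\<close>, minus a signed X_qq(x), see \<open>psi_et\<close>.\<close>

definition et :: "'m + 'n + 'n \<Rightarrow> 'r \<Rightarrow> 'l" where
  "et q x = hh p0 q 1 x"

text \<open>For homogeneous arguments \<open>a * b - ring_scomm gr a b\<close> is $(-1)^{|a||b|} b a$.\<close>

definition lam :: "'r \<Rightarrow> 'r \<Rightarrow> 'l" where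
  "lam a b = hh p0 q0 a b - et q0 (a * b - ring_scomm gr a b)"

lemma et_add: "nondeg p0 q \<Longrightarrow> et q (a + b) = et q a + et q b"
  by (simp add: et_def hh_add)

lemma et_sg: "nondeg p0 q \<Longrightarrow> et q (sg d a) = sg d (et q a)"
  by (simp add: et_def hh_sg)

lemma et_scale: "nondeg p0 q \<Longrightarrow> et q (scal c a) = sm c (et q a)"
  by (simp add: et_def hh_scale)

lemma et_minus: "nondeg p0 q \<Longrightarrow> et q (- a) = - et q a"
  using et_sg[of q 1 a] by simp

lemma et_diff: "nondeg p0 q \<Longrightarrow> et q (a - b) = et q a - et q b"
  using et_add[of q a "- b"] by (simp add: et_minus)

lemma lam_add: "lam (a + a') b = lam a b + lam a' b" "lam a (b + b') = lam a b + lam a b'"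
  using nondeg_p0_q0
  by (simp_all add: lam_def hh_add et_add et_diff scomm_add_left scomm_add_right distrib_left distrib_right)

lemma lam_scale: "lam (scal c a) b = sm c (lam a b)" "lam a (scal c b) = sm c (lam a b)"
  using nondeg_p0_q0
  by (simp_all add: lam_def hh_scale et_scale et_diff scomm_scale_left scomm_scale_right scale_mult_left
      scale_mult_right L.scale_right_diff_distrib)

text \<open>\<open>hh_mult\<close> at \<open>p0\<close> with first coefficient 1, solved for its
  last term: away from \<open>p0\<close>, every H is expressed by those based at
  \<open>p0\<close>.\<close>

lemma hh_p0:
  assumes qr: "nondeg p0 q" "nondeg p0 r" "nondeg q r" and c: "c \<in> gr f" and b: "b \<in> gr e"
  shows "hh r q c b = sg (dg r * (e + f + 1)) (hh p0 q c b - et r (c * b))"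
proof -
  have "hh p0 q c b = et r (c * b) + sg (dg r * (e + f + dg r)) (hh r q c b)"
    using hh_mult[OF qr(1,3,2) one_in_gr b c] by (simp add: et_def)
  also have "dg r * (e + f + dg r) = dg r * (e + f + 1)" by (simp add: algebra_simps)
  finally show ?thesis by simp
qed

text \<open>Passing from q to r by \<open>hh_mult\<close> changes H(c,b) and H(1,bc) by the same
  element H_rq(1,bc), up to the sign with exponent fe. It cancels in the difference.\<close>

lemma lam_indep_aux:
  assumes qr: "nondeg p0 q" "nondeg p0 r" "nondeg q r" and c: "c \<in> gr f" and b: "b \<in> gr e"
  shows "hh p0 q c b - sg (f * e) (et q (b * c)) = hh p0 r c b - sg (f * e) (et r (b * c))"
proof -
  have 1: "hh p0 q c b = hh p0 r c b + sg ((f + dg r) * (e + dg r)) (hh r q 1 (b * c))"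
    using hh_mult[OF qr(1,3,2) c b one_in_gr] by simp
  have 2: "et q (b * c) = et r (b * c) + sg (dg r * (e + f + dg r)) (hh r q 1 (b * c))"
    using hh_mult[OF qr(1,3,2) one_in_gr gr_mult[OF b c] one_in_gr] by (simp add: et_def)
  have x: "(f + dg r) * (e + dg r) = f * e + dg r * (e + f + dg r)" by (simp add: algebra_simps)
  show ?thesis unfolding 1 2 x sg_add by simp
qed

text \<open>The index \<open>q0\<close> in the definition of \<open>lam\<close> may be replaced by
  any index nondegenerate to \<open>p0\<close>; later arguments choose q to suit them.\<close>

lemma lam_homog:
  assumes q: "nondeg p0 q" and c: "c \<in> gr f" and b: "b \<in> gr e"
  shows "lam c b = hh p0 q c b - sg (f * e) (et q (b * c))"
proof -
  have "lam c b = hh p0 q0 c b - sg (f * e) (et q0 (b * c))"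
    by (simp add: lam_def scomm_homog[OF c b] et_sg nondeg_p0_q0)
  also have "\<dots> = hh p0 q c b - sg (f * e) (et q (b * c))"
  proof (cases "nondeg q0 q")
    case True
    then show ?thesis by (intro lam_indep_aux nondeg_p0_q0 q c b)
  next
    \<comment> \<open>Here q is \<open>q0\<close> or \<open>st q0\<close>, which
      \<open>lam_indep_aux\<close> does not compare directly; both are compared with a third
      index.\<close>
    case False
    obtain r where r: "nondeg p0 r" "nondeg q r" "nondeg r q" using third[of p0 q] by blast
    have "nondeg q0 r" using False r q by (auto simp: nondeg_def)
    then show ?thesis
      using lam_indep_aux[OF nondeg_p0_q0 r(1) _ c b] lam_indep_aux[OF r(1) q r(3) c b] by simp
  qed
  finally show ?thesis .
qed

lemma hh_p0_lam:
  assumes "nondeg p0 q" "c \<in> gr f" "b \<in> gr e"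
  shows "hh p0 q c b = lam c b + sg (f * e) (et q (b * c))"
  using lam_homog[OF assms] by simp

lemma hh_lam:
  assumes "nondeg p0 q" "nondeg p0 r" "nondeg q r" "c \<in> gr f" "b \<in> gr e"
  shows "hh r q c b = sg (dg r * (e + f + 1)) (lam c b + sg (f * e) (et q (b * c)) - et r (c * b))"
  using hh_p0[OF assms] hh_p0_lam[OF assms(1,4,5)] by simp

lemma lam_one: "lam 1 b = 0"
proof (induction b rule: homogeneous_induct)
  case (1 e b)
  then show ?case using lam_homog[OF nondeg_p0_q0 one_in_gr 1] by (simp add: et_def)
qed (simp add: lam_add)

lemma two_more:
  obtains q r where "nondeg p0 q" "nondeg p0 r" "nondeg q r" "nondeg r q"
  using third[of p0 q0] nondeg_p0_q0 by blast

text \<open>Substituting \<open>hh_p0_lam\<close> and \<open>hh_lam\<close> into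
  \<open>hh_mult\<close>, the \<open>et\<close> terms for q and for r cancel separately. This is the
  cyclic relation with two of its terms not yet put into skew-symmetric order.\<close>

lemma lam_assoc:
  assumes a: "a \<in> gr d" and b: "b \<in> gr e" and c: "c \<in> gr f"
  shows "lam (a * c) b = lam a (c * b) + sg (d * (e + f)) (lam c (b * a))"
proof -
  obtain q r where qr: "nondeg p0 q" "nondeg p0 r" "nondeg q r" by (rule two_more)
  have "hh p0 q (a * c) b = hh p0 r a (c * b) + sg ((d + dg r) * (e + f + dg r)) (hh r q c (b * a))"
    using hh_mult[OF qr(1,3,2) a b c] by simp
  then have "lam (a * c) b + sg ((d + f) * e) (et q (b * (a * c))) =
      lam a (c * b) + sg (d * (f + e)) (et r (c * b * a)) + sg ((d + dg r) * (e + f + dg r) + dg r * (e + d + f + 1))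
        (lam c (b * a) + sg (f * (e + d)) (et q (b * a * c)) - et r (c * (b * a)))"
    unfolding hh_p0_lam[OF qr(1) gr_mult[OF a c] b] hh_p0_lam[OF qr(2) a gr_mult[OF c b]]
      hh_lam[OF qr c gr_mult[OF b a]] by simp
  moreover have "(d + dg r) * (e + f + dg r) + dg r * (e + d + f + 1) = d * (e + f)"
    by (cases d; cases e; cases f; cases "dg r") simp_all
  ultimately show ?thesis
    by (simp add: sg_add sg_diff algebra_simps)
qed

text \<open>H_rq(c,b) and H_qr(b,c) agree up to sign. Expressed by \<open>hh_lam\<close>, both
  contain the same two \<open>et\<close> terms, so the \<open>lam\<close> terms must agree as
  well.\<close>

lemma lam_skew:
  assumes c: "c \<in> gr f" and b: "b \<in> gr e"
  shows "lam c b = - sg (f * e) (lam b c)"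
proof -
  obtain q r where qr: "nondeg p0 q" "nondeg p0 r" "nondeg q r" "nondeg r q" by (rule two_more)
  have x: "(f + dg r + dg q) * (e + dg r + dg q) + dg q * (f + e + 1) = dg r * (e + f + 1) + f * e"
    by (cases f; cases e; cases "dg r"; cases "dg q") simp_all
  have "sg (dg r * (e + f + 1)) (lam c b + sg (f * e) (et q (b * c)) - et r (c * b)) =
      - sg ((f + dg r + dg q) * (e + dg r + dg q)) (sg (dg q * (f + e + 1))
        (lam b c + sg (e * f) (et r (c * b)) - et q (b * c)))"
    using hh_flip[OF qr(4) c b] unfolding hh_lam[OF qr(1,2,3) c b] hh_lam[OF qr(2,1,4) b c] .
  then have "sg (dg r * (e + f + 1)) (lam c b + sg (f * e) (et q (b * c)) - et r (c * b)) =
      sg (dg r * (e + f + 1)) (- sg (f * e) (lam b c + sg (e * f) (et r (c * b)) - et q (b * c)))"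
    unfolding sg_sg x by (simp add: sg_minus)
  then have "lam c b + sg (f * e) (et q (b * c)) - et r (c * b) =
      - sg (f * e) (lam b c + sg (e * f) (et r (c * b)) - et q (b * c))"
    by (simp only: sg_cancel)
  then show ?thesis
    by (simp add: sg_add sg_diff mult.commute algebra_simps eq_neg_iff_add_eq_0)
qed

lemma lam_cyclic:
  assumes a: "a \<in> gr d" and b: "b \<in> gr e" and c: "c \<in> gr f"
  shows "sg (d * f) (lam (a * b) c) + sg (d * e) (lam (b * c) a) + sg (e * f) (lam (c * a) b) = 0"
  unfolding lam_assoc[OF a c b] lam_skew[OF a gr_mult[OF b c]] lam_skew[OF b gr_mult[OF c a]]
  by (simp add: sg_add sg_minus sg_diff algebra_simps)

text \<open>Reflecting H(1,x) and flipping the bracket yields H(bar x, 1) at \<open>st q\<close>,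
  which differs from \<open>et (st q) (bar x)\<close> by \<open>lam (bar x) 1\<close> = 0.\<close>

lemma et_st:
  assumes "nondeg p0 q"
  shows "et (st q) (bar x) = - et q x"
proof (induction x rule: homogeneous_induct)
  case (1 d x)
  have q: "nondeg p0 (st q)" "nondeg (st q) p0" using assms nondeg_sym by auto
  have y: "dg q * (d + 1) + (d + dg q) * dg q = 0" by (cases d; cases "dg q") simp_all
  have "et q x = sg (dg q * (d + 1)) (hh (st q) p0 1 (bar x))"
    using hh_st[OF assms one_in_gr 1] by (simp add: et_def)
  also have "hh (st q) p0 1 (bar x) = - sg (dg q * (d + dg q)) (hh p0 (st q) (bar x) 1)"
    using hh_flip[OF q(2) one_in_gr bar_gr[OF 1]] by simp
  finally have "et q x = - hh p0 (st q) (bar x) 1"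
    using y by (simp add: sg_minus mult.commute)
  also have "hh p0 (st q) (bar x) 1 = lam (bar x) 1 + et (st q) (bar x)"
    using hh_p0_lam[OF q(1) bar_gr[OF 1] one_in_gr] by simp
  also have "lam (bar x) 1 = 0"
    using lam_skew[OF bar_gr[OF 1] one_in_gr] by (simp add: lam_one)
  finally show ?case by simp
qed (use assms in \<open>simp add: et_add bar_add\<close>)

text \<open>Compare H_rq(c,b) with its reflection at \<open>st q\<close>, \<open>st r\<close>. By
  \<open>et_st\<close> the \<open>et\<close> terms match, with their roles exchanged.\<close>

lemma lam_bar: "lam (bar c) (bar b) = lam c b"
proof (induction c rule: homogeneous_induct)
  case (1 f c)
  note c = this
  show ?case
  proof (induction b rule: homogeneous_induct)
    case (1 e b)
    note b = this
    obtain q r where qr: "nondeg p0 q" "nondeg p0 r" "nondeg q r" "nondeg r q" by (rule two_more)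
    have st: "nondeg p0 (st r)" "nondeg p0 (st q)" "nondeg (st r) (st q)" using qr by simp_all
    have "sg (dg r * (e + f + 1)) (lam c b + sg (f * e) (et q (b * c)) - et r (c * b)) =
      sg ((dg r + dg q) * (f + e + 1)) (sg (dg q * (e + f + 1))
        (lam (bar c) (bar b) + sg (f * e) (et (st r) (bar b * bar c)) - et (st q) (bar c * bar b)))"
      using hh_st[OF qr(4) c b] unfolding hh_lam[OF qr(1,2,3) c b] hh_lam[OF st bar_gr[OF c] bar_gr[OF b]]
      by simp
    moreover have "(dg r + dg q) * (f + e + 1) + dg q * (e + f + 1) = dg r * (e + f + 1)"
      by (cases f; cases e; cases "dg r"; cases "dg q") simp_all
    moreover have "bar b * bar c = sg (f * e) (bar (c * b))" "bar c * bar b = sg (f * e) (bar (b * c))"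
      by (simp_all add: bar_times[OF c b] bar_times[OF b c] mult.commute)
    ultimately have "sg (dg r * (e + f + 1)) (lam c b + sg (f * e) (et q (b * c)) - et r (c * b)) =
      sg (dg r * (e + f + 1)) (lam (bar c) (bar b) - et r (c * b) + sg (f * e) (et q (b * c)))"
      using qr st by (simp add: et_sg et_st sg_minus)
    then show ?case by (simp add: algebra_simps)
  qed (simp add: lam_add bar_add)
qed (simp add: lam_add bar_add)

end

section \<open>The remaining spanning elements, and stability of their span\<close>

context sto_model
begin

lemma XL_diff: "nondeg p q \<Longrightarrow> XL p q (a - b) = XL p q a - XL p q b"
  using XL_add[of p q "a - b" b] by simp

text \<open>The lift of X_pq(c) with q = \<open>st p\<close>, for symplectic p, where no generator
  is available. By \<open>vv_eq\<close> the choice of the intermediate index is immaterial.\<close>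

definition vv :: "'m + 'n + 'n \<Rightarrow> 'r \<Rightarrow> 'l" where
  "vv p c = (let r = SOME r. nondeg p r in br (XL p r 1) (XL r (st p) c))"

text \<open>Expanding X_pq(ac) = [X_pr(a), X_rq(c)] moves the intermediate index from q to r and the
  coefficient c to the second factor.\<close>

lemma vv_eq:
  assumes "nondeg p q" "p \<noteq> st p"
  shows "br (XL p q a) (XL q (st p) b) = vv p (a * b)"
proof -
  have move: "br (XL p q (a * c)) (XL q (st p) b) = br (XL p r a) (XL r (st p) (c * b))"
    if nd: "nondeg p q" "nondeg p r" "nondeg r q" "nondeg q r" "nondeg r p" for q r a b c
  proof (induction a rule: homogeneous_induct)
    case (1 d a)
    note a = this
    show ?case
    proof (induction b rule: homogeneous_induct)
      case (1 e b)
      note b = this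
      show ?case
      proof (induction c rule: homogeneous_induct)
        case (1 f c)
        note c = this
        have nd': "nondeg q (st p)" "nondeg r (st p)" "nondeg q p" using nd nondeg_sym by auto
        \<comment> \<open>The cross term of the Leibniz rule: none of the indices of the two factors
          meet, even up to \<open>st\<close>.\<close>
        have z: "br (XL p r a) (XL q (st p) b) = 0"
          using assms(2) nd by (intro XL_zero nd nd') (auto simp: nondeg_def)
        have "br (XL p q (a * c)) (XL q (st p) b) = br (br (XL p r a) (XL r q c)) (XL q (st p) b)"
          by (simp add: XL_product nd)
        also have "\<dots> = br (XL p r a) (br (XL r q c) (XL q (st p) b)) -
           sg ((d + dg p + dg r) * (f + dg r + dg q)) (br (XL r q c) (br (XL p r a) (XL q (st p) b)))"
          by (rule L.br_leibniz_left[OF XL_H[OF _ a] XL_H[OF _ c] XL_H[OF _ b]]) (use nd nd' in auto)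
        also have "\<dots> = br (XL p r a) (XL r (st p) (c * b))"
          by (simp add: z XL_product nd nd')
        finally show ?case .
      qed (use nd nondeg_sym in \<open>simp add: distrib_left distrib_right XL_add L.br_add_left L.br_add_right\<close>)
    qed (use nd nondeg_sym in \<open>simp add: distrib_left distrib_right XL_add L.br_add_left L.br_add_right\<close>)
  qed (use nd nondeg_sym in \<open>simp add: distrib_left distrib_right XL_add L.br_add_left L.br_add_right\<close>)
  define s where "s = (SOME r. nondeg p r)"
  have s: "nondeg p s" unfolding s_def by (rule someI[of "nondeg p"]) (rule assms)
  have to_third: "br (XL p q a) (XL q (st p) b) = br (XL p r 1) (XL r (st p) (a * b))"
    if "nondeg p q" "nondeg p r" "nondeg q r" for q r a b
    using move[of q r 1 a b] that nondeg_sym by simp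
  show ?thesis
  proof (cases "nondeg q s")
    case True
    then show ?thesis unfolding vv_def Let_def s_def[symmetric] by (intro to_third assms s)
  next
    case False
    obtain r where r: "nondeg p r" "nondeg q r" "nondeg r q" using third[of p q] by blast
    have "nondeg r s" using False r s by (auto simp: nondeg_def)
    then have "br (XL p r 1) (XL r (st p) (a * b)) = vv p (a * b)"
      unfolding vv_def Let_def s_def[symmetric] using to_third[of r s 1 "a * b"] r s by simp
    then show ?thesis using to_third[of q r a b] assms r by simp
  qed
qed

lemma ex_nondeg: obtains q where "nondeg p q" "nondeg q p"
  using third[of p p] by blast

lemma vv_add: "p \<noteq> st p \<Longrightarrow> vv p (a + b) = vv p a + vv p b"
proof -
  assume p: "p \<noteq> st p"
  obtain q where q: "nondeg p q" "nondeg q p" by (rule ex_nondeg)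
  show ?thesis
    using vv_eq[OF q(1) p, of 1 a] vv_eq[OF q(1) p, of 1 b] vv_eq[OF q(1) p, of 1 "a + b"] q
    by (simp add: XL_add L.br_add_right)
qed

lemma vv_scale: "p \<noteq> st p \<Longrightarrow> vv p (scal c a) = sm c (vv p a)"
proof -
  assume p: "p \<noteq> st p"
  obtain q where q: "nondeg p q" "nondeg q p" by (rule ex_nondeg)
  show ?thesis
    using vv_eq[OF q(1) p, of 1 a] vv_eq[OF q(1) p, of 1 "scal c a"] q
    by (simp add: XL_scale L.br_sm_right)
qed

text \<open>Reflecting both factors of the defining bracket and exchanging them leads to a bracket
  of the same kind with coefficient \<open>bar c\<close>.\<close>

lemma vv_bar:
  assumes p: "p \<noteq> st p"
  shows "vv p (bar c) = vv p c"
proof (induction c rule: homogeneous_induct)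
  case (1 d c)
  obtain q where q: "nondeg p q" "nondeg q p" by (rule ex_nondeg)
  have dgp: "dg p = 1" using p by (cases p rule: index_cases) auto
  have nd: "nondeg q (st p)" "nondeg (st q) p" "nondeg (st q) (st p)" "nondeg p (st q)" using q by auto
  have "vv p c = br (XL p q 1) (XL q (st p) c)"
    using vv_eq[OF q(1) p, of 1 c] by simp
  also have "\<dots> = sg (xs (st q) (st p) + xs p (st q) + (dg q + dg p) * d)
      (br (XL (st q) (st p) 1) (XL p (st q) (bar c)))"
    using q nd cj_homog[OF one_in_gr, of "dg p + dg q"]
    by (simp add: XL_st[OF q(1), of 1] XL_st[OF nd(1), of c] cj_homog[OF 1] XL_sg L.br_minus_left L.br_minus_right
        L.br_sg_left L.br_sg_right sg_minus ac_simps)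
  also have "br (XL (st q) (st p) 1) (XL p (st q) (bar c)) =
      - sg ((dg q + dg p) * (d + dg p + dg q)) (vv p (bar c))"
    using XL_flip[OF nd(3,4) one_in_gr bar_gr[OF 1]] vv_eq[OF nd(4) p, of "bar c" 1] by simp
  finally have "vv p c = - sg (xs (st q) (st p) + xs p (st q) + (dg q + dg p) * d + (dg q + dg p) * (d + dg p + dg q)) (vv p (bar c))"
    by (simp add: sg_minus)
  \<comment> \<open>The exponent is 1 because dg p = 1; it cancels the minus sign in front.\<close>
  also have "xs (st q) (st p) + xs p (st q) + (dg q + dg p) * d + (dg q + dg p) * (d + dg p + dg q) = 1"
    by (simp add: xs_def nu_st dgp) (cases "dg q"; cases d; cases "nu p"; cases "nu q"; simp)
  finally show ?case by simp
qed (simp add: bar_add vv_add p)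

text \<open>Coefficients are taken homogeneous so that all members lie in some \<open>H d\<close>.
  H_pq for other p need not be listed, by \<open>hh_NN\<close>.\<close>

definition spanning :: "'l set" where
  "spanning = {XL p q a | p q a d. nondeg p q \<and> a \<in> gr d} \<union> {vv p a | p a d. p \<noteq> st p \<and> a \<in> gr d}
     \<union> {hh p0 q a b | q a b d e. nondeg p0 q \<and> a \<in> gr d \<and> b \<in> gr e}"

definition NN :: "'l set" where "NN = L.span spanning"

lemma NN_sub: "L.subspace NN"
  by (simp add: NN_def)

lemmas NN_add = L.subspace_add[OF NN_sub] and NN_diff = L.subspace_diff[OF NN_sub]
  and NN_sg = L.subspace_sg[OF NN_sub] and NN_0 = L.subspace_0[OF NN_sub]
  and NN_neg = L.subspace_neg[OF NN_sub] and NN_scale = L.subspace_scale[OF NN_sub]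

lemma XL_NN: "nondeg p q \<Longrightarrow> XL p q a \<in> NN"
proof (induction a rule: homogeneous_induct)
  case (1 d a)
  then show ?case unfolding NN_def spanning_def by (intro L.span_base) blast
qed (simp add: XL_add NN_add)

lemma vv_NN: "p \<noteq> st p \<Longrightarrow> vv p a \<in> NN"
proof (induction a rule: homogeneous_induct)
  case (1 d a)
  then show ?case unfolding NN_def spanning_def by (intro L.span_base) blast
qed (simp add: vv_add NN_add)

lemma hh_p0_NN: "nondeg p0 q \<Longrightarrow> hh p0 q a b \<in> NN"
proof (induction a rule: homogeneous_induct)
  case (1 d a)
  note a = this
  show ?case
  proof (induction b rule: homogeneous_induct)
    case (1 e b)
    then show ?case using a unfolding NN_def spanning_def by (intro L.span_base) blast
  qed (simp add: hh_add 1 NN_add)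
qed (simp add: hh_add NN_add)

lemma hh_NN:
  assumes qr: "nondeg q r" "nondeg r q" and a: "a \<in> gr d" and b: "b \<in> gr e"
  shows "hh q r a b \<in> NN"
proof -
  consider "q = p0" | "r = p0" | "nondeg p0 q" "nondeg p0 r"
    by (metis nondeg_def p0_simps(2))
  then show ?thesis
  proof cases
    case 1 then show ?thesis using hh_p0_NN qr by simp
  next
    case 2 then show ?thesis
      using hh_flip[OF qr(1) a b] qr by (simp add: hh_p0_NN NN_neg NN_sg)
  next
    case 3 then show ?thesis
      using hh_p0[OF 3(2,1) qr(2) a b] by (simp add: et_def NN_sg NN_diff hh_p0_NN)
  qed
qed

text \<open>A path u, v, w gives a root element, an H, or a \<open>vv\<close>, according to the
  position of w relative to u.\<close>

lemma path_NN:
  assumes "nondeg u v" "nondeg v w" "a \<in> gr d" "b \<in> gr e"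
  shows "br (XL u v a) (XL v w b) \<in> NN"
proof -
  consider "nondeg u w" | "w = u" | "w = st u" "u \<noteq> st u" by (metis nondeg_def)
  then show ?thesis
  proof cases
    case 1 then show ?thesis by (simp add: XL_product assms XL_NN)
  next
    case 2 then show ?thesis using hh_NN[of u v a d b e] assms by (simp add: hh_def)
  next
    case 3 then show ?thesis by (simp add: vv_eq assms vv_NN)
  qed
qed

text \<open>Up to reversing the bracket and reflecting the second factor, two elements X_pq and X_rs
  either form a path or commute.\<close>

lemma XL_XL_NN:
  assumes pq: "nondeg p q" "nondeg r s" and a: "a \<in> gr d" and b: "b \<in> gr e"
  shows "br (XL p q a) (XL r s b) \<in> NN"
proof -
  have *: "br (XL p q a) (XL r s b) \<in> NN" if "q = r \<or> p = s" "nondeg r s" "b \<in> gr e" for r s b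
    using that path_NN[OF pq(1), of s a d b e] path_NN[of r p q b e a d] XL_flip[OF pq(1) that(2) a that(3)] pq a
    by (auto simp: NN_neg NN_sg)
  consider "q = r \<or> p = s" | "q = st s \<or> p = st r" | "q \<noteq> r" "p \<noteq> s" "q \<noteq> st s" "p \<noteq> st r" by blast
  then show ?thesis
  proof cases
    case 1 then show ?thesis using * pq b by blast
  next
    case 2
    have "nondeg (st s) (st r)" using pq nondeg_sym by simp
    then have "br (XL p q a) (XL (st s) (st r) (cj (dg r + dg s) b)) \<in> NN"
      using * 2 b cj_gr by blast
    then show ?thesis
      by (subst XL_st[OF pq(2)]) (simp add: L.br_minus_right L.br_sg_right NN_neg NN_sg)
  next
    case 3 then show ?thesis by (simp add: XL_zero pq NN_0)
  qed
qed

text \<open>If p or q is nondegenerate to both r and s, the indices that survive the bracket are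
  again nondegenerate, so neither an H nor a \<open>vv\<close> can arise.\<close>

lemma XL_XL_root:
  assumes pq: "nondeg p q" "nondeg r s" and a: "a \<in> gr d" and b: "b \<in> gr e"
    and "nondeg p r \<and> nondeg p s \<or> nondeg q r \<and> nondeg q s"
  shows "\<exists>u v c f. nondeg u v \<and> c \<in> gr f \<and> br (XL p q a) (XL r s b) = XL u v c"
proof -
  let ?P = "\<lambda>x. \<exists>u v c f. nondeg u v \<and> c \<in> gr f \<and> x = XL u v c"
  have P0: "?P (sg x (XL u v c))" if "nondeg u v" "c \<in> gr f" for x u v c f
    using that by (intro exI[of _ u] exI[of _ v] exI[of _ "sg x c"] exI[of _ f]) (simp add: XL_sg gr_sg)
  have neg: "- sg x y = sg (1 + x) y" for x and y :: 'l by (cases x) simp_all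
  have P: "?P (sg x (XL u v c))" "?P (- sg x (XL u v c))" "?P (- XL u v c)" "?P (XL u v c)"
    if "nondeg u v" "c \<in> gr f" for x u v c f
    using P0[OF that, of x] P0[OF that, of "1 + x"] P0[OF that, of 1] P0[OF that, of 0]
    unfolding neg by simp_all
  have *: "?P (br (XL p q a) (XL r s b)) \<and> ?P (- sg x (br (XL p q a) (XL r s b)))"
    if "q = r \<or> p = s" and nd: "nondeg r s" "nondeg p r \<and> nondeg p s \<or> nondeg q r \<and> nondeg q s" and b: "b \<in> gr e" for r s b x
  proof (cases "q = r")
    case True
    then have "nondeg p s" using nd by (auto simp: nondeg_def)
    then show ?thesis using True pq(1) nd(1) P gr_mult[OF a b] by (simp add: XL_product)
  next
    case False
    then have 1: "p = s" using that by blast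
    then have "nondeg r q" using nd nondeg_sym by (auto simp: nondeg_def)
    then have "br (XL p q a) (XL r s b) = - sg ((d + dg p + dg q) * (e + dg r + dg s)) (XL r q (b * a))"
      using XL_flip[OF pq(1) nd(1) a b] 1 pq(1) nd(1) by (simp add: XL_product)
    then show ?thesis using P[OF \<open>nondeg r q\<close> gr_mult[OF b a]] by (simp add: sg_minus)
  qed
  consider "q = r \<or> p = s" | "q = st s \<or> p = st r" | "q \<noteq> r" "p \<noteq> s" "q \<noteq> st s" "p \<noteq> st r" by blast
  then show ?thesis
  proof cases
    case 1 then show ?thesis using * assms by blast
  next
    case 2
    have nd: "nondeg (st s) (st r)" using pq nondeg_sym by simp
    have "?P (- sg (xs (st s) (st r)) (br (XL p q a) (XL (st s) (st r) (cj (dg r + dg s) b))))"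
    proof (rule conjunct2[OF *])
      show "q = st s \<or> p = st r" by (rule 2)
      show "nondeg (st s) (st r)" by (rule nd)
      show "nondeg p (st s) \<and> nondeg p (st r) \<or> nondeg q (st s) \<and> nondeg q (st r)"
        using assms(5) by auto
      show "cj (dg r + dg s) b \<in> gr e" by (rule cj_gr[OF b])
    qed
    then show ?thesis
      by (subst XL_st[OF pq(2)]) (simp add: L.br_minus_right L.br_sg_right)
  next
    case 3
    then show ?thesis
      \<comment> \<open>A vanishing bracket counts as a root element with coefficient 0.\<close>
      by (intro exI[of _ p] exI[of _ q] exI[of _ 0] exI[of _ 0])
        (simp add: XL_zero pq XL_0 subspace_0 gr_sub)
  qed
qed

text \<open>By the Leibniz rule only brackets of two root elements remain, because the outer element
  sends each inner factor to a root element.\<close>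

lemma XL_bracket_NN:
  assumes Z: "nondeg p0 s" "c \<in> gr f"
    and x: "nondeg p q" "a \<in> gr d" and y: "nondeg p' q'" "b \<in> gr e"
    and "nondeg p0 p \<and> nondeg p0 q \<or> nondeg s p \<and> nondeg s q"
    and "nondeg p0 p' \<and> nondeg p0 q' \<or> nondeg s p' \<and> nondeg s q'"
  shows "br (XL p0 s c) (br (XL p q a) (XL p' q' b)) \<in> NN"
proof -
  obtain u v c1 f1 where 1: "nondeg u v" "c1 \<in> gr f1" "br (XL p0 s c) (XL p q a) = XL u v c1"
    using XL_XL_root[OF Z(1) x(1) Z(2) x(2)] assms(7) by blast
  obtain u' v' c2 f2 where 2: "nondeg u' v'" "c2 \<in> gr f2" "br (XL p0 s c) (XL p' q' b) = XL u' v' c2"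
    using XL_XL_root[OF Z(1) y(1) Z(2) y(2)] assms(8) by blast
  show ?thesis
    unfolding L.br_leibniz_right[OF XL_H[OF Z] XL_H[OF x] XL_H[OF y]] 1(3) 2(3)
    by (intro NN_add NN_sg XL_XL_NN[OF 1(1) y(1) 1(2) y(2)] XL_XL_NN[OF x(1) 2(1) x(2) 2(2)])
qed

text \<open>Each spanning element is written as a bracket of root elements lying well enough with
  respect to \<open>p0\<close> and \<open>s\<close> for \<open>XL_bracket_NN\<close>.\<close>

lemma Z_spanning:
  assumes Z: "nondeg p0 s" "c \<in> gr f" and g: "g \<in> spanning"
  shows "br (XL p0 s c) g \<in> NN"
proof -
  consider p q a d where "g = XL p q a" "nondeg p q" "a \<in> gr d"
    | p a d where "g = vv p a" "p \<noteq> st p" "a \<in> gr d"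
    | q a b d e where "g = hh p0 q a b" "nondeg p0 q" "a \<in> gr d" "b \<in> gr e"
    using g unfolding spanning_def by blast
  then show ?thesis
  proof cases
    case 1
    then show ?thesis using XL_XL_NN Z by blast
  next
    case 2
    have p: "nondeg p0 p" using 2(2) by (auto simp: nondeg_def p0_def)
    obtain r where r: "nondeg p r" "nondeg r p" "nondeg p0 r" using third[of p p0] by blast
    have "g = br (XL p r 1) (XL r (st p) a)" using vv_eq[OF r(1) 2(2), of 1 a] 2(1) by simp
    then show ?thesis
      using XL_bracket_NN[OF Z r(1) one_in_gr, of r "st p" a d] r 2(3) p by simp
  next
    case 3
    have *: "br (XL p0 s c) (hh p0 r a b) \<in> NN" if r: "nondeg p0 r" "nondeg s r" "a \<in> gr d" "b \<in> gr e" for r a b d e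
    proof -
      have rp: "nondeg r p0" using r nondeg_sym by blast
      have sp: "nondeg s p0" using Z nondeg_sym by blast
      show ?thesis
        unfolding hh_def using XL_bracket_NN[OF Z r(1,3) rp r(4)] r sp by simp
    qed
    show ?thesis
    proof (cases "nondeg s q")
      case True then show ?thesis using * 3 by blast
    next
      \<comment> \<open>Here q is s or \<open>st s\<close>. \<open>hh_mult\<close> trades q for a
        third index r, at the cost of an H whose indices are nondegenerate to
        \<open>p0\<close>.\<close>
      case False
      obtain r where r: "nondeg p0 r" "nondeg q r" "nondeg r q" using third[of p0 q] by blast
      have s: "nondeg s r" using False r by (auto simp: nondeg_def)
      have "g = hh p0 r a b + sg ((d + dg r) * (e + dg r)) (hh r q 1 (b * a))"
        using hh_mult[OF 3(2) r(2) r(1) 3(3,4) one_in_gr] 3(1) by simp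
      moreover have "br (XL p0 s c) (hh r q 1 (b * a)) \<in> NN"
        unfolding hh_def
        using XL_bracket_NN[OF Z r(3) one_in_gr r(2) gr_mult[OF 3(4,3)]] r 3 by simp
      ultimately show ?thesis using *[OF r(1) s 3(3,4)]
        by (simp add: L.br_add_right L.br_sg_right NN_add NN_sg)
    qed
  qed
qed

lemma spanning_H:
  assumes "g \<in> spanning"
  shows "\<exists>d. g \<in> H d"
proof -
  consider p q a d where "g = XL p q a" "nondeg p q" "a \<in> gr d"
    | p a d where "g = vv p a" "p \<noteq> st p" "a \<in> gr d"
    | q a b d e where "g = hh p0 q a b" "nondeg p0 q" "a \<in> gr d" "b \<in> gr e"
    using assms unfolding spanning_def by blast
  then show ?thesis
  proof cases
    case 1 then show ?thesis using XL_H by blast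
  next
    case 2
    obtain r where r: "nondeg p r" "nondeg r p" by (rule ex_nondeg)
    have "g = br (XL p r 1) (XL r (st p) a)" using vv_eq[OF r(1) 2(2), of 1 a] 2(1) by simp
    then show ?thesis using L.H_br[OF XL_H[OF r(1) one_in_gr] XL_H[OF _ 2(3)]] r by (metis nondeg_st(2))
  next
    case 3
    then show ?thesis unfolding hh_def using L.H_br[OF XL_H XL_H] nondeg_sym by blast
  qed
qed

text \<open>The homogeneous elements that normalize the span form a subalgebra; it contains generators.\<close>

definition KK :: "bit \<Rightarrow> 'l set" where
  "KK d = {x \<in> H d. \<forall>y\<in>NN. br x y \<in> NN}"

lemma KK_I:
  assumes "x \<in> H d" "\<And>g. g \<in> spanning \<Longrightarrow> br x g \<in> NN"
  shows "x \<in> KK d"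
proof -
  have "br x y \<in> NN" if "y \<in> NN" for y
    using that unfolding NN_def[of] 
  proof (induction rule: L.span_induct_alt)
    case base then show ?case by (simp add: L.span_zero)
  next
    case (step c z y)
    then show ?case
      using assms(2)[of z] unfolding NN_def
      by (simp add: L.br_add_right L.br_sm_right L.span_add L.span_scale)
  qed
  then show ?thesis using assms(1) by (simp add: KK_def)
qed

lemma KK_br: "x \<in> KK d \<Longrightarrow> y \<in> KK e \<Longrightarrow> br x y \<in> KK (d + e)"
proof (rule KK_I)
  assume x: "x \<in> KK d" and y: "y \<in> KK e"
  then show "br x y \<in> H (d + e)" by (simp add: KK_def L.H_br)
  fix g assume g: "g \<in> spanning"
  then obtain f where f: "g \<in> H f" using spanning_H by blast
  have "g \<in> NN" using g unfolding NN_def by (rule L.span_base)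
  then show "br (br x y) g \<in> NN"
    using x y L.br_leibniz_left[of x d y e g f] f by (simp add: KK_def NN_diff NN_sg)
qed

lemma KK_sub: "L.subspace (KK d)"
  by (rule L.subspaceI)
    (auto simp: KK_def L.subspace_0 L.subspace_add L.subspace_scale L.H_subspace NN_0 NN_add NN_scale
      L.br_add_left L.br_sm_left)

lemma Z_KK: "nondeg p0 s \<Longrightarrow> c \<in> gr f \<Longrightarrow> XL p0 s c \<in> KK (f + dg s)"
  using XL_H[of p0 s c f] by (intro KK_I Z_spanning) auto

lemma gen_eq_XL: "gen q a = XL (row_index q) (col_index q) a"
  by (cases q) (simp_all add: XL_def)

lemma valid_nondeg: "valid_kind q \<Longrightarrow> nondeg (row_index q) (col_index q)"
  by (cases q) (auto simp: nondeg_def)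

abbreviation ev :: "('k, ('m, 'n, 'r) sto_generator) lie_term \<Rightarrow> 'l" where
  "ev \<equiv> lev sm br (\<lambda>x. gen (fst x) (snd x))"

text \<open>The elements \<open>XL p0 s c\<close> generate the algebra.\<close>

context
  fixes K :: "bit \<Rightarrow> 'l set"
  assumes K_sub: "\<And>d. L.subspace (K d)"
    and K_br: "\<And>x y d e. x \<in> K d \<Longrightarrow> y \<in> K e \<Longrightarrow> br x y \<in> K (d + e)"
    and K_Z: "\<And>s c f. nondeg p0 s \<Longrightarrow> c \<in> gr f \<Longrightarrow> XL p0 s c \<in> K (f + dg s)"
begin

text \<open>As \<open>p0\<close> is self-dual, the X_pq with second index \<open>p0\<close> are
  reflections of those with first index \<open>p0\<close>; any other one is the bracket of one of
  each sort.\<close>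

lemma XL_in_K:
  assumes pq: "nondeg p q" and a: "a \<in> gr d"
  shows "XL p q a \<in> K (d + dg p + dg q)"
proof -
  have qp: "nondeg q p" using pq nondeg_sym by blast
  have r: "XL p p0 a \<in> K (d + dg p)" if "nondeg p0 p" "a \<in> gr d" for p a d
  proof -
    have "nondeg p p0" using that nondeg_sym by blast
    from XL_st[OF this, of a] have "XL p p0 a = - sg (xs p0 (st p)) (XL p0 (st p) (cj (dg p) a))" by simp
    moreover have "XL p0 (st p) (cj (dg p) a) \<in> K (d + dg p)"
      using K_Z[of "st p" "cj (dg p) a" d] that cj_gr by simp
    ultimately show ?thesis by (simp add: L.subspace_neg[OF K_sub] L.subspace_sg[OF K_sub])
  qed
  consider "p = p0" | "q = p0" | "nondeg p0 p" "nondeg p0 q" by (metis nondeg_def p0_simps(2))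
  then show ?thesis
  proof cases
    case 1 then show ?thesis using K_Z pq a by simp
  next
    case 2 then show ?thesis using r[OF _ a, of p] qp by simp
  next
    case 3
    have "nondeg p p0" using 3 nondeg_sym by blast
    then have "XL p q a = br (XL p p0 a) (XL p0 q 1)"
      using XL_product[of p p0 q a 1] 3 pq by simp
    then show ?thesis using K_br[OF r[OF 3(1) a] K_Z[OF 3(2) one_in_gr]] by simp
  qed
qed

text \<open>Applied to the normaliser \<open>KK\<close> of the span and to the centraliser of a
  kernel element. Both are given degree by degree, hence the two summands.\<close>

lemma ev_in_K:
  assumes "t \<in> lie_terms (sto_generators gr)"
  shows "\<exists>x0\<in>K 0. \<exists>x1\<in>K 1. ev t = x0 + x1"
  using assms
proof (induction t)
  case (Gen x)
  then obtain e where e: "valid_kind (fst x)" "snd x \<in> gr e" by (auto simp: sto_generators_def)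
  have "\<exists>d. ev (Gen x) \<in> K d"
    using XL_in_K[OF valid_nondeg[OF e(1)] e(2)] by (auto simp: gen_eq_XL)
  then obtain d where d: "ev (Gen x) \<in> K d" by blast
  show ?case
  proof (cases "d = 0")
    case True
    then show ?thesis using d L.subspace_0[OF K_sub, of 1]
      by (intro bexI[of _ "ev (Gen x)"] bexI[of _ 0]) auto
  next
    case False
    then show ?thesis using d L.subspace_0[OF K_sub, of 0]
      by (intro bexI[of _ 0] bexI[of _ "ev (Gen x)"]) auto
  qed
next
  case Zero
  then show ?case using L.subspace_0[OF K_sub] by (auto intro!: bexI[of _ 0])
next
  case (Add s t)
  then obtain s0 s1 t0 t1 where *: "s0 \<in> K 0" "s1 \<in> K 1" "t0 \<in> K 0" "t1 \<in> K 1"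
    "ev s = s0 + s1" "ev t = t0 + t1"
    by auto
  then show ?case
    by (intro bexI[of _ "s0 + t0"] bexI[of _ "s1 + t1"])
      (auto simp: algebra_simps intro: L.subspace_add[OF K_sub])
next
  case (Smul a s)
  then obtain s0 s1 where *: "s0 \<in> K 0" "s1 \<in> K 1" "ev s = s0 + s1" by auto
  then show ?case
    by (intro bexI[of _ "sm a s0"] bexI[of _ "sm a s1"])
      (auto simp: L.scale_right_distrib intro: L.subspace_scale[OF K_sub])
next
  case (Br s t)
  then obtain s0 s1 t0 t1 where *: "s0 \<in> K 0" "s1 \<in> K 1" "t0 \<in> K 0" "t1 \<in> K 1"
    "ev s = s0 + s1" "ev t = t0 + t1"
    by auto
  have "br s0 t0 + br s1 t1 \<in> K 0" "br s0 t1 + br s1 t0 \<in> K 1"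
    using K_br[OF *(1,3)] K_br[OF *(2,4)] K_br[OF *(1,4)] K_br[OF *(2,3)]
    by (auto intro: L.subspace_add[OF K_sub])
  then show ?case using *
    by (intro bexI[of _ "br s0 t0 + br s1 t1"] bexI[of _ "br s0 t1 + br s1 t0"])
      (auto simp: L.br_add_left L.br_add_right algebra_simps)
qed

end

text \<open>A bracket stays in the span because its left factor is a sum of two elements that
  normalise it.\<close>

lemma ev_NN:
  assumes "t \<in> lie_terms (sto_generators gr)"
  shows "ev t \<in> NN"
  using assms
proof (induction t)
  case (Gen x)
  then have "valid_kind (fst x)" by (auto simp: sto_generators_def)
  then show ?case using XL_NN[OF valid_nondeg, of "fst x" "snd x"] by (simp flip: gen_eq_XL)
next
  case (Br s t)
  then obtain x0 x1 where "x0 \<in> KK 0" "x1 \<in> KK 1" "ev s = x0 + x1"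
    using ev_in_K[of KK s, OF KK_sub KK_br Z_KK] by auto
  then show ?case using Br by (simp add: L.br_add_left KK_def NN_add)
qed (simp_all add: NN_0 NN_add NN_scale)

text \<open>Both terms of the Leibniz rule lead back to the indices \<open>p0\<close>, s: one
  directly, the other after reflecting X_pq and X_qp at p = \<open>p0\<close>, which is its own
  dual.\<close>

lemma hh_action:
  assumes q: "nondeg p0 q" "nondeg q s" and s: "nondeg p0 s" and a: "a \<in> gr d" and b: "b \<in> gr e" and c: "c \<in> gr f"
  shows "\<exists>x. br (hh p0 q a b) (XL p0 s c) = XL p0 s x"
proof -
  have nd: "nondeg q p0" "nondeg s q" "nondeg s p0" using q s nondeg_sym by blast+
  have 1: "br (XL p0 q a) (br (XL q p0 b) (XL p0 s c)) = XL p0 s (a * (b * c))"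
    by (simp add: XL_product nd q s)
  have "br (XL p0 q a) (XL p0 s c) = - sg (xs (st q) p0) (XL (st q) s (cj (dg q) a * c))"
    using XL_st[OF q(1), of a] nd q s by (simp add: L.br_minus_left L.br_sg_left XL_product)
  moreover have "br (XL q p0 b) (XL (st q) s (cj (dg q) a * c)) =
      - sg (xs p0 (st q)) (XL p0 s (cj (dg q) b * (cj (dg q) a * c)))"
    using XL_st[OF nd(1), of b] nd q s by (simp add: L.br_minus_left L.br_sg_left XL_product)
  ultimately have 2: "br (XL q p0 b) (br (XL p0 q a) (XL p0 s c)) =
      sg (xs (st q) p0 + xs p0 (st q)) (XL p0 s (cj (dg q) b * (cj (dg q) a * c)))"
    by (simp add: L.br_minus_right L.br_sg_right sg_minus add.commute)
  have "br (hh p0 q a b) (XL p0 s c) = XL p0 s (a * (b * c)) -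
     sg ((d + dg p0 + dg q) * (e + dg q + dg p0)) (XL p0 s (sg (xs (st q) p0 + xs p0 (st q)) (cj (dg q) b * (cj (dg q) a * c))))"
    unfolding hh_def L.br_leibniz_left[OF XL_H[OF q(1) a] XL_H[OF nd(1) b] XL_H[OF s c]] 1 2 XL_sg[OF s] ..
  also have "\<dots> = XL p0 s (a * (b * c) - sg ((d + dg p0 + dg q) * (e + dg q + dg p0))
     (sg (xs (st q) p0 + xs p0 (st q)) (cj (dg q) b * (cj (dg q) a * c))))"
    by (simp only: XL_diff[OF s] XL_sg[OF s])
  finally show ?thesis by blast
qed

text \<open>The freedom in \<open>lam_homog\<close> is used to take q away from s. Only the shape of
  the result matters; its coefficient is determined through psi in
  \<open>kernel_central\<close>.\<close>

lemma lam_action: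
  assumes s: "nondeg p0 s"
  shows "\<exists>x. br (lam a b) (XL p0 s c) = XL p0 s x"
proof -
  let ?P = "\<lambda>y. \<exists>x. y = XL p0 s x"
  have add: "?P (y + z)" if "?P y" "?P z" for y z
    using that XL_add[OF s] by metis
  have neg: "?P (- sg x y)" if "?P y" for y x
    using that XL_sg[OF s] by (metis minus_eq_sg)
  obtain q where q: "nondeg p0 q" "nondeg s q" "nondeg q s" using third[of p0 s] by blast
  show ?thesis
  proof (induction a rule: homogeneous_induct)
    case (1 d a)
    note a = this
    show ?case
    proof (induction b rule: homogeneous_induct)
      case (1 e b)
      note b = this
      show ?case
      proof (induction c rule: homogeneous_induct)
        case (1 f c)
        have "br (lam a b) (XL p0 s c) = br (hh p0 q a b) (XL p0 s c) + - sg (d * e) (br (hh p0 q 1 (b * a)) (XL p0 s c))"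
          unfolding lam_homog[OF q(1) a b] et_def
          using L.br_add_left[of _ "- sg _ _"] by (simp add: L.br_minus_left L.br_sg_left)
        then show ?case
          using add[OF hh_action[OF q(1,3) s a b 1] neg[OF hh_action[OF q(1,3) s one_in_gr gr_mult[OF b a] 1]]]
          by simp
      qed (simp add: XL_add[OF s] L.br_add_right add)
    qed (simp add: lam_add L.br_add_left add)
  qed (simp add: lam_add L.br_add_left add)
qed

end

section \<open>Linear extension\<close>

abbreviation pm_scale :: "'k::comm_ring_1 \<Rightarrow> ('x \<Rightarrow>\<^sub>0 'k) \<Rightarrow> ('x \<Rightarrow>\<^sub>0 'k)" where
  "pm_scale c \<equiv> Poly_Mapping.map ((*) c)"

lemma lookup_pm_scale [simp]: "Poly_Mapping.lookup (pm_scale c p) x = c * Poly_Mapping.lookup p x"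
  by (simp add: Poly_Mapping.map.rep_eq when_def)

interpretation PM: Modules.module "pm_scale :: 'k::comm_ring_1 \<Rightarrow> ('x \<Rightarrow>\<^sub>0 'k) \<Rightarrow> _"
  by unfold_locales (rule poly_mapping_eqI; simp add: lookup_add algebra_simps)+

text \<open>The linear map out of the free module on \<open>'x\<close> that extends
  \<open>f\<close>.\<close>

definition plin :: "('k::comm_ring_1 \<Rightarrow> 'b \<Rightarrow> 'b) \<Rightarrow> ('x \<Rightarrow> 'b) \<Rightarrow> ('x \<Rightarrow>\<^sub>0 'k) \<Rightarrow> 'b::ab_group_add" where
  "plin s f p = (\<Sum>x\<in>Poly_Mapping.keys p. s (Poly_Mapping.lookup p x) (f x))"

context Modules.module
begin

lemma plin_superset:
  assumes "finite S" "Poly_Mapping.keys p \<subseteq> S"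
  shows "plin scale f p = (\<Sum>x\<in>S. scale (Poly_Mapping.lookup p x) (f x))"
  unfolding plin_def using assms
  by (intro sum.mono_neutral_left) (auto simp: in_keys_iff)

lemma plin_add: "plin scale f (p + q) = plin scale f p + plin scale f q"
proof -
  let ?S = "Poly_Mapping.keys p \<union> Poly_Mapping.keys q \<union> Poly_Mapping.keys (p + q)"
  have "plin scale f r = (\<Sum>x\<in>?S. scale (Poly_Mapping.lookup r x) (f x))" if "r \<in> {p, q, p + q}" for r
    using that by (intro plin_superset) auto
  then show ?thesis
    by (simp add: lookup_add scale_left_distrib sum.distrib)
qed

lemma plin_scale: "plin scale f (pm_scale c p) = scale c (plin scale f p)"
proof -
  let ?S = "Poly_Mapping.keys p \<union> Poly_Mapping.keys (pm_scale c p)"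
  have "plin scale f r = (\<Sum>x\<in>?S. scale (Poly_Mapping.lookup r x) (f x))" if "r \<in> {p, pm_scale c p}" for r
    using that by (intro plin_superset) auto
  then show ?thesis
    by (simp add: scale_sum_right)
qed

lemma plin_single [simp]: "plin scale f (Poly_Mapping.single x c) = scale c (f x)"
  by (simp add: plin_superset[of "{x}"])

lemma plin_zero [simp]: "plin scale f 0 = 0"
  by (simp add: plin_def)

lemma plin_diff: "plin scale f (p - q) = plin scale f p - plin scale f q"
  using plin_add[of f "p - q" q] by simp

lemma plin_sum: "plin scale f (\<Sum>i\<in>I. g i) = (\<Sum>i\<in>I. plin scale f (g i))"
  by (induction I rule: infinite_finite_induct) (simp_all add: plin_add)

end

lemma plin_hom:
  fixes f :: "'x \<Rightarrow> 'b::ab_group_add"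
  assumes "\<And>x y. h (x + y) = h x + h y" "\<And>c x. h (s c x) = s' c (h x)"
  shows "h (plin s f p) = plin s' (\<lambda>x. h (f x)) p"
proof -
  have h0: "h 0 = 0" using assms(1)[of 0 0] by simp
  have "h (sum g I) = (\<Sum>i\<in>I. h (g i))" for g and I :: "'x set"
    by (induction I rule: infinite_finite_induct) (simp_all add: h0 assms(1))
  then show ?thesis by (simp add: plin_def assms(2))
qed

section \<open>The kernel of psi\<close>

text \<open>Together \<open>psi\<close> and \<open>chi\<close> form a homomorphism into the cocycle
  extension, whose bracket is \<open>mqbr\<close>.\<close>

locale sto_cover =
  sto_model scal gr bar mn half sm br H gen + skew_dihedral_form scal gr bar mn sq ang
  for scal :: "'k::comm_ring_1 \<Rightarrow> 'r::ring_1 \<Rightarrow> 'r" and gr :: "bit \<Rightarrow> 'r set" and bar :: "'r \<Rightarrow> 'r"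
    and mn :: "('m::finite \<times> 'n::finite) itself" and half :: 'k
    and sm :: "'k \<Rightarrow> 'l::ab_group_add \<Rightarrow> 'l" and br :: "'l \<Rightarrow> 'l \<Rightarrow> 'l" and H :: "bit \<Rightarrow> 'l set"
    and gen :: "('m, 'n) kind \<Rightarrow> 'r \<Rightarrow> 'l"
    and sq :: "'k \<Rightarrow> 'q::ab_group_add \<Rightarrow> 'q" and ang :: "'r \<Rightarrow> 'r \<Rightarrow> 'q" +
  fixes psi :: "'l \<Rightarrow> ('m, 'n, 'r) smatrix" and chi :: "'l \<Rightarrow> 'q"
  assumes psi_add: "psi (x + y) = psi x + psi y" and psi_sm: "psi (sm c x) = ms c (psi x)"
    and psi_br: "psi (br x y) = mbr (psi x) (psi y)"
    and psi_gen: "valid_kind q \<Longrightarrow> psi (gen q a) = XM (row_index q) (col_index q) a"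
    and chi_add: "chi (x + y) = chi x + chi y" and chi_sm: "chi (sm c x) = sq c (chi x)"
    and chi_br: "chi (br x y) = alpha (psi x) (psi y)"
begin

lemma psi_sg: "psi (sg d x) = sg d (psi x)"
  by (rule additive_sg) (rule psi_add)

lemma psi_minus: "psi (- x) = - psi x"
  using psi_sg[of 1 x] by simp

lemma psi_diff: "psi (x - y) = psi x - psi y"
  using psi_add[of "x - y" y] by simp

lemma psi_zero [simp]: "psi 0 = 0"
  using psi_add[of 0 0] by simp

lemma chi_diff: "chi (x - y) = chi x - chi y"
  using chi_add[of "x - y" y] by simp

lemma chi_sg: "chi (sg d x) = sg d (chi x)"
  by (rule additive_sg) (rule chi_add)

lemma psi_XL: "nondeg p q \<Longrightarrow> psi (XL p q a) = XM p q a"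
  by (cases p rule: index_cases; cases q rule: index_cases)
    (simp_all add: XL_def nondeg_def psi_minus psi_gen XM_F XM_G XM_U)

lemma psi_hh: "nondeg p q \<Longrightarrow> psi (hh p q a b) = mbr (XM p q a) (XM q p b)"
  using nondeg_sym[of p q] by (simp add: hh_def psi_br psi_XL)

lemma psi_hh_homog:
  assumes "nondeg p q" "a \<in> gr d" "b \<in> gr e"
  shows "psi (hh p q a b) = XM p p (a * b) - sg ((d + dg p + dg q) * (e + dg p + dg q)) (XM q q (b * a))"
  using assms(1) mbr_XM[OF assms(2,3), of p q q p]
  by (simp add: psi_hh nondeg_def ac_simps st_eq_swap)

lemma psi_et:
  assumes "nondeg p0 q" "x \<in> gr d"
  shows "psi (et q x) = XM p0 p0 x - sg (dg q * (d + dg q)) (XM q q x)"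
  using psi_hh_homog[OF assms(1) one_in_gr assms(2)] by (simp add: et_def)

text \<open>In the difference defining \<open>lam\<close> the two diagonal parts at
  \<open>q0\<close> cancel, and the parts at \<open>p0\<close> combine to the
  supercommutator.\<close>

lemma psi_lam: "psi (lam a b) = XM p0 p0 (ring_scomm gr a b)"
proof (induction a rule: homogeneous_induct)
  case (1 d a)
  note a = this
  show ?case
  proof (induction b rule: homogeneous_induct)
    case (1 e b)
    have x: "d * e + dg q0 * (d + e + dg q0) = (d + dg q0) * (e + dg q0)"
      by (simp add: algebra_simps)
    show ?case
      unfolding lam_homog[OF nondeg_p0_q0 a 1] psi_diff psi_sg psi_hh_homog[OF nondeg_p0_q0 a 1]
        psi_et[OF nondeg_p0_q0 gr_mult[OF 1 a]] scomm_homog[OF a 1]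
      using x XM_add[of p0 p0 "a * b - sg (d * e) (b * a)" "sg (d * e) (b * a)"]
      by (simp add: sg_diff XM_sg add.commute[of e d])
  qed (simp add: lam_add psi_add scomm_add_right XM_add)
qed (simp add: lam_add psi_add scomm_add_left XM_add)

lemma chi_hh:
  assumes "nondeg p0 q" "a \<in> gr d" "b \<in> gr e"
  shows "chi (hh p0 q a b) = ang a b + ang a b"
proof -
  have "nondeg q p0" using assms nondeg_sym by blast
  then show ?thesis
    using alpha_XM[OF assms(2,3), of p0 q] assms(1)
    by (simp add: hh_def chi_br psi_XL nondeg_def)
qed

text \<open>The correction term in \<open>lam\<close> has value 2<1,ba> = 0.\<close>

lemma chi_lam: "chi (lam a b) = ang a b + ang a b"
proof (induction a rule: homogeneous_induct)
  case (1 d a)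
  note a = this
  show ?case
  proof (induction b rule: homogeneous_induct)
    case (1 e b)
    show ?case
      unfolding lam_homog[OF nondeg_p0_q0 a 1] chi_diff chi_sg et_def chi_hh[OF nondeg_p0_q0 a 1]
        chi_hh[OF nondeg_p0_q0 one_in_gr gr_mult[OF 1 a]]
      by (simp add: ang_one)
  qed (simp add: lam_add chi_add ang_add_right)
qed (simp add: lam_add chi_add ang_add_left)

text \<open>A linear section of \<open>psi\<close> on the span of the root elements and of the elements \<open>et q x\<close>.\<close>

definition kk :: "'m + 'n + 'n \<Rightarrow> 'r \<Rightarrow> 'r" where
  "kk q y = (if dg q = 1 then rho gr y else - y)"

definition S1 :: "('m, 'n, 'r) smatrix \<Rightarrow> 'l" where
  "S1 A = (\<Sum>p\<in>UNIV. \<Sum>q\<in>UNIV. if nondeg p q then XL p q (A $ p $ q) else 0)"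

definition S2 :: "('m, 'n, 'r) smatrix \<Rightarrow> 'l" where
  "S2 A = (\<Sum>p\<in>UNIV. if p \<noteq> st p then vv p (A $ p $ st p) else 0)"

definition S3 :: "('m, 'n, 'r) smatrix \<Rightarrow> 'l" where
  "S3 A = (\<Sum>q\<in>UNIV. if nondeg p0 q then et q (kk q (A $ q $ q)) else 0)"

text \<open>Every X_pq shows up at (p, q) and at its reflection, so reading all entries counts it
  twice; hence \<open>half\<close>. The factor \<open>kk q\<close> is the sign of X_qq(x) in
  \<open>psi (et q x)\<close>. The entry at \<open>p0\<close>, \<open>p0\<close> is not read at
  all.\<close>

definition Xi :: "('m, 'n, 'r) smatrix \<Rightarrow> 'l" where
  "Xi A = sm half (S1 A + S2 A + S3 A)"

lemma kk_add: "kk q (a + b) = kk q a + kk q b"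
  by (simp add: kk_def rho_add)

lemma kk_scale: "kk q (scal c a) = scal c (kk q a)"
  by (simp add: kk_def rho_scale)

lemma kk_zero [simp]: "kk q 0 = 0"
  using kk_add[of q 0 0] by simp

lemma S_add: "S1 (A + B) = S1 A + S1 B" "S2 (A + B) = S2 A + S2 B" "S3 (A + B) = S3 A + S3 B"
  unfolding S1_def S2_def S3_def sum.distrib[symmetric]
  by (intro sum.cong HOL.refl, auto simp: XL_add vv_add et_add kk_add)+

lemma S_scale: "S1 (ms c A) = sm c (S1 A)" "S2 (ms c A) = sm c (S2 A)" "S3 (ms c A) = sm c (S3 A)"
  unfolding S1_def S2_def S3_def L.scale_sum_right
  by (intro sum.cong HOL.refl, auto simp: XL_scale vv_scale et_scale kk_scale mat_scale_def)+

lemma Xi_add: "Xi (A + B) = Xi A + Xi B"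
  by (simp add: Xi_def S_add L.scale_right_distrib)

lemma Xi_scale: "Xi (ms c A) = sm c (Xi A)"
  by (simp add: Xi_def S_scale mult.commute flip: L.scale_right_distrib)

lemma Xi_zero [simp]: "Xi 0 = 0"
  using Xi_add[of 0 0] by simp

lemma S_sg: "S1 (sg d A) = sg d (S1 A)" "S2 (sg d A) = sg d (S2 A)" "S3 (sg d A) = sg d (S3 A)"
  by (rule additive_sg, rule S_add)+

lemma S_diff: "S1 (A - B) = S1 A - S1 B" "S2 (A - B) = S2 A - S2 B" "S3 (A - B) = S3 A - S3 B"
  using S_add(1)[of "A - B" B] S_add(2)[of "A - B" B] S_add(3)[of "A - B" B] by simp_all

lemma et_zero: "nondeg p0 q \<Longrightarrow> et q 0 = 0"
  using et_add[of q 0 0] by simp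

lemma vv_zero: "p \<noteq> st p \<Longrightarrow> vv p 0 = 0"
  using vv_add[of p 0 0] by simp

lemma S1_eu: "S1 (eu u v b) = (if nondeg u v then XL u v b else 0)"
proof -
  have "S1 (eu u v b) = (\<Sum>p\<in>UNIV. \<Sum>q\<in>UNIV. if q = v then if p = u then if nondeg u v then XL u v b else 0 else 0 else 0)"
    unfolding S1_def by (intro sum.cong HOL.refl) (auto simp: eu_nth XL_0)
  also have "\<dots> = (if nondeg u v then XL u v b else 0)"
    by (simp only: sum.delta finite UNIV_I if_True)
  finally show ?thesis .
qed

lemma S2_eu: "S2 (eu u v b) = (if v = st u \<and> u \<noteq> st u then vv u b else 0)"
proof -
  have "S2 (eu u v b) = (\<Sum>p\<in>UNIV. if p = u then if v = st u \<and> u \<noteq> st u then vv u b else 0 else 0)"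
    unfolding S2_def by (intro sum.cong HOL.refl) (auto simp: eu_nth vv_zero)
  also have "\<dots> = (if v = st u \<and> u \<noteq> st u then vv u b else 0)"
    by (simp only: sum.delta finite UNIV_I if_True)
  finally show ?thesis .
qed

lemma S3_eu: "S3 (eu u v b) = (if u = v \<and> nondeg p0 u then et u (kk u b) else 0)"
proof -
  have "S3 (eu u v b) = (\<Sum>p\<in>UNIV. if p = u then if u = v \<and> nondeg p0 u then et u (kk u b) else 0 else 0)"
    unfolding S3_def by (intro sum.cong HOL.refl) (auto simp: eu_nth et_zero)
  also have "\<dots> = (if u = v \<and> nondeg p0 u then et u (kk u b) else 0)"
    by (simp only: sum.delta finite UNIV_I if_True)
  finally show ?thesis .
qed

lemmas S_XM = XM_unfold S_add S_diff S_sg S1_eu S2_eu S3_eu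

lemma half_add: "sm half (x + x) = x"
  by (metis L.scale_left_distrib L.scale_one L.scale_right_distrib half)

lemma Xi_XL:
  assumes "nondeg p q"
  shows "Xi (XM p q a) = XL p q a"
proof -
  have "nondeg (st q) (st p)" using assms nondeg_sym by simp
  then have "S1 (XM p q a) = XL p q a + XL p q a"
    using assms XL_st[OF assms, of a] by (simp add: S_XM)
  moreover have "S2 (XM p q a) = 0" "S3 (XM p q a) = 0"
    using assms by (auto simp: S_XM nondeg_def)
  ultimately show ?thesis by (simp add: Xi_def half_add)
qed

text \<open>The position (p, \<open>st p\<close>) is its own reflection: its entry is c + bar c, and
  by \<open>vv_bar\<close> both summands lift to the same element.\<close>

lemma Xi_vv:
  assumes "p \<noteq> st p" "c \<in> gr d"
  shows "psi (vv p c) = XM p (st p) c" "Xi (XM p (st p) c) = vv p c"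
proof -
  obtain r where r: "nondeg p r" "nondeg r p" by (rule ex_nondeg)
  have "vv p c = br (XL p r 1) (XL r (st p) c)" using vv_eq[OF r(1) assms(1), of 1 c] by simp
  then have "psi (vv p c) = mbr (XM p r 1) (XM r (st p) c)" using r by (simp add: psi_br psi_XL)
  also have "\<dots> = XM p (st p) c"
    using mbr_XM[OF one_in_gr assms(2), of p r r "st p"] assms(1) r by (auto simp: nondeg_def)
  finally show "psi (vv p c) = XM p (st p) c" .
  have "xs p (st p) = 1" using assms(1) by (cases p rule: index_cases) (auto simp: xs_def)
  then have "S2 (XM p (st p) c) = vv p c + vv p c"
    using assms(1) by (simp add: S_XM vv_bar)
  moreover have "S1 (XM p (st p) c) = 0" "S3 (XM p (st p) c) = 0"
    using assms(1) by (auto simp: S_XM nondeg_def)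
  ultimately show "Xi (XM p (st p) c) = vv p c" by (simp add: Xi_def half_add)
qed

text \<open>Consequently \<open>Xi\<close> annihilates the image of every
  \<open>lam\<close>.\<close>

lemma Xi_p0: "Xi (XM p0 p0 c) = 0"
  by (simp add: Xi_def S_XM nondeg_def)

lemma Xi_et:
  assumes q: "nondeg p0 q" and x: "x \<in> gr d"
  shows "Xi (psi (et q x)) = et q x"
proof -
  have kk: "kk r y = sg (dg r * d + dg r + 1) y" if "y \<in> gr d" for r y
    using that by (cases "dg r") (simp_all add: kk_def rho_homog)
  have xs: "xs (st q) (st q) = 0" by (cases q rule: index_cases) (simp_all add: xs_def)
  have n1: "\<not> nondeg q q" "\<not> nondeg (st q) (st q)" "\<not> nondeg p0 p0" by (simp_all add: nondeg_def)
  have n2: "\<not> (q = st q \<and> q \<noteq> st q)" "\<not> (st q = st (st q) \<and> st q \<noteq> st (st q))" by auto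
  have "S3 (XM q q x) = et q (kk q x) - et (st q) (kk (st q) (bar x))"
    using q by (simp add: S_XM xs)
  also have "\<dots> = sg (dg q * d + dg q + 1) (et q x + et q x)"
    using q by (simp add: kk[OF x] kk[OF bar_gr[OF x]] et_sg et_st sg_add sg_minus)
  finally have "S3 (XM q q x) = sg (dg q * d + dg q + 1) (et q x + et q x)" .
  moreover have "S1 (XM q q x) = 0" "S2 (XM q q x) = 0"
    using n1 n2 by (simp_all add: S_XM)
  moreover have "S1 (XM p0 p0 x) = 0" "S2 (XM p0 p0 x) = 0" "S3 (XM p0 p0 x) = 0"
    using n1 by (simp_all add: S_XM)
  moreover have "sg (dg q * (d + dg q)) (sg (dg q * d + dg q + 1) y) = - y" for y :: 'l
    by (cases "dg q"; cases d) simp_all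
  ultimately show ?thesis
    unfolding psi_et[OF q x] Xi_def S_diff S_sg by (simp add: half_add del: sg_sg)
qed

abbreviation Lam :: "('r \<times> 'r \<Rightarrow>\<^sub>0 'k) \<Rightarrow> 'l" where
  "Lam \<equiv> plin sm (\<lambda>(a, b). lam a b)"

text \<open>The map sending n to n - \<open>Xi (psi n)\<close> is linear, vanishes on root elements,
  on \<open>vv\<close> and on \<open>et\<close>, and fixes each \<open>lam\<close>. So on the span
  its values are sums of \<open>lam\<close>; on the kernel of psi it is the identity.\<close>

lemma decomposition:
  assumes "n \<in> NN"
  shows "\<exists>\<xi>. n = Xi (psi n) + Lam \<xi>"
  using assms unfolding NN_def
proof (induction rule: L.span_induct_alt)
  case base
  show ?case by (intro exI[of _ 0]) simp
next
  case (step c g n)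
  have "\<exists>\<xi>. g = Xi (psi g) + Lam \<xi>"
  proof -
    consider p q a d where "g = XL p q a" "nondeg p q" "a \<in> gr d"
      | p a d where "g = vv p a" "p \<noteq> st p" "a \<in> gr d"
      | q a b d e where "g = hh p0 q a b" "nondeg p0 q" "a \<in> gr d" "b \<in> gr e"
      using step(1) unfolding spanning_def by blast
    then show ?thesis
    proof cases
      case 1
      then show ?thesis by (intro exI[of _ 0]) (simp add: psi_XL Xi_XL)
    next
      case 2
      then show ?thesis by (intro exI[of _ 0]) (simp add: Xi_vv)
    next
      case 3
      have "g = lam a b + sg (d * e) (et q (b * a))"
        using hh_p0_lam[OF 3(2-4)] 3(1) by simp
      moreover have "Xi (sg x (psi (et q (b * a)))) = sg x (et q (b * a))" for x
        using Xi_et[OF 3(2) gr_mult[OF 3(4,3)]] additive_sg[of Xi, OF Xi_add] by simp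
      ultimately show ?thesis
        by (intro exI[of _ "Poly_Mapping.single (a, b) 1"]) (simp add: psi_add Xi_add psi_lam Xi_p0 psi_sg)
    qed
  qed
  then obtain \<xi> \<eta> where "g = Xi (psi g) + Lam \<xi>" "n = Xi (psi n) + Lam \<eta>" using step(2) by blast
  then have "sm c g + n = sm c (Xi (psi g) + Lam \<xi>) + (Xi (psi n) + Lam \<eta>)" by metis
  also have "\<dots> = Xi (psi (sm c g + n)) + Lam (pm_scale c \<xi> + \<eta>)"
    by (simp add: psi_add psi_sm Xi_add Xi_scale L.plin_add L.plin_scale L.scale_right_distrib)
  finally have "sm c g + n = Xi (psi (sm c g + n)) + Lam (pm_scale c \<xi> + \<eta>)" .
  then show ?case by blast
qed

lemma kernel_Lam:
  assumes "t \<in> lie_terms (sto_generators gr)" "psi (ev t) = 0"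
  obtains \<xi> where "ev t = Lam \<xi>"
  using decomposition[OF ev_NN[OF assms(1)]] assms(2) that by auto

lemma psi_Lam: "psi (Lam \<xi>) = XM p0 p0 (plin scal (\<lambda>(a, b). ring_scomm gr a b) \<xi>)"
proof -
  have "psi (Lam \<xi>) = plin ms (\<lambda>x. psi (case x of (a, b) \<Rightarrow> lam a b)) \<xi>"
    by (rule plin_hom) (simp_all add: psi_add psi_sm)
  also have "(\<lambda>x. psi (case x of (a, b) \<Rightarrow> lam a b)) = (\<lambda>x. XM p0 p0 (case x of (a, b) \<Rightarrow> ring_scomm gr a b))"
    by (auto simp: psi_lam)
  also have "plin ms \<dots> \<xi> = XM p0 p0 (plin scal (\<lambda>(a, b). ring_scomm gr a b) \<xi>)"
    by (rule plin_hom[symmetric]) (simp_all add: XM_add XM_ms)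
  finally show ?thesis .
qed

text \<open>X_pp(c) at p = \<open>p0\<close> is the single entry c - bar c. This is where the
  condition defining the homology module comes from.\<close>

lemma psi_Lam_eq_0_iff:
  "psi (Lam \<xi>) = 0 \<longleftrightarrow>
    plin scal (\<lambda>(a, b). ring_scomm gr a b) \<xi> = bar (plin scal (\<lambda>(a, b). ring_scomm gr a b) \<xi>)"
proof -
  have "XM p0 p0 c = eu p0 p0 (c - bar c)" for c
    using eu_add[of p0 p0 "c - bar c" "bar c"] by (simp add: XM_unfold xs_def p0_def)
  moreover have "eu p0 p0 c = 0 \<longleftrightarrow> c = 0" for c
    by (auto simp: vec_eq_iff eu_nth)
  ultimately show ?thesis by (simp add: psi_Lam)
qed

lemma chi_Lam: "chi (Lam \<xi>) = plin sq (\<lambda>(a, b). ang a b) \<xi> + plin sq (\<lambda>(a, b). ang a b) \<xi>"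
proof -
  have "chi (Lam \<xi>) = plin sq (\<lambda>x. chi (case x of (a, b) \<Rightarrow> lam a b)) \<xi>"
    by (rule plin_hom) (simp_all add: chi_add chi_sm)
  also have "(\<lambda>x. chi (case x of (a, b) \<Rightarrow> lam a b)) =
      (\<lambda>x. (case x of (a, b) \<Rightarrow> ang a b) + (case x of (a, b) \<Rightarrow> ang a b))"
    by (auto simp: chi_lam)
  finally show ?thesis by (simp add: plin_def Q.scale_right_distrib sum.distrib)
qed

lemma Lam_action:
  assumes "nondeg p0 s"
  shows "\<exists>x. br (Lam \<xi>) (XL p0 s c) = XL p0 s x"
proof -
  have sum: "\<exists>x. br (sum f I) (XL p0 s c) = XL p0 s x"
    if "\<And>i. i \<in> I \<Longrightarrow> \<exists>x. br (f i) (XL p0 s c) = XL p0 s x" for f and I :: "('r \<times> 'r) set"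
    using that
  proof (induction I rule: infinite_finite_induct)
    case (insert i I)
    obtain x where "br (f i) (XL p0 s c) = XL p0 s x" using insert.prems by blast
    moreover obtain y where "br (sum f I) (XL p0 s c) = XL p0 s y" using insert.IH insert.prems by blast
    ultimately have "br (sum f (insert i I)) (XL p0 s c) = XL p0 s (x + y)"
      using insert by (simp add: L.br_add_left XL_add[OF assms])
    then show ?case by blast
  qed (use XL_0[OF assms] in \<open>auto intro: exI[of _ 0]\<close>)
  have "\<exists>x. br (sm k (lam a b)) (XL p0 s c) = XL p0 s x" for k a b
    using lam_action[OF assms, of a b c] XL_scale[OF assms] by (metis L.br_sm_left)
  then show ?thesis unfolding plin_def by (intro sum) (auto split: prod.splits)
qed

text \<open>Homogeneity of \<open>Lam \<xi>\<close> makes its centraliser closed under brackets, so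
  it suffices to annihilate the generating elements with first index \<open>p0\<close>.\<close>

lemma kernel_central:
  assumes z: "Lam \<xi> \<in> H e" "psi (Lam \<xi>) = 0" and t: "t \<in> lie_terms (sto_generators gr)"
  shows "br (Lam \<xi>) (ev t) = 0"
proof -
  define C where "C d = {x \<in> H d. br (Lam \<xi>) x = 0}" for d
  have "\<exists>x0\<in>C 0. \<exists>x1\<in>C 1. ev t = x0 + x1"
  proof (rule ev_in_K[OF _ _ _ t])
    show "L.subspace (C d)" for d
      by (rule L.subspaceI)
        (auto simp: C_def L.subspace_0 L.subspace_add L.subspace_scale L.H_subspace
          L.br_add_right L.br_sm_right)
    show "br x y \<in> C (d + f)" if "x \<in> C d" "y \<in> C f" for x y d f
      using that L.br_leibniz_right[of "Lam \<xi>" e x d y f] z(1) L.H_br by (simp add: C_def)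
    show "XL p0 s c \<in> C (f + dg s)" if s: "nondeg p0 s" and c: "c \<in> gr f" for s c f
    proof -
      obtain x where x: "br (Lam \<xi>) (XL p0 s c) = XL p0 s x" using Lam_action[OF s] by blast
      have "XM p0 s x = psi (br (Lam \<xi>) (XL p0 s c))" by (simp add: x psi_XL s)
      also have "\<dots> = 0" using z(2) mbr_add(1)[of 0 0] by (simp add: psi_br)
      \<comment> \<open>This entry is x itself, since the reflected position is a different
        one.\<close>
      finally have "XM p0 s x $ p0 $ s = 0" by simp
      then have "x = 0" using s by (auto simp: XM_nth nondeg_def)
      then show ?thesis using x XL_H[OF s c] s by (simp add: C_def XL_0)
    qed
  qed
  then show ?thesis by (auto simp: C_def L.br_add_right)
qed

end

section \<open>Quotient modules\<close>

locale quotient_setup = M: Module.module "base_ring :: 'k::comm_ring_1 ring" M + submodule N base_ring M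
  for M :: "('k::comm_ring_1, 'a, 'z) module_scheme" and N
begin

abbreviation (input) proj :: "'a \<Rightarrow> 'a set" where "proj x \<equiv> N +>\<^bsub>M\<^esub> x"
abbreviation (input) QM :: "('k, 'a set) module" where "QM \<equiv> quotient_module M N"

sublocale N: abelian_subgroup N M
proof (rule abelian_subgroupI3)
  show "additive_subgroup N M"
    by (rule additive_subgroup.intro) unfold_locales
  show "abelian_group M" by (rule M.abelian_group_axioms)
qed

lemma carrier_QM: "carrier QM = proj ` carrier M"
  by (auto simp: quotient_module_def A_RCOSETS_def')

lemma zero_QM: "\<zero>\<^bsub>QM\<^esub> = proj \<zero>\<^bsub>M\<^esub>"
  by (simp add: quotient_module_def M.a_coset_add_zero[OF N.a_subset])

lemma proj_eq_iff: "x \<in> carrier M \<Longrightarrow> y \<in> carrier M \<Longrightarrow> proj x = proj y \<longleftrightarrow> x \<ominus>\<^bsub>M\<^esub> y \<in> N"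
  using N.a_rcos_module[of y x] N.a_repr_independence'[of x y] N.a_rcos_self[of x]
  by (auto simp: a_minus_def)

lemma add_proj: "x \<in> carrier M \<Longrightarrow> y \<in> carrier M \<Longrightarrow> proj x \<oplus>\<^bsub>QM\<^esub> proj y = proj (x \<oplus>\<^bsub>M\<^esub> y)"
  by (simp add: quotient_module_def N.a_rcos_sum)

lemma smult_proj:
  assumes x: "x \<in> carrier M"
  shows "c \<odot>\<^bsub>QM\<^esub> proj x = proj (c \<odot>\<^bsub>M\<^esub> x)"
proof -
  have "proj (c \<odot>\<^bsub>M\<^esub> y) = proj (c \<odot>\<^bsub>M\<^esub> x)" if "y \<in> proj x" for y
  proof -
    have y: "y \<in> carrier M" using that x N.a_elemrcos_carrier by blast
    have "proj y = proj x" using that x N.a_repr_independence' y by metis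
    then have "y \<ominus>\<^bsub>M\<^esub> x \<in> N" using proj_eq_iff x y by blast
    then have "c \<odot>\<^bsub>M\<^esub> (y \<ominus>\<^bsub>M\<^esub> x) \<in> N" by (simp add: smult_closed)
    moreover have "c \<odot>\<^bsub>M\<^esub> (y \<ominus>\<^bsub>M\<^esub> x) = c \<odot>\<^bsub>M\<^esub> y \<ominus>\<^bsub>M\<^esub> c \<odot>\<^bsub>M\<^esub> x"
      using x y M.smult_r_minus[of c x] by (simp add: a_minus_def M.smult_r_distr)
    ultimately show ?thesis using x y proj_eq_iff by simp
  qed
  moreover have "x \<in> proj x" using x N.a_rcos_self by blast
  ultimately have "(\<Union>y\<in>proj x. proj (c \<odot>\<^bsub>M\<^esub> y)) = proj (c \<odot>\<^bsub>M\<^esub> x)" by blast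
  then show ?thesis by (simp add: quotient_module_def)
qed

lemma module_QM: "Module.module base_ring QM"
proof (rule moduleI[OF cring_base_ring])
  show "abelian_group QM"
  proof (rule abelian_groupI)
    fix x assume "x \<in> carrier QM"
    then obtain y where "x = proj y" "y \<in> carrier M" by (auto simp: carrier_QM)
    then show "\<exists>y\<in>carrier QM. y \<oplus>\<^bsub>QM\<^esub> x = \<zero>\<^bsub>QM\<^esub>"
      by (intro bexI[of _ "proj (\<ominus>\<^bsub>M\<^esub> y)"]) (auto simp: carrier_QM add_proj zero_QM M.l_neg)
  qed (auto simp: carrier_QM zero_QM add_proj M.a_ac)
qed (auto simp: carrier_QM add_proj smult_proj M.smult_r_distr
    M.smult_l_distr[simplified] M.smult_assoc1[simplified] M.smult_one[simplified])

end

lemma submodule_span_submodule: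
  assumes "Module.module base_ring M" "S \<subseteq> carrier M"
  shows "submodule (submodule_span M S) base_ring M"
proof -
  interpret Module.module base_ring M by fact
  have sub: "submodule N base_ring M \<Longrightarrow> \<zero>\<^bsub>M\<^esub> \<in> N \<and> N \<subseteq> carrier M \<and> (\<forall>a\<in>N. \<ominus>\<^bsub>M\<^esub> a \<in> N) \<and>
      (\<forall>a\<in>N. \<forall>b\<in>N. a \<oplus>\<^bsub>M\<^esub> b \<in> N) \<and> (\<forall>c. \<forall>a\<in>N. c \<odot>\<^bsub>M\<^esub> a \<in> N)" for N
    using submoduleE[of N] subgroup.one_closed[of N "add_monoid M"]
    by (auto simp: submodule_def submodule_axioms_def)
  have "carrier M \<in> {N. submodule N base_ring M \<and> S \<subseteq> N}"
    using carrier_is_submodule assms(2) by simp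
  then show ?thesis
    unfolding submodule_span_def
    by (intro submoduleI) (use sub in blast)+
qed

lemma submodule_span_least: "submodule N base_ring M \<Longrightarrow> S \<subseteq> N \<Longrightarrow> submodule_span M S \<subseteq> N"
  unfolding submodule_span_def by blast

lemma submodule_span_superset: "S \<subseteq> submodule_span M S"
  unfolding submodule_span_def by blast

section \<open>The skew-dihedral homology module\<close>

lemma free_simps [simp]: "carrier free_module = UNIV" "\<zero>\<^bsub>free_module\<^esub> = 0"
  "x \<oplus>\<^bsub>free_module\<^esub> y = x + y" "c \<odot>\<^bsub>free_module\<^esub> x = pm_scale c x"
  by (simp_all add: free_module_def)

lemma module_free: "Module.module base_ring (free_module :: ('k::comm_ring_1, 'x \<Rightarrow>\<^sub>0 'k) module)"
proof (rule moduleI[OF cring_base_ring])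
  show "abelian_group (free_module :: ('k, 'x \<Rightarrow>\<^sub>0 'k) module)"
    by (rule abelian_groupI) (auto simp: algebra_simps intro: exI[of _ "- _"])
qed (simp_all add: PM.scale_left_distrib PM.scale_right_distrib)

lemma free_inv: "\<ominus>\<^bsub>free_module\<^esub> (x :: 'x \<Rightarrow>\<^sub>0 'k::comm_ring_1) = - x"
proof -
  interpret Module.module base_ring "free_module :: ('k, 'x \<Rightarrow>\<^sub>0 'k) module" by (rule module_free)
  show ?thesis by (rule minus_equality) simp_all
qed

lemma free_minus: "x \<ominus>\<^bsub>free_module\<^esub> y = x - (y :: 'x \<Rightarrow>\<^sub>0 'k::comm_ring_1)"
  by (simp add: a_minus_def free_inv)

lemma submodule_free_iff: "submodule N base_ring (free_module :: ('k::comm_ring_1, 'x \<Rightarrow>\<^sub>0 'k) module) \<longleftrightarrow> PM.subspace N"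
proof -
  interpret Module.module base_ring "free_module :: ('k, 'x \<Rightarrow>\<^sub>0 'k) module" by (rule module_free)
  show ?thesis
  proof
    assume N: "submodule N base_ring (free_module :: ('k, 'x \<Rightarrow>\<^sub>0 'k) module)"
    show "PM.subspace N"
      using submoduleE[OF N] subgroup.one_closed[of N "add_monoid free_module"] N
      by (intro PM.subspaceI) (auto simp: submodule_def submodule_axioms_def)
  next
    assume "PM.subspace N"
    then show "submodule N base_ring (free_module :: ('k, 'x \<Rightarrow>\<^sub>0 'k) module)"
      by (intro submoduleI) (auto simp: free_inv PM.subspace_0 PM.subspace_neg PM.subspace_add PM.subspace_scale)
  qed
qed

lemma submodule_span_free: "submodule_span free_module S = PM.span (S :: ('x \<Rightarrow>\<^sub>0 'k::comm_ring_1) set)"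
proof
  show "submodule_span free_module S \<subseteq> PM.span S"
    by (rule submodule_span_least) (simp_all add: submodule_free_iff PM.span_superset)
  have "PM.subspace (submodule_span free_module S)"
    using submodule_span_submodule[OF module_free, of S] by (simp add: submodule_free_iff)
  then show "PM.span S \<subseteq> submodule_span free_module S"
    by (intro PM.span_minimal submodule_span_superset)
qed

text \<open>Representatives in the free module of the elements spanning the skew-dihedral relations.
  They turn the iterated quotient, first to the tensor square and then to <R,R>, into a single
  one.\<close>

definition hd_relators ::
  "('k::comm_ring_1 \<Rightarrow> 'r::ring_1 \<Rightarrow> 'r) \<Rightarrow> (bit \<Rightarrow> 'r set) \<Rightarrow> ('r \<Rightarrow> 'r) \<Rightarrow> ('r \<times> 'r \<Rightarrow>\<^sub>0 'k) set" where
  "hd_relators scal gr bar =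
    {Poly_Mapping.single (a, b) 1 - Poly_Mapping.single (bar a, bar b) 1 | a b. True}
     \<union> {Poly_Mapping.single (a, b) 1 + pm_scale (koszul (d * e)) (Poly_Mapping.single (b, a) 1)
         | a b d e. a \<in> gr d \<and> b \<in> gr e}
     \<union> {pm_scale (koszul (d * f)) (Poly_Mapping.single (a * b, c) 1)
          + pm_scale (koszul (d * e)) (Poly_Mapping.single (b * c, a) 1)
          + pm_scale (koszul (e * f)) (Poly_Mapping.single (c * a, b) 1)
        | a b c d e f. a \<in> gr d \<and> b \<in> gr e \<and> c \<in> gr f}"

abbreviation all_relators ::
  "('k::comm_ring_1 \<Rightarrow> 'r::ring_1 \<Rightarrow> 'r) \<Rightarrow> (bit \<Rightarrow> 'r set) \<Rightarrow> ('r \<Rightarrow> 'r) \<Rightarrow> ('r \<times> 'r \<Rightarrow>\<^sub>0 'k) set" where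
  "all_relators scal gr bar \<equiv> bilinear_relators scal \<union> hd_relators scal gr bar"

context
  fixes scal :: "'k::comm_ring_1 \<Rightarrow> 'r::ring_1 \<Rightarrow> 'r" and gr :: "bit \<Rightarrow> 'r set" and bar :: "'r \<Rightarrow> 'r"
begin

abbreviation (input) B where "B \<equiv> submodule_span free_module (bilinear_relators scal)"
abbreviation (input) TS where "TS \<equiv> tensor_square scal"
abbreviation (input) RR where "RR \<equiv> skew_dihedral_relations scal gr bar"
abbreviation (input) SP where "SP \<equiv> skew_dihedral_pairing scal gr bar"

definition ten :: "('r \<times> 'r \<Rightarrow>\<^sub>0 'k) \<Rightarrow> ('r \<times> 'r \<Rightarrow>\<^sub>0 'k) set" where
  "ten x = B +>\<^bsub>free_module\<^esub> x"

definition hdclass :: "('r \<times> 'r \<Rightarrow>\<^sub>0 'k) \<Rightarrow> ('r \<times> 'r \<Rightarrow>\<^sub>0 'k) set set" where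
  "hdclass x = RR +>\<^bsub>TS\<^esub> ten x"

interpretation F: Module.module base_ring "free_module :: ('k, 'r \<times> 'r \<Rightarrow>\<^sub>0 'k) module"
  by (rule module_free)

interpretation T: quotient_setup free_module B
  by (intro quotient_setup.intro module_free submodule_span_submodule) simp

lemma TS_module: "Module.module base_ring TS"
  unfolding tensor_square_def by (rule T.module_QM)

interpretation TM: Module.module base_ring TS
  by (rule TS_module)

lemma ten_add: "ten x \<oplus>\<^bsub>TS\<^esub> ten y = ten (x + y)"
  and ten_smult: "c \<odot>\<^bsub>TS\<^esub> ten x = ten (pm_scale c x)"
  and ten_zero: "\<zero>\<^bsub>TS\<^esub> = ten 0"
  and ten_carrier: "carrier TS = range ten"
  and ten_eq_iff: "ten x = ten y \<longleftrightarrow> x - y \<in> PM.span (bilinear_relators scal)"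
  unfolding ten_def tensor_square_def
  using T.add_proj[of x y] T.smult_proj[of x c] T.zero_QM T.carrier_QM T.proj_eq_iff[of x y]
  by (simp_all add: free_minus submodule_span_free)

lemma ten_in [simp]: "ten x \<in> carrier TS"
  by (simp add: ten_carrier)

lemma ten_inv: "\<ominus>\<^bsub>TS\<^esub> ten x = ten (- x)"
  by (rule TM.minus_equality) (simp_all add: ten_add ten_zero)

lemma ten_minus: "ten x \<ominus>\<^bsub>TS\<^esub> ten y = ten (x - y)"
  by (simp add: a_minus_def ten_inv ten_add)

lemma pure_tensor_eq: "pure_tensor scal a b = ten (Poly_Mapping.single (a, b) 1)"
  by (simp add: pure_tensor_def ten_def)

lemma RR_eq: "RR = submodule_span TS (ten ` hd_relators scal gr bar)"
proof -
  have "ten ` hd_relators scal gr bar =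
    {pure_tensor scal a b \<ominus>\<^bsub>TS\<^esub> pure_tensor scal (bar a) (bar b) | a b. True}
     \<union> {pure_tensor scal a b \<oplus>\<^bsub>TS\<^esub> koszul (d * e) \<odot>\<^bsub>TS\<^esub> pure_tensor scal b a | a b d e. a \<in> gr d \<and> b \<in> gr e}
     \<union> {koszul (d * f) \<odot>\<^bsub>TS\<^esub> pure_tensor scal (a * b) c
          \<oplus>\<^bsub>TS\<^esub> koszul (d * e) \<odot>\<^bsub>TS\<^esub> pure_tensor scal (b * c) a
          \<oplus>\<^bsub>TS\<^esub> koszul (e * f) \<odot>\<^bsub>TS\<^esub> pure_tensor scal (c * a) b
        | a b c d e f. a \<in> gr d \<and> b \<in> gr e \<and> c \<in> gr f}"
    unfolding hd_relators_def image_Un pure_tensor_eq ten_add ten_smult ten_minus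
    by (intro arg_cong2[where f = "(\<union>)"]) blast+
  then show ?thesis by (simp add: skew_dihedral_relations_def Let_def)
qed

lemma RR_submodule: "submodule RR base_ring TS"
  unfolding RR_eq by (rule submodule_span_submodule[OF TS_module]) auto

interpretation S: quotient_setup TS RR
  by (intro quotient_setup.intro TS_module RR_submodule)

interpretation SM: Module.module base_ring SP
  unfolding skew_dihedral_pairing_def by (rule S.module_QM)

text \<open>A quotient of a quotient: the preimage of \<open>RR\<close> in the free module is
  spanned by the bilinear and the skew-dihedral relators together.\<close>

lemma ten_in_RR_iff: "ten x \<in> RR \<longleftrightarrow> x \<in> PM.span (all_relators scal gr bar)"
proof
  let ?N = "ten ` PM.span (all_relators scal gr bar)"
  have "submodule ?N base_ring TS"
    by (rule TM.submoduleI)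
      (auto simp: ten_add ten_smult ten_zero ten_inv PM.span_zero PM.span_add PM.span_scale PM.span_neg)
  moreover have "ten ` hd_relators scal gr bar \<subseteq> ?N"
    by (intro image_mono) (auto intro: PM.span_base)
  ultimately have "RR \<subseteq> ?N" unfolding RR_eq by (rule submodule_span_least)
  moreover assume "ten x \<in> RR"
  ultimately obtain y where y: "ten x = ten y" "y \<in> PM.span (all_relators scal gr bar)" by blast
  then have "x - y \<in> PM.span (all_relators scal gr bar)"
    using PM.span_mono[of "bilinear_relators scal" "all_relators scal gr bar"] by (auto simp: ten_eq_iff)
  then show "x \<in> PM.span (all_relators scal gr bar)"
    using PM.span_add[OF _ y(2), of "x - y"] by simp
next
  have sub: "\<zero>\<^bsub>TS\<^esub> \<in> RR" "\<And>a b. a \<in> RR \<Longrightarrow> b \<in> RR \<Longrightarrow> a \<oplus>\<^bsub>TS\<^esub> b \<in> RR"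
    "\<And>c a. a \<in> RR \<Longrightarrow> c \<odot>\<^bsub>TS\<^esub> a \<in> RR"
    using S.N.zero_closed S.N.a_closed S.smult_closed by auto
  have "PM.subspace {x. ten x \<in> RR}"
    using sub by (intro PM.subspaceI) (auto simp flip: ten_add ten_smult ten_zero)
  moreover have "all_relators scal gr bar \<subseteq> {x. ten x \<in> RR}"
  proof
    fix x assume "x \<in> all_relators scal gr bar"
    then consider "x \<in> bilinear_relators scal" | "x \<in> hd_relators scal gr bar" by blast
    then show "x \<in> {x. ten x \<in> RR}"
    proof cases
      case 1
      then have "ten x = ten 0" by (simp add: ten_eq_iff PM.span_base)
      then show ?thesis using sub(1) by (simp add: ten_zero)
    next
      case 2
      then show ?thesis unfolding RR_eq using submodule_span_superset[of "ten ` hd_relators scal gr bar" TS] by blast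
    qed
  qed
  ultimately have "PM.span (all_relators scal gr bar) \<subseteq> {x. ten x \<in> RR}" by (intro PM.span_minimal)
  moreover assume "x \<in> PM.span (all_relators scal gr bar)"
  ultimately show "ten x \<in> RR" by blast
qed

lemma hdclass_add: "hdclass x \<oplus>\<^bsub>SP\<^esub> hdclass y = hdclass (x + y)"
  and hdclass_smult: "c \<odot>\<^bsub>SP\<^esub> hdclass x = hdclass (pm_scale c x)"
  and hdclass_zero: "\<zero>\<^bsub>SP\<^esub> = hdclass 0"
  and hdclass_eq_iff: "hdclass x = hdclass y \<longleftrightarrow> x - y \<in> PM.span (all_relators scal gr bar)"
  unfolding hdclass_def skew_dihedral_pairing_def
  using S.add_proj[of "ten x" "ten y"] S.smult_proj[of "ten x" c] S.zero_QM S.proj_eq_iff[of "ten x" "ten y"]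
  by (simp_all add: ten_add ten_smult ten_zero ten_minus ten_in_RR_iff)

lemma hdclass_carrier: "hdclass x \<in> carrier SP"
  unfolding hdclass_def skew_dihedral_pairing_def using S.carrier_QM by auto

lemma pairing_class_eq: "pairing_class scal gr bar a b = hdclass (Poly_Mapping.single (a, b) 1)"
  by (simp add: pairing_class_def hdclass_def pure_tensor_eq)

lemma finsum_pairing_class:
  "(\<Oplus>\<^bsub>SP\<^esub>i\<in>{..<N::nat}. pairing_class scal gr bar (a i) (b i)) =
    hdclass (\<Sum>i<N. Poly_Mapping.single (a i, b i) 1)"
proof (induction N)
  case 0
  then show ?case by (simp add: hdclass_zero)
next
  case (Suc N)
  have "(\<Oplus>\<^bsub>SP\<^esub>i\<in>insert N {..<N}. pairing_class scal gr bar (a i) (b i)) =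
      pairing_class scal gr bar (a N) (b N) \<oplus>\<^bsub>SP\<^esub> (\<Oplus>\<^bsub>SP\<^esub>i\<in>{..<N}. pairing_class scal gr bar (a i) (b i))"
    by (rule SM.finsum_insert) (auto simp: pairing_class_eq hdclass_carrier)
  then show ?case
    unfolding lessThan_Suc Suc by (simp add: pairing_class_eq hdclass_add)
qed

end

text \<open>The quotients of a free module by all its submodules, in one type.\<close>

definition pointwise_span :: "((('x \<Rightarrow>\<^sub>0 'k::comm_ring_1) set) \<Rightarrow> ('x \<Rightarrow>\<^sub>0 'k)) \<Rightarrow> (('x \<Rightarrow>\<^sub>0 'k) set \<Rightarrow> ('x \<Rightarrow>\<^sub>0 'k)) \<Rightarrow> bool" where
  "pointwise_span f g \<longleftrightarrow> (\<forall>D. f D - g D \<in> PM.span D)"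

lemma span_diff_sym: "x - y \<in> PM.span D \<Longrightarrow> y - x \<in> PM.span D"
  using PM.span_neg by fastforce

lemma span_diff_trans: "x - y \<in> PM.span D \<Longrightarrow> y - z \<in> PM.span D \<Longrightarrow> x - z \<in> PM.span D"
  using PM.span_add[of "x - y" D "y - z"] by simp

quotient_type (overloaded) ('x, 'k) free_quotient =
  "('x \<Rightarrow>\<^sub>0 'k::comm_ring_1) set \<Rightarrow> ('x \<Rightarrow>\<^sub>0 'k)" / pointwise_span
proof (rule equivpI)
  show "reflp pointwise_span" by (simp add: reflp_def pointwise_span_def PM.span_zero)
  show "symp pointwise_span" by (auto simp: symp_def pointwise_span_def intro: span_diff_sym)
  show "transp pointwise_span" unfolding transp_def pointwise_span_def by (blast intro: span_diff_trans)
qed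

instantiation free_quotient :: (type, comm_ring_1) ab_group_add
begin

lift_definition zero_free_quotient :: "('a, 'b) free_quotient" is "\<lambda>_. 0" .

lift_definition plus_free_quotient ::
  "('a, 'b) free_quotient \<Rightarrow> ('a, 'b) free_quotient \<Rightarrow> ('a, 'b) free_quotient" is "\<lambda>f g D. f D + g D"
  unfolding pointwise_span_def using PM.span_add by (fastforce simp: algebra_simps)

lift_definition uminus_free_quotient ::
  "('a, 'b) free_quotient \<Rightarrow> ('a, 'b) free_quotient" is "\<lambda>f D. - f D"
  unfolding pointwise_span_def using span_diff_sym by fastforce

lift_definition minus_free_quotient ::
  "('a, 'b) free_quotient \<Rightarrow> ('a, 'b) free_quotient \<Rightarrow> ('a, 'b) free_quotient" is "\<lambda>f g D. f D - g D"
  unfolding pointwise_span_def using PM.span_diff by (fastforce simp: algebra_simps)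

instance
  by standard (transfer; simp add: pointwise_span_def PM.span_zero algebra_simps)+

end

lift_definition fq_scale :: "'k::comm_ring_1 \<Rightarrow> ('x, 'k) free_quotient \<Rightarrow> ('x, 'k) free_quotient"
  is "\<lambda>c f D. pm_scale c (f D)"
  by (simp add: pointwise_span_def PM.span_scale flip: PM.scale_right_diff_distrib)

text \<open>As in \<open>pclass\<close>, the quotient by the span of \<open>D\<close> occupies one
  coordinate of the product, and 0 is put elsewhere.\<close>

definition fq_class :: "('x \<Rightarrow>\<^sub>0 'k::comm_ring_1) set \<Rightarrow> ('x \<Rightarrow>\<^sub>0 'k) \<Rightarrow> ('x, 'k) free_quotient" where
  "fq_class D x = abs_free_quotient (\<lambda>E. if E = D then x else 0)"

interpretation FQ: Modules.module "fq_scale :: 'k::comm_ring_1 \<Rightarrow> ('x, 'k) free_quotient \<Rightarrow> _"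
  by standard (transfer; simp add: pointwise_span_def PM.span_zero PM.scale_left_distrib PM.scale_right_distrib)+

lemma fq_class_eq_iff: "fq_class D x = fq_class D y \<longleftrightarrow> x - y \<in> PM.span D"
  by (auto simp: fq_class_def free_quotient.abs_eq_iff pointwise_span_def PM.span_zero)

lemma fq_class_add: "fq_class D (x + y) = fq_class D x + fq_class D y"
  by (simp add: fq_class_def plus_free_quotient.abs_eq free_quotient.abs_eq_iff pointwise_span_def PM.span_zero)

lemma fq_class_scale: "fq_class D (pm_scale c x) = fq_scale c (fq_class D x)"
  by (simp add: fq_class_def fq_scale.abs_eq free_quotient.abs_eq_iff pointwise_span_def PM.span_zero)

lemma fq_class_zero: "fq_class D 0 = 0"
  using fq_class_add[of D 0 0] by simp

section \<open>The theorem\<close>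

text \<open>All axioms but one are built into \<open>lie_cong\<close>; uniqueness of the homogeneous
  decomposition depends on the relations and is therefore assumed.\<close>

lemma lie_superalgebra_presented:
  fixes X :: "bit \<Rightarrow> 'x set"
    and Rel :: "(('k::comm_ring_1, 'x) lie_term \<times> ('k, 'x) lie_term) set"
  assumes direct: "pgrade X Rel 0 \<inter> pgrade X Rel 1 \<subseteq> {0}"
  shows "lie_superalgebra (presented_lie_superalgebra X Rel)" (is "lie_superalgebra ?L")
proof -
  interpret P: lie_type psmul pbr "pgrade X Rel" by (rule lie_type_presented)
  note ops = add_presented bracket_presented smult_presented zero_presented carrier_presented
  note pcl = cls_eq_iff pclass_Add pclass_Smul pclass_Br
  note [simp] = homogeneous_in_lie_terms
  have ag: "abelian_group ?L"
  proof (rule abelian_groupI)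
    fix x assume "x \<in> carrier ?L"
    then obtain s where "x = lie_cong X Rel `` {s}" "s \<in> lie_terms X" by (auto simp: ops)
    then show "\<exists>y\<in>carrier ?L. y \<oplus>\<^bsub>?L\<^esub> x = \<zero>\<^bsub>?L\<^esub>"
      by (intro bexI[of _ "lie_cong X Rel `` {Smul (- 1) s}"]) (auto simp: ops pcl del: equalityI)
  qed (auto simp: ops pcl algebra_simps del: equalityI)
  have mod: "Module.module base_ring ?L"
    by (rule moduleI[OF cring_base_ring ag])
      (auto simp: ops pcl presented.scale_left_distrib presented.scale_right_distrib del: equalityI)
  interpret mod: Module.module base_ring ?L by (rule mod)
  have inv: "\<ominus>\<^bsub>?L\<^esub> (lie_cong X Rel `` {s}) = lie_cong X Rel `` {Smul (- 1) s}" if "s \<in> lie_terms X" for s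
    by (rule mod.minus_equality) (use that in \<open>auto simp: ops pcl del: equalityI\<close>)
  have sub: "submodule (grade ?L d) base_ring ?L" for d
  proof (rule mod.submoduleI)
    show "grade ?L d \<subseteq> carrier ?L" by (auto simp: grade_presented ops)
    show "\<zero>\<^bsub>?L\<^esub> \<in> grade ?L d"
      by (auto simp: grade_presented ops intro: homogeneous_term.intros)
    show "\<ominus>\<^bsub>?L\<^esub> a \<in> grade ?L d" if "a \<in> grade ?L d" for a
      using that by (auto simp: grade_presented inv intro!: imageI homogeneous_term.intros)
    show "a \<oplus>\<^bsub>?L\<^esub> b \<in> grade ?L d" if "a \<in> grade ?L d" "b \<in> grade ?L d" for a b
      using that by (auto simp: grade_presented ops intro!: imageI homogeneous_term.intros)
    show "c \<odot>\<^bsub>?L\<^esub> a \<in> grade ?L d" if "a \<in> grade ?L d" for c a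
      using that by (auto simp: grade_presented ops intro!: imageI homogeneous_term.intros)
  qed
  show ?thesis
  proof (intro lie_superalgebra.intro mod lie_superalgebra_axioms.intro sub)
    fix x assume "x \<in> carrier ?L"
    then obtain t where t: "x = lie_cong X Rel `` {t}" "t \<in> lie_terms X" by (auto simp: ops)
    obtain t0 t1 where t01: "homogeneous_term X 0 t0" "homogeneous_term X 1 t1"
      "pclass X Rel t = pclass X Rel t0 + pclass X Rel t1"
      using homogeneous_decomposition[OF t(2), of Rel] by (auto simp: pgrade_def)
    show "\<exists>!(x0, x1). x0 \<in> grade ?L 0 \<and> x1 \<in> grade ?L 1 \<and> x = x0 \<oplus>\<^bsub>?L\<^esub> x1"
    proof (rule ex1I[of _ "(lie_cong X Rel `` {t0}, lie_cong X Rel `` {t1})"])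
      show "case (lie_cong X Rel `` {t0}, lie_cong X Rel `` {t1}) of (x0, x1) \<Rightarrow>
          x0 \<in> grade ?L 0 \<and> x1 \<in> grade ?L 1 \<and> x = x0 \<oplus>\<^bsub>?L\<^esub> x1"
        using t t01 by (auto simp: grade_presented ops pcl del: equalityI)
      fix y assume "case y of (x0, x1) \<Rightarrow> x0 \<in> grade ?L 0 \<and> x1 \<in> grade ?L 1 \<and> x = x0 \<oplus>\<^bsub>?L\<^esub> x1"
      then obtain s0 s1 where s: "homogeneous_term X 0 s0" "homogeneous_term X 1 s1"
          "y = (lie_cong X Rel `` {s0}, lie_cong X Rel `` {s1})"
          "x = lie_cong X Rel `` {s0} \<oplus>\<^bsub>?L\<^esub> lie_cong X Rel `` {s1}"
        by (auto simp: grade_presented)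
      have "pclass X Rel t0 + pclass X Rel t1 = pclass X Rel s0 + pclass X Rel s1"
        using s(1,2,4) t t01 by (simp add: ops pcl)
      \<comment> \<open>The left side is even and the right side odd, so both vanish by
        \<open>direct\<close>.\<close>
      then have e: "pclass X Rel t0 - pclass X Rel s0 = pclass X Rel s1 - pclass X Rel t1"
        by (simp add: algebra_simps)
      have in_gr: "pclass X Rel r \<in> pgrade X Rel d" if "homogeneous_term X d r" for r d
        using that by (auto simp: pgrade_def)
      have "pclass X Rel t0 - pclass X Rel s0 \<in> pgrade X Rel 0 \<inter> pgrade X Rel 1"
        using presented.subspace_diff[OF P.H_subspace in_gr[OF t01(1)] in_gr[OF s(1)]]
          presented.subspace_diff[OF P.H_subspace in_gr[OF s(2)] in_gr[OF t01(2)]] e by simp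
      then have "pclass X Rel t0 - pclass X Rel s0 = 0" using direct by blast
      then show "y = (lie_cong X Rel `` {t0}, lie_cong X Rel `` {t1})"
        using e s t01 by (simp add: pcl)
    qed
  next
    fix x y z d e f assume "x \<in> grade ?L d" "y \<in> grade ?L e" "z \<in> grade ?L f"
    then obtain r s t where rst: "homogeneous_term X d r" "homogeneous_term X e s" "homogeneous_term X f t"
        "x = lie_cong X Rel `` {r}" "y = lie_cong X Rel `` {s}" "z = lie_cong X Rel `` {t}"
      by (auto simp: grade_presented)
    have "pclass X Rel r \<in> pgrade X Rel d" "pclass X Rel s \<in> pgrade X Rel e" "pclass X Rel t \<in> pgrade X Rel f"
      using rst by (auto simp: pgrade_def)
    from P.br_jacobi[OF this] rst
    show "koszul (d * f) \<odot>\<^bsub>?L\<^esub> bracket ?L (bracket ?L x y) z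
      \<oplus>\<^bsub>?L\<^esub> koszul (e * d) \<odot>\<^bsub>?L\<^esub> bracket ?L (bracket ?L y z) x
      \<oplus>\<^bsub>?L\<^esub> koszul (f * e) \<odot>\<^bsub>?L\<^esub> bracket ?L (bracket ?L z x) y = \<zero>\<^bsub>?L\<^esub>"
      by (simp add: ops pcl)
  next
    fix x y d e assume "x \<in> grade ?L d" "y \<in> grade ?L e"
    then obtain r s where rst: "homogeneous_term X d r" "homogeneous_term X e s"
        "x = lie_cong X Rel `` {r}" "y = lie_cong X Rel `` {s}"
      by (auto simp: grade_presented)
    then show "bracket ?L x y \<in> grade ?L (d + e)"
      by (auto simp: ops grade_presented intro!: imageI homogeneous_term.intros)
    have "pclass X Rel r \<in> pgrade X Rel d" "pclass X Rel s \<in> pgrade X Rel e"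
      using rst by (auto simp: pgrade_def)
    from P.br_antisym[OF this] rst
    show "bracket ?L x y = (- koszul (d * e)) \<odot>\<^bsub>?L\<^esub> bracket ?L y x"
      by (simp add: ops pcl)
  qed (auto simp: ops pcl pbr_add_left pbr_add_right pbr_smul_left pbr_smul_right del: equalityI)
qed

lemma lie_type_prod:
  assumes "lie_type s1 b1 H1" "lie_type s2 b2 H2"
  shows "lie_type (\<lambda>c x. (s1 c (fst x), s2 c (snd x)))
    (\<lambda>x y. (b1 (fst x) (fst y), b2 (snd x) (snd y))) (\<lambda>d. H1 d \<times> H2 d)"
proof -
  interpret A: lie_type s1 b1 H1 by fact
  interpret B: lie_type s2 b2 H2 by fact
  have mod: "Modules.module (\<lambda>c x. (s1 c (fst x), s2 c (snd x)))"
    by unfold_locales (simp_all add: A.scale_left_distrib B.scale_left_distrib A.scale_right_distrib B.scale_right_distrib)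
  interpret C: Modules.module "\<lambda>c x. (s1 c (fst x), s2 c (snd x))" by (rule mod)
  show ?thesis
  proof (intro lie_type.intro mod lie_type_axioms.intro)
    fix d show "C.subspace (H1 d \<times> H2 d)"
      by (rule C.subspaceI)
        (auto simp: mem_Times_iff A.H_subspace B.H_subspace A.subspace_0 B.subspace_0 A.subspace_add B.subspace_add
          A.subspace_scale B.subspace_scale)
  next
    fix x y d e assume "x \<in> H1 d \<times> H2 d" "y \<in> H1 e \<times> H2 e"
    then show "(b1 (fst x) (fst y), b2 (snd x) (snd y)) = - sg (d * e) (b1 (fst y) (fst x), b2 (snd y) (snd x))"
      using A.br_antisym[of "fst x" d "fst y" e] B.br_antisym[of "snd x" d "snd y" e]
      by (simp only: prod_eq_iff fst_uminus snd_uminus fst_sg snd_sg fst_conv snd_conv mem_Times_iff)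
  next
    fix x y z d e f assume "x \<in> H1 d \<times> H2 d" "y \<in> H1 e \<times> H2 e" "z \<in> H1 f \<times> H2 f"
    then show "sg (d * f) (b1 (fst (b1 (fst x) (fst y), b2 (snd x) (snd y))) (fst z), b2 (snd (b1 (fst x) (fst y), b2 (snd x) (snd y))) (snd z)) +
       sg (e * d) (b1 (fst (b1 (fst y) (fst z), b2 (snd y) (snd z))) (fst x), b2 (snd (b1 (fst y) (fst z), b2 (snd y) (snd z))) (snd x)) +
       sg (f * e) (b1 (fst (b1 (fst z) (fst x), b2 (snd z) (snd x))) (fst y), b2 (snd (b1 (fst z) (fst x), b2 (snd z) (snd x))) (snd y)) = 0"
      using A.br_jacobi[of "fst x" d "fst y" e "fst z" f] B.br_jacobi[of "snd x" d "snd y" e "snd z" f]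
      by (simp add: prod_eq_iff fst_sg snd_sg mem_Times_iff)
  qed (auto simp: A.br_add_left B.br_add_left A.br_add_right B.br_add_right A.br_sm_left B.br_sm_left
      A.br_sm_right B.br_sm_right A.H_br B.H_br)
qed

lemma homogeneous_Gen:
  "valid_kind q \<Longrightarrow> a \<in> gr e \<Longrightarrow> d = kind_degree q + e \<Longrightarrow> homogeneous_term (sto_generators gr) d (Gen (q, a))"
  by (rule homogeneous_term.intros) (auto simp: sto_generators_def)

lemma homogeneous_Br: "homogeneous_term X d s \<Longrightarrow> homogeneous_term X e t \<Longrightarrow> f = d + e \<Longrightarrow> homogeneous_term X f (Br s t)"
  by (simp add: homogeneous_term.intros)

section \<open>The grading of \<open>sto\<close>, the universal pairing and the concrete
  model\<close>

locale sto_setup = osp_half scal gr bar mn half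
  for scal :: "'k::comm_ring_1 \<Rightarrow> 'r::ring_1 \<Rightarrow> 'r" and gr :: "bit \<Rightarrow> 'r set" and bar :: "'r \<Rightarrow> 'r"
    and mn :: "('m::finite \<times> 'n::finite) itself" and half :: 'k +
  assumes mn_neq: "(CARD('m), CARD('n)) \<noteq> (1, 1)"
begin

abbreviation X :: "bit \<Rightarrow> ('m, 'n, 'r) sto_generator set" where
  "X \<equiv> sto_generators gr"
abbreviation Rel :: "(('k, ('m, 'n, 'r) sto_generator) lie_term \<times> ('k, ('m, 'n, 'r) sto_generator) lie_term) set" where
  "Rel \<equiv> sto_relations scal gr bar"
abbreviation pc :: "('k, ('m, 'n, 'r) sto_generator) lie_term \<Rightarrow> ('k, ('m, 'n, 'r) sto_generator) presented" where
  "pc \<equiv> pclass X Rel"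

text \<open>Besides placing both sides among the admissible terms, this is what makes the parity
  automorphism respect the relations.\<close>

lemma relations_homogeneous:
  assumes "(s, t) \<in> Rel"
  shows "\<exists>d. homogeneous_term X d s \<and> homogeneous_term X d t"
  using assms
  by cases
    (simp_all only:, (rule exI conjI homogeneous_Gen homogeneous_Br homogeneous_term.intros(2-4) gr_mult bar_gr HOL.refl
        subspace_add[OF gr_sub] subspace_scale[OF gr_sub]
      | assumption | (simp add: ac_simps; fail) | (auto; fail))+)

end

lemma lev_prod:
  "lev (\<lambda>c x. (s1 c (fst x), s2 c (snd x))) (\<lambda>x y. (b1 (fst x) (fst y), b2 (snd x) (snd y))) (\<lambda>x. (f x, g x)) t =
    (lev s1 b1 f t, lev s2 b2 g t)"
  by (induction t) (simp_all add: zero_prod_def)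

lemma lev_cong_terms:
  assumes "t \<in> lie_terms X" "\<And>x. x \<in> X 0 \<union> X 1 \<Longrightarrow> f x = g x"
  shows "lev s b f t = lev s b g t"
  using assms(1) by (induction t) (simp_all add: assms(2))

context sto_setup
begin

abbreviation rels :: "('r \<times> 'r \<Rightarrow>\<^sub>0 'k) set" where
  "rels \<equiv> all_relators scal gr bar"

abbreviation pairing :: "'r \<Rightarrow> 'r \<Rightarrow> ('r \<times> 'r, 'k) free_quotient" where
  "pairing a b \<equiv> fq_class rels (Poly_Mapping.single (a, b) 1)"

lemma single_scale: "Poly_Mapping.single x c = pm_scale c (Poly_Mapping.single x (1::'k))"
  by (rule poly_mapping_eqI) (simp add: lookup_single when_def)

text \<open>The universal pairing: a formal combination of pairs has value 0 exactly when it lies in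
  the span of the relators.\<close>

sublocale skew_dihedral_form scal gr bar mn fq_scale pairing
proof
  have eq: "fq_class rels x = fq_class rels y" if "x - y \<in> rels" for x y
    using that by (simp add: fq_class_eq_iff PM.span_base)
  have bil: "fq_class rels x = fq_class rels y" if "x - y \<in> bilinear_relators scal" for x y
    using that by (intro eq) simp
  have hd: "fq_class rels x = 0" if "x \<in> hd_relators scal gr bar" for x
    using eq[of x 0] that by (simp add: fq_class_zero)
  fix a b a' b' c :: 'r and k :: 'k and d e f
  show "pairing (a + a') b = pairing a b + pairing a' b"
    unfolding fq_class_add[symmetric]
    by (rule bil, unfold bilinear_relators_def diff_diff_eq[symmetric]) blast
  show "pairing a (b + b') = pairing a b + pairing a b'"
    unfolding fq_class_add[symmetric]
    by (rule bil, unfold bilinear_relators_def diff_diff_eq[symmetric]) blast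
  show "pairing (scal k a) b = fq_scale k (pairing a b)"
    unfolding fq_class_scale[symmetric] single_scale[symmetric]
    by (rule bil, unfold bilinear_relators_def) blast
  show "pairing a (scal k b) = fq_scale k (pairing a b)"
    unfolding fq_class_scale[symmetric] single_scale[symmetric]
    by (rule bil, unfold bilinear_relators_def) blast
  show "pairing (bar a) (bar b) = pairing a b"
    by (rule eq[symmetric], rule UnI2, unfold hd_relators_def, rule UnI1, rule UnI1) blast
  show "pairing a b = - sg (d * e) (pairing b a)" if "a \<in> gr d" "b \<in> gr e"
  proof -
    have "fq_class rels (Poly_Mapping.single (a, b) 1 + pm_scale (koszul (d * e)) (Poly_Mapping.single (b, a) 1)) = 0"
      by (rule hd, unfold hd_relators_def, rule UnI1, rule UnI2) (use that in blast)
    then show ?thesis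
      by (simp only: fq_class_add fq_class_scale FQ.koszul_scale eq_neg_iff_add_eq_0)
  qed
  show "sg (d * f) (pairing (a * b) c) + sg (d * e) (pairing (b * c) a) + sg (e * f) (pairing (c * a) b) = 0"
    if "a \<in> gr d" "b \<in> gr e" "c \<in> gr f"
  proof -
    have "fq_class rels (pm_scale (koszul (d * f)) (Poly_Mapping.single (a * b, c) 1)
          + pm_scale (koszul (d * e)) (Poly_Mapping.single (b * c, a) 1)
          + pm_scale (koszul (e * f)) (Poly_Mapping.single (c * a, b) 1)) = 0"
      by (rule hd, unfold hd_relators_def, rule UnI2) (use that in blast)
    then show ?thesis
      by (simp only: fq_class_add fq_class_scale FQ.koszul_scale)
  qed
qed

lemma X_D: "x \<in> X 0 \<union> X 1 \<longleftrightarrow> valid_kind (fst x) \<and> (\<exists>e. snd x \<in> gr e)"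
proof -
  have "x \<in> X (kind_degree (fst x) + e)" if "valid_kind (fst x)" "snd x \<in> gr e" for e
    using that by (cases x) (auto simp: sto_generators_def)
  moreover have "x \<in> X d \<Longrightarrow> x \<in> X 0 \<union> X 1" for d by (cases "d = 0") auto
  ultimately have "valid_kind (fst x) \<and> (\<exists>e. snd x \<in> gr e) \<Longrightarrow> x \<in> X 0 \<union> X 1" by blast
  then show ?thesis by (auto simp: sto_generators_def)
qed

lemma pc_linear:
  assumes "valid_kind q" "a \<in> gr d" "b \<in> gr d"
  shows "pc (Gen (q, scal k a + scal k' b)) = psmul k (pc (Gen (q, a))) + psmul k' (pc (Gen (q, b)))"
proof -
  have g: "(Gen (q, c) :: ('k, ('m, 'n, 'r) sto_generator) lie_term) \<in> lie_terms X" if "c \<in> gr d" for c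
    using that assms(1) X_D[of "(q, c)"] by auto
  have ab: "scal k a + scal k' b \<in> gr d" using assms by (simp add: gr_sub subspace_add subspace_scale)
  have "pc (Gen (q, scal k a + scal k' b)) = pc (Add (Smul k (Gen (q, a))) (Smul k' (Gen (q, b))))"
    using g[OF ab] g[OF assms(2)] g[OF assms(3)]
    by (subst pclass_eq_iff) (auto intro!: lie_cong.rel sto_relations.linear assms simp del: Gen_in_lie_terms)
  then show ?thesis
    using g[OF assms(2)] g[OF assms(3)] by (simp add: pclass_Add pclass_Smul del: Gen_in_lie_terms)
qed

lemma pc_add: "valid_kind q \<Longrightarrow> a \<in> gr d \<Longrightarrow> b \<in> gr d \<Longrightarrow> pc (Gen (q, a + b)) = pc (Gen (q, a)) + pc (Gen (q, b))"
  using pc_linear[of q a d b 1 1] by simp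

lemma pc_scale: "valid_kind q \<Longrightarrow> a \<in> gr d \<Longrightarrow> pc (Gen (q, scal k a)) = psmul k (pc (Gen (q, a)))"
  using pc_linear[of q a d a k 0] by simp

text \<open>A pair with inhomogeneous coefficient is not a generator, and \<open>pc\<close> would
  send it to 0; the sum over components is the linear extension that \<open>sto_model\<close> asks
  for.\<close>

definition GG :: "('m, 'n) kind \<Rightarrow> 'r \<Rightarrow> ('k, ('m, 'n, 'r) sto_generator) presented" where
  "GG q a = pc (Gen (q, component gr 0 a)) + pc (Gen (q, component gr 1 a))"

lemma GG_add: "valid_kind q \<Longrightarrow> GG q (a + b) = GG q a + GG q b"
  using pc_add[of q "component gr 0 a" 0 "component gr 0 b"] pc_add[of q "component gr 1 a" 1 "component gr 1 b"]
  by (simp add: GG_def component_add)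

lemma GG_scale: "valid_kind q \<Longrightarrow> GG q (scal k a) = psmul k (GG q a)"
  using pc_scale[of q "component gr 0 a" 0 k] pc_scale[of q "component gr 1 a" 1 k]
  by (simp add: GG_def component_scale presented.scale_right_distrib)

lemma GG_homog: "valid_kind q \<Longrightarrow> a \<in> gr d \<Longrightarrow> GG q a = pc (Gen (q, a))"
proof -
  assume q: "valid_kind q" and a: "a \<in> gr d"
  have "pc (Gen (q, 0)) = 0" using pc_scale[OF q a, of 0] by simp
  then show ?thesis by (cases "d = 0") (use a in \<open>simp_all add: GG_def component_homog[OF a]\<close>)
qed

lemma GG_grade: "valid_kind q \<Longrightarrow> a \<in> gr d \<Longrightarrow> GG q a \<in> pgrade X Rel (kind_degree q + d)"
  by (auto simp: GG_homog pgrade_def intro!: imageI homogeneous_Gen)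

lemma lev_GG: "t \<in> lie_terms X \<Longrightarrow> lev psmul pbr (\<lambda>x. GG (fst x) (snd x)) t = pc t"
  unfolding pclass_eq_lev by (rule lev_cong_terms) (auto simp: sto_generators_def GG_homog)

text \<open>The parity automorphism separates the even from the odd elements.\<close>

lemma pgrade_direct: "pgrade X Rel 0 \<inter> pgrade X Rel 1 \<subseteq> {0}"
proof
  fix x assume x: "x \<in> pgrade X Rel 0 \<inter> pgrade X Rel 1"
  interpret P: lie_type psmul pbr "pgrade X Rel" by (rule lie_type_presented)
  \<comment> \<open>On a generator of degree d this is (-1)^d times its class. The formula itself
    avoids d because generators with coefficient 0 have both degrees.\<close>
  define \<theta> where "\<theta> x = sg (kind_degree (fst x)) (GG (fst x) (rho gr (snd x)))" for x
  have th: "\<theta> x = sg d (pc (Gen x))" if "x \<in> X d" for x d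
  proof -
    obtain q a e where xqa: "x = (q, a)" by (cases x)
    with that obtain e where v: "valid_kind q" "a \<in> gr e" "d = kind_degree q + e" by (auto simp: sto_generators_def)
    have "GG q (sg e a) = sg e (GG q a)" by (rule additive_sg) (rule GG_add[OF v(1)])
    then show ?thesis using v by (simp add: \<theta>_def xqa rho_homog[OF v(2)] GG_homog)
  qed
  have hom: "lev psmul pbr \<theta> s = sg d (pc s)" if "homogeneous_term X d s" for s d
    using that
  proof induction
    case (5 d s e t)
    then show ?case
      by (simp add: pclass_Br homogeneous_in_lie_terms P.br_sg_left P.br_sg_right add.commute)
  qed (auto simp: th pclass_Add pclass_Smul homogeneous_in_lie_terms sg_add presented.scale_sg)
  obtain s t where st: "homogeneous_term X 0 s" "homogeneous_term X 1 t" "x = pc s" "x = pc t"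
    using x by (auto simp: pgrade_def)
  have "(s, t) \<in> lie_cong X Rel"
    using st pclass_eq_iff[of s X t Rel] homogeneous_in_lie_terms by metis
  then have "lev psmul pbr \<theta> s = lev psmul pbr \<theta> t"
  proof (rule P.lev_cong[rotated 2])
    show "\<theta> y \<in> pgrade X Rel d" if "y \<in> X d" for y d
      using that th[OF that] by (auto simp: pgrade_def intro!: P.H_sg[unfolded pgrade_def] homogeneous_term.intros)
    show "lev psmul pbr \<theta> u = lev psmul pbr \<theta> v" if "(u, v) \<in> Rel" for u v
    proof -
      obtain d where d: "homogeneous_term X d u" "homogeneous_term X d v" using relations_homogeneous \<open>(u, v) \<in> Rel\<close> by blast
      have "pc u = pc v"
        using d that by (subst pclass_eq_iff) (auto intro: lie_cong.rel homogeneous_in_lie_terms)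
      then show ?thesis using hom d by metis
    qed
  qed
  \<comment> \<open>The parity automorphism fixes x as an even element and negates it as an odd one;
    invertibility of 2 then gives x = 0.\<close>
  then have "x = - x" using hom[OF st(1)] hom[OF st(2)] st(3,4) by simp
  then have "x + x = 0" by (metis add.right_inverse)
  then have "psmul half x + psmul half x = 0" by (metis presented.scale_right_distrib presented.scale_zero_right)
  then show "x \<in> {0}" by (simp add: half flip: presented.scale_left_distrib)
qed

lemma sto_lie_superalgebra: "lie_superalgebra (sto scal gr bar :: ('k, ('k, ('m, 'n, 'r) sto_generator) lie_term set) lie_super)"
  unfolding sto_def by (rule lie_superalgebra_presented) (rule pgrade_direct)

text \<open>The model: \<open>sto\<close> together with its evaluation in the central extension of the matrices by
  the cocycle, so that \<open>psi\<close> and the detecting map \<open>chi\<close> become projections.\<close>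

abbreviation Lsm where "Lsm \<equiv> \<lambda>c x. (psmul c (fst x), mqs c (snd x))"
abbreviation Lbr where "Lbr \<equiv> \<lambda>x y. (pbr (fst x) (fst y), mqbr (snd x) (snd y))"
abbreviation Lgen where "Lgen \<equiv> \<lambda>q a. (GG q a, XM (row_index q) (col_index q) a, 0 :: ('r \<times> 'r, 'k) free_quotient)"
abbreviation LH where "LH \<equiv> \<lambda>d. pgrade X Rel d \<times> (mg d \<times> UNIV)"

abbreviation mq :: "('k, ('m, 'n, 'r) sto_generator) lie_term \<Rightarrow> ('m, 'n, 'r) smatrix \<times> ('r \<times> 'r, 'k) free_quotient" where
  "mq \<equiv> lev mqs mqbr gmq"

lemma gmq_eq: "gmq x = (XM (row_index (fst x)) (col_index (fst x)) (snd x), 0)"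
  by (simp add: gmq_def osp_element_eq)

lemma lev_Lgen: "lev Lsm Lbr (\<lambda>x. Lgen (fst x) (snd x)) t = (lev psmul pbr (\<lambda>x. GG (fst x) (snd x)) t, mq t)"
  unfolding lev_prod[of psmul mqs pbr mqbr "\<lambda>x. GG (fst x) (snd x)"] gmq_eq[abs_def] ..

sublocale C: sto_cover scal gr bar mn half Lsm Lbr LH Lgen fq_scale pairing "\<lambda>x. fst (snd x)" "\<lambda>x. snd (snd x)"
proof -
  interpret L: lie_type Lsm Lbr LH
    by (rule lie_type_prod[OF lie_type_presented MQ.lie_type_axioms])
  show "sto_cover scal gr bar half Lsm Lbr LH Lgen fq_scale pairing (\<lambda>x. fst (snd x)) (\<lambda>x. snd (snd x))"
  proof unfold_locales
    fix q :: "('m, 'n) kind" and a b :: 'r and k :: 'k and d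
    assume q: "valid_kind q"
    show "Lgen q (a + b) = Lgen q a + Lgen q b"
      by (simp add: GG_add q XM_add)
    show "Lgen q (scal k a) = Lsm k (Lgen q a)"
      by (simp add: GG_scale q XM_ms mqs_def)
    show "Lgen q a \<in> LH (kind_degree q + d)" if "a \<in> gr d"
      using GG_grade[OF q that] gmq_homogeneous[of "(q, a)" "kind_degree q + d"] q that
      by (auto simp: sto_generators_def gmq_eq)
    show "fst (snd (Lgen q a)) = XM (row_index q) (col_index q) a"
      by simp
  next
    fix s t assume st: "(s, t) \<in> Rel"
    then obtain d where d: "homogeneous_term X d s" "homogeneous_term X d t" using relations_homogeneous by blast
    then have "s \<in> lie_terms X" "t \<in> lie_terms X" using homogeneous_in_lie_terms by blast+
    moreover from this have "pc s = pc t" using st by (simp add: pclass_eq_iff lie_cong.rel)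
    ultimately show "lev Lsm Lbr (\<lambda>x. Lgen (fst x) (snd x)) s = lev Lsm Lbr (\<lambda>x. Lgen (fst x) (snd x)) t"
      unfolding lev_Lgen using gmq_relations[OF st] by (simp add: lev_GG)
  next
    show "(CARD('m), CARD('n)) \<noteq> (1, 1)" by (rule mn_neq)
  qed (simp_all add: mqs_def mqbr_def)
qed

end

lemma poly_mapping_sum_monomials:
  "(\<Sum>x\<in>Poly_Mapping.keys p. Poly_Mapping.single x (Poly_Mapping.lookup p x)) = p"
proof (rule poly_mapping_eqI)
  fix y
  have "Poly_Mapping.lookup (\<Sum>x\<in>Poly_Mapping.keys p. Poly_Mapping.single x (Poly_Mapping.lookup p x)) y =
      (\<Sum>x\<in>Poly_Mapping.keys p. if x = y then Poly_Mapping.lookup p x else 0)"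
    by (simp add: lookup_sum lookup_single when_def)
  then show "Poly_Mapping.lookup (\<Sum>x\<in>Poly_Mapping.keys p. Poly_Mapping.single x (Poly_Mapping.lookup p x)) y =
      Poly_Mapping.lookup p y"
    by (simp add: in_keys_iff)
qed

lemma (in sto_model) XL_eq_gen:
  assumes "nondeg p q"
  obtains r b x where "valid_kind r" "XL p q a = sg x (gen r b)"
proof -
  have pos: "\<exists>r'. valid_kind r' \<and> (\<exists>b' x. gen r b = sg x (gen r' b'))" if "valid_kind r" for r b
    using that by (metis sg_0)
  have neg: "\<exists>r'. valid_kind r' \<and> (\<exists>b' x. - gen r b = sg x (gen r' b'))" if "valid_kind r" for r b
    using that by (metis sg_1)
  have "\<exists>r. valid_kind r \<and> (\<exists>b x. XL p q a = sg x (gen r b))"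
    using assms
    by (cases p rule: index_cases; cases q rule: index_cases) (auto simp: XL_def nondeg_def intro!: pos neg)
  then show ?thesis using that by blast
qed

section \<open>The linear map sending <a,b> to \<open>lam a b\<close>\<close>

context sto_model
begin

lemma Lam_bilinear: "x \<in> bilinear_relators scal \<Longrightarrow> plin sm (\<lambda>(a, b). lam a b) x = 0"
  unfolding bilinear_relators_def
  by (elim UnE CollectE exE conjE; simp only: L.plin_diff L.plin_single split lam_add lam_scale L.scale_one)
    (simp_all add: algebra_simps)

lemma Lam_hd:
  assumes "x \<in> hd_relators scal gr bar"
  shows "plin sm (\<lambda>(a, b). lam a b) x = 0"
proof -
  let ?Lam = "plin sm (\<lambda>(a, b). lam a b)"
  have 1: "?Lam (Poly_Mapping.single (a, b) 1 - Poly_Mapping.single (bar a, bar b) 1) = 0" for a b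
    by (simp only: L.plin_diff L.plin_single split L.scale_one lam_bar diff_self)
  have 2: "?Lam (Poly_Mapping.single (a, b) 1 + pm_scale (koszul (d * e)) (Poly_Mapping.single (b, a) 1)) = 0"
    if "a \<in> gr d" "b \<in> gr e" for a b d e
    using lam_skew[OF that]
    by (simp only: L.plin_add L.plin_scale L.plin_single split L.scale_one L.koszul_scale add.left_inverse)
  have 3: "?Lam (pm_scale (koszul (d * f)) (Poly_Mapping.single (a * b, c) 1)
        + pm_scale (koszul (d * e)) (Poly_Mapping.single (b * c, a) 1)
        + pm_scale (koszul (e * f)) (Poly_Mapping.single (c * a, b) 1)) = 0"
    if "a \<in> gr d" "b \<in> gr e" "c \<in> gr f" for a b c d e f
    using lam_cyclic[OF that]
    by (simp only: L.plin_add L.plin_scale L.plin_single split L.scale_one L.koszul_scale)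
  from assms show ?thesis
    unfolding hd_relators_def
  proof (elim UnE CollectE exE conjE)
    fix a b assume "x = Poly_Mapping.single (a, b) 1 - Poly_Mapping.single (bar a, bar b) 1"
    then show ?thesis using 1 by (simp only:)
  next
    fix a b d e assume "x = Poly_Mapping.single (a, b) 1 + pm_scale (koszul (d * e)) (Poly_Mapping.single (b, a) 1)"
      "a \<in> gr d" "b \<in> gr e"
    then show ?thesis using 2 by (simp only:)
  next
    fix a b c d e f assume "x = pm_scale (koszul (d * f)) (Poly_Mapping.single (a * b, c) 1)
        + pm_scale (koszul (d * e)) (Poly_Mapping.single (b * c, a) 1)
        + pm_scale (koszul (e * f)) (Poly_Mapping.single (c * a, b) 1)" "a \<in> gr d" "b \<in> gr e" "c \<in> gr f"
    then show ?thesis using 3 by (simp only:)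
  qed
qed

text \<open>Sending <a,b> to \<open>lam a b\<close> is thus well defined on <R,R>; this is the upper
  bound on the kernel of psi.\<close>

lemma Lam_relators:
  assumes "\<xi> \<in> PM.span (all_relators scal gr bar)"
  shows "plin sm (\<lambda>(a, b). lam a b) \<xi> = 0"
  using assms
proof (induction rule: PM.span_induct_alt)
  case base show ?case by (rule L.plin_zero)
next
  case (step c x y)
  then have "plin sm (\<lambda>(a, b). lam a b) x = 0" using Lam_bilinear Lam_hd by blast
  then show ?case using step(2) by (simp only: L.plin_add L.plin_scale L.scale_zero_right add_0)
qed

end

section \<open>Return from the model to \<open>sto\<close>, \<open>osp\<close> and the homology
  module\<close>

context sto_setup
begin

abbreviation LT :: "('k, ('m, 'n, 'r) sto_generator) lie_term set" where
  "LT \<equiv> lie_terms X"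
abbreviation cl :: "('k, ('m, 'n, 'r) sto_generator) lie_term \<Rightarrow> ('k, ('m, 'n, 'r) sto_generator) lie_term set" where
  "cl t \<equiv> lie_cong X Rel `` {t}"
abbreviation sto' :: "('k, ('k, ('m, 'n, 'r) sto_generator) lie_term set) lie_super" where
  "sto' \<equiv> sto scal gr bar"
abbreviation osp' :: "('k, ('m, 'n, 'r) smatrix) lie_super" where
  "osp' \<equiv> osp scal gr bar"

lemmas sto_ops = add_presented[where X = X and Rel = Rel, folded sto_def]
  bracket_presented[where X = X and Rel = Rel, folded sto_def]
  smult_presented[where X = X and Rel = Rel, folded sto_def]
  zero_presented[where X = X and Rel = Rel, folded sto_def]
  carrier_presented[where X = X and Rel = Rel, folded sto_def]
  grade_presented[where X = X and Rel = Rel, folded sto_def]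

lemma osp_ops [simp]: "carrier osp' = osp_carrier scal gr bar" "\<zero>\<^bsub>osp'\<^esub> = 0" "x \<oplus>\<^bsub>osp'\<^esub> y = x + y"
  "c \<odot>\<^bsub>osp'\<^esub> x = ms c x" "bracket osp' x y = mbr x y" "grade osp' d = osp_carrier scal gr bar \<inter> mg d"
  by (simp_all add: osp_def)

lemma cl_eq_iff: "s \<in> LT \<Longrightarrow> t \<in> LT \<Longrightarrow> cl s = cl t \<longleftrightarrow> pc s = pc t"
  by (rule cls_eq_iff)

lemma ev_eq: "t \<in> LT \<Longrightarrow> C.ev t = (pc t, mq t)"
  unfolding lev_Lgen by (simp add: lev_GG)

lemma mq_cong: "(s, t) \<in> lie_cong X Rel \<Longrightarrow> mq s = mq t"
  by (rule MQ.lev_cong[OF gmq_homogeneous gmq_relations])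

lemma mq_homogeneous: "homogeneous_term X d t \<Longrightarrow> mq t \<in> mg d \<times> UNIV"
  by (rule MQ.lev_homogeneous[OF gmq_homogeneous])

lemma mq_in_osp: "t \<in> LT \<Longrightarrow> fst (mq t) \<in> osp_carrier scal gr bar"
proof (induction t)
  case (Gen x)
  then have "valid_kind (fst x)" unfolding Gen_in_lie_terms X_D by blast
  then show ?case
    using XM_in_osp_carrier[OF mn_neq, of "col_index (fst x)" "row_index (fst x)"] C.valid_nondeg
    by (simp add: gmq_def osp_element_eq C.nondeg_def)
next
  case (Br s t)
  then show ?case using osp_carrier_subset by (auto simp: mqbr_def intro!: mbr_in_osp_carrier)
qed (simp_all add: M.subspace_0[OF osp_carrier_subspace] M.subspace_add[OF osp_carrier_subspace]
    M.subspace_scale[OF osp_carrier_subspace] mqs_def)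

text \<open>Evaluation of a representative in the matrix part of the model; \<open>mq_cong\<close>
  makes it independent of the representative.\<close>

lemma canonical_hom_exists: "\<exists>\<psi> :: ('k, ('m, 'n, 'r) sto_generator) lie_term set \<Rightarrow> ('m, 'n, 'r) smatrix.
    canonical_hom scal gr bar \<psi>"
proof
  define \<psi> where "\<psi> A = fst (mq (SOME t. t \<in> A))" for A
  have \<psi>: "\<psi> (cl t) = fst (mq t)" if "t \<in> LT" for t
  proof -
    have "(SOME s. s \<in> cl t) \<in> cl t"
      using lie_cong.refl[OF that] by (intro someI[of "\<lambda>s. s \<in> cl t" t]) simp
    then show ?thesis unfolding \<psi>_def using mq_cong by fastforce
  qed
  have "lie_super_hom sto' osp' \<psi>"
    unfolding lie_super_hom_def
  proof (intro conjI ballI allI)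
    fix x d assume "x \<in> grade sto' d"
    then obtain t where t: "x = cl t" "homogeneous_term X d t" by (auto simp: sto_ops)
    have "mq t \<in> mg d \<times> UNIV" by (rule mq_homogeneous[OF t(2)])
    then show "\<psi> x \<in> grade osp' d"
      using t mq_in_osp[of t] by (auto simp: \<psi> homogeneous_in_lie_terms)
  qed (auto simp: sto_ops \<psi> mq_in_osp mqs_def mqbr_def)
  moreover have "\<psi> (sto_element scal gr bar x) = osp_element gr bar x" if "x \<in> X d" for x d
  proof -
    have "Gen x \<in> LT" using that by (cases "d = 0") auto
    then show ?thesis using \<psi>[of "Gen x"] by (simp add: sto_element_def gmq_def del: Gen_in_lie_terms)
  qed
  ultimately show "canonical_hom scal gr bar \<psi>" by (simp add: canonical_hom_def)
qed

text \<open>The type of the model is larger than \<open>sto\<close>, so \<open>lam a b\<close> has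
  to be exhibited as the value of a term. The range of evaluation is closed under the operations and
  contains every X_pq.\<close>

lemma lam_in_range: "\<exists>t\<in>LT. C.ev t = C.lam a b"
proof -
  let ?R = "C.ev ` LT"
  have zero: "0 \<in> ?R" by (auto intro!: image_eqI[of _ _ Zero])
  have add: "x + y \<in> ?R" if "x \<in> ?R" "y \<in> ?R" for x y
    using that by (auto intro!: image_eqI[of _ _ "Add _ _"])
  have sm: "Lsm c x \<in> ?R" if "x \<in> ?R" for x c
    using that by (auto intro!: image_eqI[of _ _ "Smul _ _"])
  have br: "Lbr x y \<in> ?R" if "x \<in> ?R" "y \<in> ?R" for x y
    using that by (auto intro!: image_eqI[of _ _ "Br _ _"])
  have neg: "- x \<in> ?R" if "x \<in> ?R" for x
    using sm[OF that, of "- 1"] C.L.scale_minus_left[of 1 x] C.L.scale_one[of x] by simp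
  have gen_h: "Lgen q a \<in> ?R" if "valid_kind q" "a \<in> gr d" for q a d
  proof -
    have "Gen (q, a) \<in> LT" unfolding Gen_in_lie_terms X_D using that by auto
    then show ?thesis by (intro image_eqI[of _ _ "Gen (q, a)"]) auto
  qed
  have gen: "Lgen q a \<in> ?R" if "valid_kind q" for q a
  proof (induction a rule: homogeneous_induct)
    case (1 d x) then show ?case using gen_h that by blast
  next
    case (2 x y)
    have "Lgen q (x + y) = Lgen q x + Lgen q y" by (rule C.gen_add[OF that])
    then show ?case using add[OF 2] by (simp only:)
  qed
  have XL: "C.XL p q a \<in> ?R" if nd: "C.nondeg p q" for p q a
  proof -
    have sg: "sg x y \<in> ?R" if "y \<in> ?R" for x y
    proof (cases "x = 1")
      case True show ?thesis unfolding sg_def if_P[OF True] by (rule neg[OF that])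
    next
      case False show ?thesis unfolding sg_def if_not_P[OF False] by (rule that)
    qed
    obtain r b x where r: "valid_kind r" "C.XL p q a = sg x (Lgen r b)" by (rule C.XL_eq_gen[OF nd])
    show ?thesis unfolding r(2) by (rule sg[OF gen[OF r(1)]])
  qed
  have hh: "C.hh C.p0 C.q0 c d \<in> ?R" for c d
    unfolding C.hh_def using C.nondeg_p0_q0 C.nondeg_sym by (intro br XL) blast+
  have "C.lam a b = C.hh C.p0 C.q0 a b + - C.et C.q0 (a * b - ring_scomm gr a b)"
    by (simp add: C.lam_def)
  then have "C.lam a b \<in> ?R"
    unfolding C.et_def by (simp only: add[OF hh neg[OF hh]])
  then obtain t where t: "C.lam a b = C.ev t" "t \<in> LT" by (rule imageE)
  then show ?thesis by (intro bexI[OF _ t(2)]) (rule t(1)[symmetric])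
qed

lemma Lam_in_range: "\<exists>t\<in>LT. C.ev t = C.Lam \<xi>"
proof -
  have "\<exists>t\<in>LT. C.ev t = (\<Sum>x\<in>I. Lsm (f x) (case x of (a, b) \<Rightarrow> C.lam a b))" if "finite I" for I f
    using that
  proof induction
    case empty
    then show ?case by (intro bexI[of _ Zero]) auto
  next
    case (insert x I)
    then obtain t where t: "t \<in> LT" "C.ev t = (\<Sum>x\<in>I. Lsm (f x) (case x of (a, b) \<Rightarrow> C.lam a b))" by blast
    obtain s where s: "s \<in> LT" "C.ev s = (case x of (a, b) \<Rightarrow> C.lam a b)"
      using lam_in_range by (cases x) auto
    have "C.ev (Add (Smul (f x) s) t) = (\<Sum>x\<in>insert x I. Lsm (f x) (case x of (a, b) \<Rightarrow> C.lam a b))"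
      unfolding sum.insert[OF insert.hyps] using s t by simp
    then show ?case using s t by (intro bexI[of _ "Add (Smul (f x) s) t"]) auto
  qed
  then show ?thesis unfolding plin_def by simp
qed

lemma fq_plin: "plin fq_scale (\<lambda>(a, b). pairing a b) \<xi> = fq_class rels \<xi>"
proof -
  have "fq_class rels (plin pm_scale (\<lambda>x. Poly_Mapping.single x 1) \<xi>) =
      plin fq_scale (\<lambda>x. fq_class rels (Poly_Mapping.single x 1)) \<xi>"
    by (rule plin_hom) (simp_all add: fq_class_add fq_class_scale)
  moreover have "plin pm_scale (\<lambda>x. Poly_Mapping.single x 1) \<xi> = \<xi>"
    unfolding plin_def by (simp add: poly_mapping_sum_monomials flip: single_scale)
  ultimately show ?thesis by (simp add: case_prod_unfold)
qed

text \<open>Relators are killed by \<open>Lam_relators\<close>. Conversely the detecting map takes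
  \<open>Lam \<xi>\<close> to twice the class of \<open>\<xi>\<close> in the universal pairing, and
  2 is invertible.\<close>

lemma Lam_eq_iff: "C.Lam \<xi> = C.Lam \<eta> \<longleftrightarrow> \<xi> - \<eta> \<in> PM.span rels"
proof
  assume "C.Lam \<xi> = C.Lam \<eta>"
  then have "snd (snd (C.Lam (\<xi> - \<eta>))) = 0" by (simp add: C.L.plin_diff)
  then have "fq_class rels (\<xi> - \<eta>) + fq_class rels (\<xi> - \<eta>) = 0"
    unfolding C.chi_Lam fq_plin .
  then have "fq_scale half (fq_class rels (\<xi> - \<eta>)) + fq_scale half (fq_class rels (\<xi> - \<eta>)) = 0"
    by (metis FQ.scale_right_distrib FQ.scale_zero_right)
  then have "fq_class rels (\<xi> - \<eta>) = fq_class rels 0"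
    by (simp add: half fq_class_zero flip: FQ.scale_left_distrib)
  then show "\<xi> - \<eta> \<in> PM.span rels" by (simp add: fq_class_eq_iff)
next
  assume "\<xi> - \<eta> \<in> PM.span rels"
  then have "C.Lam (\<xi> - \<eta>) = 0" by (rule C.Lam_relators)
  then show "C.Lam \<xi> = C.Lam \<eta>" by (simp only: C.L.plin_diff right_minus_eq)
qed

text \<open>The homology module consists of sums of classes <a_i,b_i> without coefficients. Modulo
  the relators every formal combination has this shape: coefficients are absorbed into the first
  argument, which leaves the sum of supercommutators unchanged.\<close>

lemma hd_carrier:
  "carrier (skew_dihedral_HD1 scal gr bar) =
    hdclass scal gr bar ` {\<xi>. plin scal (\<lambda>(a, b). ring_scomm gr a b) \<xi> = bar (plin scal (\<lambda>(a, b). ring_scomm gr a b) \<xi>)}"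
    (is "_ = hdclass scal gr bar ` {\<xi>. ?s \<xi> = bar (?s \<xi>)}")
proof -
  have s: "?s (\<Sum>i<N. Poly_Mapping.single (a i, b i) 1) = (\<Sum>i<N. ring_scomm gr (a i) (b i))" for N :: nat and a b
    by (simp add: plin_sum)
  have c: "carrier (skew_dihedral_HD1 scal gr bar) =
    {hdclass scal gr bar (\<Sum>i<N. Poly_Mapping.single (a i, b i) 1) | (N::nat) a b.
       (\<Sum>i<N. ring_scomm gr (a i) (b i)) = (\<Sum>i<N. bar (ring_scomm gr (a i) (b i)))}"
    by (simp add: skew_dihedral_HD1_def finsum_pairing_class)
  have norm: "\<exists>(N::nat) a b. \<xi> - (\<Sum>i<N. Poly_Mapping.single (a i, b i) 1) \<in> PM.span rels \<and>
      ?s \<xi> = (\<Sum>i<N. ring_scomm gr (a i) (b i))" for \<xi>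
  proof -
    let ?K = "Poly_Mapping.keys \<xi>" and ?c = "Poly_Mapping.lookup \<xi>"
    obtain h where h: "bij_betw h {..<card ?K} ?K"
      using ex_bij_betw_nat_finite[of ?K] by (auto simp: atLeast0LessThan)
    let ?a = "\<lambda>i. scal (?c (h i)) (fst (h i))" and ?b = "\<lambda>i. snd (h i)"
    have e1: "\<xi> = (\<Sum>i<card ?K. Poly_Mapping.single (h i) (?c (h i)))"
      unfolding sum.reindex_bij_betw[OF h, of "\<lambda>x. Poly_Mapping.single x (?c x)"]
      by (rule poly_mapping_sum_monomials[symmetric])
    have "Poly_Mapping.single (h i) (?c (h i)) - Poly_Mapping.single (?a i, ?b i) 1 \<in> PM.span rels" for i
    proof -
      have "Poly_Mapping.single (?a i, ?b i) 1 - Poly_Mapping.single (fst (h i), snd (h i)) (?c (h i)) \<in> rels"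
        unfolding bilinear_relators_def by blast
      then have "Poly_Mapping.single (?a i, ?b i) 1 - Poly_Mapping.single (h i) (?c (h i)) \<in> rels"
        by (simp only: prod.collapse)
      then show ?thesis by (rule span_diff_sym[OF PM.span_base])
    qed
    then have "(\<Sum>i<card ?K. Poly_Mapping.single (h i) (?c (h i)) - Poly_Mapping.single (?a i, ?b i) 1) \<in> PM.span rels"
      by (rule PM.span_sum)
    then have 1: "\<xi> - (\<Sum>i<card ?K. Poly_Mapping.single (?a i, ?b i) 1) \<in> PM.span rels"
      by (subst e1) (simp only: sum_subtractf)
    have "?s \<xi> = (\<Sum>x\<in>?K. scal (?c x) (ring_scomm gr (fst x) (snd x)))"
      by (simp add: plin_def case_prod_unfold)
    also have "\<dots> = (\<Sum>i<card ?K. scal (?c (h i)) (ring_scomm gr (fst (h i)) (snd (h i))))"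
      by (rule sum.reindex_bij_betw[OF h, symmetric])
    finally have "?s \<xi> = (\<Sum>i<card ?K. ring_scomm gr (?a i) (?b i))"
      by (simp add: scomm_scale_left)
    with 1 show ?thesis
      by (intro exI[of _ "card ?K"] exI[of _ ?a] exI[of _ ?b] conjI)
  qed
  show ?thesis
    unfolding c
  proof (intro equalityI subsetI)
    fix x assume "x \<in> {hdclass scal gr bar (\<Sum>i<N. Poly_Mapping.single (a i, b i) 1) | (N::nat) a b.
       (\<Sum>i<N. ring_scomm gr (a i) (b i)) = (\<Sum>i<N. bar (ring_scomm gr (a i) (b i)))}"
    then show "x \<in> hdclass scal gr bar ` {\<xi>. ?s \<xi> = bar (?s \<xi>)}"
      using s by (auto simp: bar_sum intro!: imageI)
  next
    fix x assume "x \<in> hdclass scal gr bar ` {\<xi>. ?s \<xi> = bar (?s \<xi>)}"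
    then obtain \<xi> where \<xi>: "x = hdclass scal gr bar \<xi>" "?s \<xi> = bar (?s \<xi>)" by blast
    obtain N :: nat and a b where n: "\<xi> - (\<Sum>i<N. Poly_Mapping.single (a i, b i) 1) \<in> PM.span rels"
      "?s \<xi> = (\<Sum>i<N. ring_scomm gr (a i) (b i))" using norm by blast
    have "x = hdclass scal gr bar (\<Sum>i<N. Poly_Mapping.single (a i, b i) 1)"
      using n(1) by (simp add: \<xi>(1) hdclass_eq_iff)
    moreover have "(\<Sum>i<N. ring_scomm gr (a i) (b i)) = (\<Sum>i<N. bar (ring_scomm gr (a i) (b i)))"
      using \<xi>(2) n(2) by (simp add: bar_sum)
    ultimately show "x \<in> {hdclass scal gr bar (\<Sum>i<N. Poly_Mapping.single (a i, b i) 1) | (N::nat) a b.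
       (\<Sum>i<N. ring_scomm gr (a i) (b i)) = (\<Sum>i<N. bar (ring_scomm gr (a i) (b i)))}" by blast
  qed
qed

lemma hd_ops: "hdclass scal gr bar x \<oplus>\<^bsub>skew_dihedral_HD1 scal gr bar\<^esub> hdclass scal gr bar y = hdclass scal gr bar (x + y)"
  "c \<odot>\<^bsub>skew_dihedral_HD1 scal gr bar\<^esub> hdclass scal gr bar x = hdclass scal gr bar (pm_scale c x)"
  by (simp_all add: skew_dihedral_HD1_def hdclass_add hdclass_smult)

section \<open>Surjectivity, centrality and kernel of an arbitrary canonical homomorphism\<close>

context
  fixes \<psi> :: "('k, ('m, 'n, 'r) sto_generator) lie_term set \<Rightarrow> ('m, 'n, 'r) smatrix"
  assumes \<psi>: "canonical_hom scal gr bar \<psi>"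
begin

lemma psi_hom: "lie_super_hom sto' osp' \<psi>"
  using \<psi> by (simp add: canonical_hom_def)

text \<open>The conditions of \<open>canonical_hom\<close> determine the value on every class, so an
  arbitrary \<open>\<psi>\<close> agrees with the matrix part of the model.\<close>

lemma psi_cl: "t \<in> LT \<Longrightarrow> \<psi> (cl t) = fst (mq t)"
proof (induction t)
  case (Gen x)
  then have "x \<in> X 0 \<or> x \<in> X 1" by simp
  then have "\<psi> (sto_element scal gr bar x) = osp_element gr bar x"
    using \<psi> unfolding canonical_hom_def by blast
  then show ?case by (simp add: sto_element_def gmq_def)
next
  case Zero
  \<comment> \<open>Preservation of zero is not a clause of \<open>lie_super_hom\<close>; it follows
    from additivity.\<close>
  have "\<psi> (cl Zero) + \<psi> (cl Zero) = \<psi> (cl Zero \<oplus>\<^bsub>sto'\<^esub> cl Zero)"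
    using psi_hom unfolding lie_super_hom_def by (auto simp: sto_ops)
  also have "cl Zero \<oplus>\<^bsub>sto'\<^esub> cl Zero = cl Zero"
    by (simp add: sto_ops cl_eq_iff pclass_Add)
  finally show ?case by simp
next
  case (Add s t)
  then have "\<psi> (cl s \<oplus>\<^bsub>sto'\<^esub> cl t) = \<psi> (cl s) + \<psi> (cl t)"
    using psi_hom unfolding lie_super_hom_def by (auto simp: sto_ops(5))
  then show ?case using Add by (simp add: sto_ops)
next
  case (Smul c s)
  then have "\<psi> (c \<odot>\<^bsub>sto'\<^esub> cl s) = ms c (\<psi> (cl s))"
    using psi_hom unfolding lie_super_hom_def by (auto simp: sto_ops(5))
  then show ?case using Smul by (simp add: sto_ops mqs_def)
next
  case (Br s t)
  then have "\<psi> (bracket sto' (cl s) (cl t)) = mbr (\<psi> (cl s)) (\<psi> (cl t))"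
    using psi_hom unfolding lie_super_hom_def by (auto simp: sto_ops(5))
  then show ?case using Br by (simp add: sto_ops mqbr_def)
qed

text \<open>The image is a subalgebra of the matrices that contains, up to signs and
  \<open>bar\<close>, all nondegenerate X_pq, so \<open>osp_carrier_least\<close> applies.\<close>

lemma psi_surj: "\<psi> ` carrier sto' = carrier osp'"
proof
  show "\<psi> ` carrier sto' \<subseteq> carrier osp'"
    by (auto simp: sto_ops psi_cl mq_in_osp)
  let ?S = "\<psi> ` carrier sto'"
  have S: "?S = (\<lambda>t. fst (mq t)) ` LT"
    by (auto simp: sto_ops psi_cl image_image)
  have "M.subspace ?S"
    unfolding S
  proof (rule M.subspaceI)
    show "0 \<in> (\<lambda>t. fst (mq t)) ` LT" by (intro image_eqI[of _ _ Zero]) auto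
  next
    fix x y assume "x \<in> (\<lambda>t. fst (mq t)) ` LT" "y \<in> (\<lambda>t. fst (mq t)) ` LT"
    then obtain s t where "s \<in> LT" "t \<in> LT" "x = fst (mq s)" "y = fst (mq t)" by blast
    then show "x + y \<in> (\<lambda>t. fst (mq t)) ` LT" by (intro image_eqI[of _ _ "Add s t"]) auto
  next
    fix c x assume "x \<in> (\<lambda>t. fst (mq t)) ` LT"
    then obtain s where "s \<in> LT" "x = fst (mq s)" by blast
    then show "ms c x \<in> (\<lambda>t. fst (mq t)) ` LT" by (intro image_eqI[of _ _ "Smul c s"]) (auto simp: mqs_def)
  qed
  note sub = this
  have gen: "XM (row_index q) (col_index q) a \<in> ?S" if "valid_kind q" "a \<in> gr d" for q a d
  proof -
    have "Gen (q, a) \<in> LT" unfolding Gen_in_lie_terms X_D using that by auto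
    then show ?thesis unfolding S by (intro image_eqI[of _ _ "Gen (q, a)"]) (auto simp: gmq_def osp_element_eq)
  qed
  have "osp_carrier scal gr bar \<subseteq> ?S"
  proof (rule osp_carrier_least[OF sub])
    fix x y assume "x \<in> ?S" "y \<in> ?S"
    then obtain s t where "s \<in> LT" "t \<in> LT" "x = fst (mq s)" "y = fst (mq t)" unfolding S by blast
    then show "mbr x y \<in> ?S" unfolding S by (intro image_eqI[of _ _ "Br s t"]) (auto simp: mqbr_def)
  next
    fix p q :: "'m + 'n + 'n" and a d
    assume pq: "q \<noteq> p" "q \<noteq> st p" and a: "a \<in> gr d"
    show "XM p q a \<in> ?S"
      using pq gen[OF _ a, of "T _ _"] gen[OF _ a, of "U _ _"] gen[OF _ a, of "V _ _"] gen[OF _ a, of "W _ _"]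
        gen[OF _ a, of "F _ _"] gen[OF _ a, of "G _ _"] gen[OF _ cj_gr[OF a], of "F _ _"] gen[OF _ cj_gr[OF a], of "G _ _"]
        gen[OF _ bar_gr[OF a], of "U _ _"] M.subspace_neg[OF sub]
      by (cases p rule: index_cases; cases q rule: index_cases) (auto simp: XM_F XM_G XM_U)
  qed
  then show "carrier osp' \<subseteq> ?S" by simp
qed

lemma psi_kernel: "a_kernel sto' osp' \<psi> = cl ` {t \<in> LT. fst (mq t) = 0}"
  by (auto simp: a_kernel_def' sto_ops psi_cl)

text \<open>\<open>kernel_central\<close> treats homogeneous elements. The two components of a
  kernel element lie in the kernel again, because the grading of the matrices is direct.\<close>

lemma psi_central: "a_kernel sto' osp' \<psi> \<subseteq> lie_center sto'"
proof
  fix A assume "A \<in> a_kernel sto' osp' \<psi>"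
  then obtain t where t: "A = cl t" "t \<in> LT" "fst (mq t) = 0" by (auto simp: psi_kernel)
  obtain t0 t1 where h: "homogeneous_term X 0 t0" "homogeneous_term X 1 t1" "pc t = pc t0 + pc t1"
    using homogeneous_decomposition[OF t(2), of Rel] by (auto simp: pgrade_def)
  note hl = h(1,2)[THEN homogeneous_in_lie_terms]
  have "(t, Add t0 t1) \<in> lie_cong X Rel"
    using hl t(2) h(3) pclass_eq_iff[of t X "Add t0 t1" Rel] by (simp add: pclass_Add)
  then have sum: "mq t = mq t0 + mq t1" using mq_cong by fastforce
  have g: "fst (mq t0) \<in> mg 0" "fst (mq t1) \<in> mg 1"
    using mq_homogeneous[OF h(1)] mq_homogeneous[OF h(2)] by (simp_all add: mem_Times_iff)
  have "fst (mq t0) = 0 \<and> fst (mq t1) = 0"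
    by (rule M.gr_unique[of _ 0]) (use g sum t(3) in \<open>auto simp: M.subspace_0 M.gr_sub\<close>)
  then have z: "Lbr (C.ev s) (C.ev u) = 0" if su: "s = t0 \<or> s = t1" "u \<in> LT" for s u
  proof -
    obtain d where d: "homogeneous_term X d s" using su h by blast
    have s: "s \<in> LT" using d by (rule homogeneous_in_lie_terms)
    have p: "fst (snd (C.ev s)) = 0" using that \<open>fst (mq t0) = 0 \<and> fst (mq t1) = 0\<close> s by (auto simp: ev_eq)
    obtain \<xi> where \<xi>: "C.ev s = C.Lam \<xi>" by (rule C.kernel_Lam[OF s p])
    have "C.ev s \<in> LH d"
      unfolding ev_eq[OF s] using d mq_homogeneous[OF d] by (auto simp: pgrade_def)
    from this p show ?thesis unfolding \<xi> by (rule C.kernel_central[OF _ _ su(2)])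
  qed
  have "bracket sto' A (cl u) = \<zero>\<^bsub>sto'\<^esub>" if "u \<in> LT" for u
  proof -
    have "pbr (pc t0) (pc u) = 0" "pbr (pc t1) (pc u) = 0"
      using z[of t0 u] z[of t1 u] that hl by (auto simp: ev_eq zero_prod_def)
    then have "pc (Br t u) = pc Zero" using t(2) that h(3) by (simp add: pclass_Br pbr_add_left)
    then show ?thesis using t that by (simp add: sto_ops cl_eq_iff)
  qed
  then show "A \<in> lie_center sto'" using t by (auto simp: lie_center_def sto_ops)
qed

lemma psi_central_extension: "central_extension sto' osp' \<psi>"
  unfolding central_extension_def
  using sto_lie_superalgebra osp_lie_superalgebra psi_hom psi_surj psi_central by blast

text \<open>A kernel element is some \<open>Lam \<xi>\<close>; the class of \<open>\<xi>\<close> in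
  the homology module is its image. Conversely, every \<open>Lam \<xi>\<close> satisfying the
  homology condition is the value of a term in the kernel.\<close>

lemma psi_kernel_iso:
  "modules_isomorphic (sto'\<lparr>carrier := a_kernel sto' osp' \<psi>\<rparr>) (skew_dihedral_HD1 scal gr bar)"
proof -
  \<comment> \<open>The choice of \<open>\<xi>\<close> does not matter: equality of the
    \<open>Lam\<close> and equality of the \<open>hdclass\<close> are characterised by the same
    span.\<close>
  define h where "h A = hdclass scal gr bar (SOME \<xi>. \<exists>t\<in>LT. A = cl t \<and> C.ev t = C.Lam \<xi>)" for A
  have h: "h (cl t) = hdclass scal gr bar \<xi>" if "t \<in> LT" "C.ev t = C.Lam \<xi>" for t \<xi>
  proof -
    have "\<exists>s\<in>LT. cl t = cl s \<and> C.ev s = C.Lam (SOME \<xi>. \<exists>s\<in>LT. cl t = cl s \<and> C.ev s = C.Lam \<xi>)"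
      by (rule someI[of "\<lambda>\<xi>. \<exists>s\<in>LT. cl t = cl s \<and> C.ev s = C.Lam \<xi>" \<xi>]) (use that in blast)
    then obtain s where s: "s \<in> LT" "cl t = cl s"
      "C.ev s = C.Lam (SOME \<xi>. \<exists>s\<in>LT. cl t = cl s \<and> C.ev s = C.Lam \<xi>)" by blast
    have pc: "pc t = pc s" using s(2) cl_eq_iff[OF that(1) s(1)] by blast
    have cong: "(t, s) \<in> lie_cong X Rel" using pc pclass_eq_iff[OF that(1) s(1), of Rel] by blast
    have "C.ev t = C.ev s"
      unfolding ev_eq[OF that(1)] ev_eq[OF s(1)] by (simp only: pc mq_cong[OF cong])
    then have "C.Lam (SOME \<xi>. \<exists>s\<in>LT. cl t = cl s \<and> C.ev s = C.Lam \<xi>) = C.Lam \<xi>"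
      using that(2) s(3) by (simp only:)
    then show ?thesis unfolding h_def hdclass_eq_iff Lam_eq_iff .
  qed
  let ?K = "{t \<in> LT. fst (mq t) = 0}"
  let ?Z = "{\<xi>. plin scal (\<lambda>(a, b). ring_scomm gr a b) \<xi> = bar (plin scal (\<lambda>(a, b). ring_scomm gr a b) \<xi>)}"
  have ex: "\<exists>\<xi>\<in>?Z. C.ev t = C.Lam \<xi>" if "t \<in> ?K" for t
  proof -
    have t: "t \<in> LT" "fst (snd (C.ev t)) = 0" using that by (auto simp: ev_eq)
    obtain \<xi> where "C.ev t = C.Lam \<xi>" by (rule C.kernel_Lam[OF t])
    then show ?thesis using t C.psi_Lam_eq_0_iff[of \<xi>] by auto
  qed
  have ex': "\<exists>t\<in>?K. C.ev t = C.Lam \<xi>" if \<xi>: "\<xi> \<in> ?Z" for \<xi>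
  proof -
    obtain t where t: "t \<in> LT" "C.ev t = C.Lam \<xi>" using Lam_in_range by blast
    then have "fst (snd (C.ev t)) = 0" using \<xi> C.psi_Lam_eq_0_iff[of \<xi>] by auto
    then have K: "t \<in> ?K" using t(1) unfolding ev_eq[OF t(1)] by simp
    show ?thesis
    proof (rule bexI[of _ t])
      show "C.ev t = C.Lam \<xi>" by (rule t(2))
      show "t \<in> ?K" by (rule K)
    qed
  qed
  have inj: "inj_on h (cl ` ?K)"
  proof (rule inj_onI)
    fix A B assume "A \<in> cl ` ?K" "B \<in> cl ` ?K" and eq: "h A = h B"
    then obtain s t where st: "A = cl s" "B = cl t" "s \<in> ?K" "t \<in> ?K" by blast
    obtain \<xi> \<eta> where x: "C.ev s = C.Lam \<xi>" "C.ev t = C.Lam \<eta>" using ex st by blast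
    have "C.Lam \<xi> = C.Lam \<eta>"
    proof -
      have "s \<in> LT" "t \<in> LT" using st by simp_all
      then have "hdclass scal gr bar \<xi> = hdclass scal gr bar \<eta>"
        using eq h[OF _ x(1)] h[OF _ x(2)] st(1,2) by (simp only:)
      then show ?thesis unfolding Lam_eq_iff hdclass_eq_iff .
    qed
    then have "C.ev s = C.ev t" using x by (simp only:)
    \<comment> \<open>The first coordinate of the model is the class in \<open>sto\<close>, so equal
      values come from equal classes.\<close>
    moreover have "C.ev s = (pc s, mq s)" "C.ev t = (pc t, mq t)" using st by (intro ev_eq; simp)+
    ultimately have "pc s = pc t" by (simp only: prod.inject)
    then show "A = B" using st by (simp add: cl_eq_iff)
  qed
  have img: "h ` cl ` ?K = hdclass scal gr bar ` ?Z"
  proof (intro equalityI subsetI)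
    fix y assume "y \<in> h ` cl ` ?K"
    then obtain t where t: "t \<in> ?K" "y = h (cl t)" by blast
    obtain \<xi> where "\<xi> \<in> ?Z" "C.ev t = C.Lam \<xi>" using ex[OF t(1)] by blast
    then show "y \<in> hdclass scal gr bar ` ?Z" using h[of t \<xi>] t by auto
  next
    fix y assume "y \<in> hdclass scal gr bar ` ?Z"
    then obtain \<xi> where \<xi>: "\<xi> \<in> ?Z" "y = hdclass scal gr bar \<xi>" by blast
    obtain t where "t \<in> ?K" "C.ev t = C.Lam \<xi>" using ex'[OF \<xi>(1)] by blast
    then show "y \<in> h ` cl ` ?K" using h[of t \<xi>] \<xi> by auto
  qed
  show ?thesis
    unfolding modules_isomorphic_def
  proof (intro exI[of _ h] conjI ballI allI)
    show "bij_betw h (carrier (sto'\<lparr>carrier := a_kernel sto' osp' \<psi>\<rparr>)) (carrier (skew_dihedral_HD1 scal gr bar))"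
      using inj img by (simp add: bij_betw_def psi_kernel hd_carrier)
  next
    fix A B assume "A \<in> carrier (sto'\<lparr>carrier := a_kernel sto' osp' \<psi>\<rparr>)" "B \<in> carrier (sto'\<lparr>carrier := a_kernel sto' osp' \<psi>\<rparr>)"
    then obtain s t where st: "A = cl s" "B = cl t" "s \<in> ?K" "t \<in> ?K" by (auto simp: psi_kernel)
    obtain \<xi> \<eta> where x: "C.ev s = C.Lam \<xi>" "C.ev t = C.Lam \<eta>" using ex st by blast
    have "C.ev (Add s t) = C.Lam (\<xi> + \<eta>)" unfolding C.L.plin_add using x by simp
    then have "h (cl (Add s t)) = hdclass scal gr bar (\<xi> + \<eta>)" using h[of "Add s t" "\<xi> + \<eta>"] st by simp
    then show "h (A \<oplus>\<^bsub>sto'\<lparr>carrier := a_kernel sto' osp' \<psi>\<rparr>\<^esub> B) = h A \<oplus>\<^bsub>skew_dihedral_HD1 scal gr bar\<^esub> h B"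
      using h[of s \<xi>] h[of t \<eta>] st x by (simp add: sto_ops hd_ops)
  next
    fix c A assume "A \<in> carrier (sto'\<lparr>carrier := a_kernel sto' osp' \<psi>\<rparr>)"
    then obtain s where st: "A = cl s" "s \<in> ?K" by (auto simp: psi_kernel)
    obtain \<xi> where x: "C.ev s = C.Lam \<xi>" using ex st by blast
    have "C.ev (Smul c s) = C.Lam (pm_scale c \<xi>)" unfolding C.L.plin_scale using x by simp
    then have "h (cl (Smul c s)) = hdclass scal gr bar (pm_scale c \<xi>)" using h[of "Smul c s" "pm_scale c \<xi>"] st by simp
    then show "h (c \<odot>\<^bsub>sto'\<lparr>carrier := a_kernel sto' osp' \<psi>\<rparr>\<^esub> A) = c \<odot>\<^bsub>skew_dihedral_HD1 scal gr bar\<^esub> h A"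
      using h[of s \<xi>] st x by (simp add: sto_ops hd_ops)
  qed
qed

end

end

theorem theorem4p7:
  fixes scal :: "'k::comm_ring_1 \<Rightarrow> 'r::ring_1 \<Rightarrow> 'r"
    and gr :: "bit \<Rightarrow> 'r set"
    and bar :: "'r \<Rightarrow> 'r"
  assumes two_invertible: "(2 :: 'k) dvd 1"
    and R: "superalgebra_with_superinvolution scal gr bar"
    and mn: "(CARD('m::finite), CARD('n::finite)) \<noteq> (1, 1)"
  shows "(\<exists>\<psi> :: ('k, ('m, 'n, 'r) sto_generator) lie_term set \<Rightarrow> ('m, 'n, 'r) smatrix.
            canonical_hom scal gr bar \<psi>) \<and>
    (\<forall>\<psi> :: ('k, ('m, 'n, 'r) sto_generator) lie_term set \<Rightarrow> ('m, 'n, 'r) smatrix.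
        canonical_hom scal gr bar \<psi> \<longrightarrow>
          central_extension (sto scal gr bar) (osp scal gr bar) \<psi> \<and>
          modules_isomorphic
            ((sto scal gr bar)\<lparr>carrier := a_kernel (sto scal gr bar) (osp scal gr bar) \<psi>\<rparr>)
            (skew_dihedral_HD1 scal gr bar))"
proof -
  obtain half :: 'k where "1 = 2 * half" using two_invertible by (rule dvdE)
  then have half: "half + half = 1" by simp
  interpret superalgebra_with_superinvolution scal gr bar by (rule R)
  interpret sto_setup scal gr bar "TYPE('m \<times> 'n)" half
    by unfold_locales (fact half mn)+
  show ?thesis
    using canonical_hom_exists psi_central_extension psi_kernel_iso by blast
qed

end
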